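(* Let $G=[3^k,\infty^l,3^m]$ with $k+l+m=n-1$ and $k,l,m\ge1$, realized by the basic system $b_0,\dots,b_{n-1}$ with $b_i\cdot b_i=1$ for all $i$, $b_{j-1}\cdot b_j=-1/2$ when the $j$-th period is $3$, $b_{j-1}\cdot b_j=-1$ when the $j$-th period is $\infty$, and $b_i\cdot b_j=0$ for $|i-j|\ge2$; let $p$ be an odd prime. Then (a) $G^p=[3,\infty^l,3]^p$ (with $n=l+3$, $l\ge1$) is a string C-group, except possibly when $p=7$ and $l\ge4$ with $l\equiv1\pmod 3$; (b) $G^p=[3^k,\infty^l,3^m]^p$ with $k>1$ or $m>1$ (and $l\ge1$) is a string C-group for all but finitely many primes $p$.
   Context: $[3^k,\infty^l,3^m]$ denotes the string Coxeter group whose periods are $k$ threes, then $l$ infinities, then $m$ threes (so the $j$-th period is the order of $r_{j-1}r_j$); it is represented on $\mathbb{R}^n$ by $r_i(x)=x-2(x\cdot b_i)b_i$. $G^p\le GL_n(\mathbb{Z}_p)$ is generated by the reductions mod $p$ of the $r_i$ (still denoted $r_i$). $G^p$ is a string C-group if $\langle r_i:i\in I\rangle\cap\langle r_i:i\in J\rangle=\langle r_i:i\in I\cap J\rangle$ for all $I,J\subseteq\{0,\dots,n-1\}$. *)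

theory Defs
  imports
    Jordan_Normal_Form.Matrix
    "HOL-Algebra.Generated_Groups"
    "HOL-Library.Extended_Nat"
    "HOL-Computational_Algebra.Primes"
begin

section \<open>The Coxeter group \<open>[3\<^sup>k, \<infinity>\<^sup>l, 3\<^sup>m]\<close> acting on real \<open>n\<close>-space\<close>

text \<open>
  The rank is \<open>n = k + l + m + 1\<close>; the generators are \<open>r\<^sub>0, \<dots>, r\<^sub>n\<^sub>-\<^sub>1\<close> and the \<open>j\<close>-th period
  (\<open>1 \<le> j \<le> n - 1\<close>) is the order of \<open>r\<^sub>j\<^sub>-\<^sub>1 r\<^sub>j\<close>.
\<close>

definition cox_rank :: "nat \<Rightarrow> nat \<Rightarrow> nat \<Rightarrow> nat" where
  "cox_rank k l m = k + l + m + 1"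

definition period :: "nat \<Rightarrow> nat \<Rightarrow> nat \<Rightarrow> nat \<Rightarrow> enat" where
  "period k l m j = (if j \<le> k then 3 else if j \<le> k + l then \<infinity> else 3)"

text \<open>The prescribed inner products \<open>b\<^sub>i \<cdot> b\<^sub>j\<close> of the basic system.\<close>

definition gram :: "nat \<Rightarrow> nat \<Rightarrow> nat \<Rightarrow> real mat" where
  "gram k l m = mat (cox_rank k l m) (cox_rank k l m) (\<lambda>(i, j).
     if i = j then 1
     else if j = Suc i \<or> i = Suc j
       then (if period k l m (max i j) = 3 then - 1 / 2 else - 1)
     else 0)"

text \<open>
  Vectors of real \<open>n\<close>-space are written in coordinates with respect to the basis
  \<open>b\<^sub>0, \<dots>, b\<^sub>n\<^sub>-\<^sub>1\<close>, so \<open>b\<^sub>i\<close> is the \<open>i\<close>-th unit vector. The dot product below is the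
  symmetric bilinear form with the prescribed Gram matrix (not the Euclidean one).
\<close>

definition basic_vec :: "nat \<Rightarrow> nat \<Rightarrow> nat \<Rightarrow> nat \<Rightarrow> real vec" where
  "basic_vec k l m i = unit_vec (cox_rank k l m) i"

definition bform :: "nat \<Rightarrow> nat \<Rightarrow> nat \<Rightarrow> real vec \<Rightarrow> real vec \<Rightarrow> real" where
  "bform k l m x y = x \<bullet> (gram k l m *\<^sub>v y)"

definition reflection :: "nat \<Rightarrow> nat \<Rightarrow> nat \<Rightarrow> nat \<Rightarrow> real vec \<Rightarrow> real vec" where
  "reflection k l m i x =
     x - (2 * bform k l m x (basic_vec k l m i)) \<cdot>\<^sub>v basic_vec k l m i"

text \<open>The matrix of \<open>r\<^sub>i\<close> in the basis \<open>b\<^sub>0, \<dots>, b\<^sub>n\<^sub>-\<^sub>1\<close>: its \<open>j\<close>-th column is \<open>r\<^sub>i(b\<^sub>j)\<close>.\<close>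

definition refl_mat :: "nat \<Rightarrow> nat \<Rightarrow> nat \<Rightarrow> nat \<Rightarrow> real mat" where
  "refl_mat k l m i =
     mat (cox_rank k l m) (cox_rank k l m) (\<lambda>(a, j). reflection k l m i (basic_vec k l m j) $ a)"

section \<open>The general linear group over the integers modulo \<open>p\<close>\<close>

text \<open>
  Residue classes modulo \<open>p\<close> are represented by the integers \<open>0, \<dots>, p - 1\<close>, as in
  the library ring \<open>residue_ring\<close>.
\<close>

definition mod_mat :: "nat \<Rightarrow> int mat \<Rightarrow> int mat" where
  "mod_mat p A = map_mat (\<lambda>x. x mod int p) A"

definition mat_monoid :: "nat \<Rightarrow> nat \<Rightarrow> int mat monoid" where
  "mat_monoid n p =
     \<lparr> carrier = {A \<in> carrier_mat n n. \<forall>i<n. \<forall>j<n. A $$ (i, j) \<in> {0..<int p}},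
       mult = (\<lambda>A B. mod_mat p (A * B)),
       one = mod_mat p (1\<^sub>m n) \<rparr>"

definition GL :: "nat \<Rightarrow> nat \<Rightarrow> int mat monoid" where
  "GL n p = units_of (mat_monoid n p)"

section \<open>Reduction modulo \<open>p\<close> and string C-groups\<close>

text \<open>
  The entries of \<^const>\<open>refl_mat\<close> are integers (lemma \<open>refl_mat_integral\<close> below), so taking
  the floor only changes the type.
\<close>

definition red_refl :: "nat \<Rightarrow> nat \<Rightarrow> nat \<Rightarrow> nat \<Rightarrow> nat \<Rightarrow> int mat" where
  "red_refl k l m p i = mod_mat p (map_mat floor (refl_mat k l m i))"

text \<open>
  The intersection property for the group generated by \<open>r\<^sub>0, \<dots>, r\<^sub>n\<^sub>-\<^sub>1\<close>. The remaining
  requirements on a string C-group, namely that the \<open>r\<^sub>i\<close> are involutions and that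
  \<open>r\<^sub>i r\<^sub>j = r\<^sub>j r\<^sub>i\<close> for \<open>\<bar>i - j\<bar> \<ge> 2\<close>, hold for every reduced group considered here
  (lemmas \<open>red_refl_involution\<close> and \<open>red_refl_commute\<close>).
\<close>

definition string_C_group :: "('g, 'x) monoid_scheme \<Rightarrow> nat \<Rightarrow> (nat \<Rightarrow> 'g) \<Rightarrow> bool" where
  "string_C_group G n r \<longleftrightarrow>
     (\<forall>I J. I \<subseteq> {0..<n} \<longrightarrow> J \<subseteq> {0..<n} \<longrightarrow>
        generate G (r ` I) \<inter> generate G (r ` J) = generate G (r ` (I \<inter> J)))"

definition reduction_string_C :: "nat \<Rightarrow> nat \<Rightarrow> nat \<Rightarrow> nat \<Rightarrow> bool" where
  "reduction_string_C k l m p \<longleftrightarrow>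
     string_C_group (GL (cox_rank k l m) p) (cox_rank k l m) (red_refl k l m p)"

section \<open>Well-definedness\<close>

lemma bform_basic_vec:
  assumes "i < cox_rank k l m" "j < cox_rank k l m"
  shows "bform k l m (basic_vec k l m i) (basic_vec k l m j) = gram k l m $$ (i, j)"
proof -
  have G: "gram k l m \<in> carrier_mat (cox_rank k l m) (cox_rank k l m)"
    by (simp add: gram_def)
  have "bform k l m (basic_vec k l m i) (basic_vec k l m j)
        = (gram k l m *\<^sub>v unit_vec (cox_rank k l m) j) $ i"
    unfolding bform_def basic_vec_def
    using assms G by (intro scalar_prod_left_unit) auto
  also have "\<dots> = gram k l m $$ (i, j)"
    using assms G by (simp add: scalar_prod_right_unit)
  finally show ?thesis .
qed

lemma refl_mat_entry:
  assumes "i < cox_rank k l m" "a < cox_rank k l m" "j < cox_rank k l m"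
  shows "refl_mat k l m i $$ (a, j)
       = (if a = j then 1 else 0) - (if a = i then 2 * gram k l m $$ (j, i) else 0)"
  using assms bform_basic_vec[of j k l m i]
  by (simp add: refl_mat_def reflection_def basic_vec_def)

definition int_refl :: "nat \<Rightarrow> nat \<Rightarrow> nat \<Rightarrow> nat \<Rightarrow> int mat" where
  "int_refl k l m i = map_mat floor (refl_mat k l m i)"

definition cartan :: "nat \<Rightarrow> nat \<Rightarrow> nat \<Rightarrow> nat \<Rightarrow> nat \<Rightarrow> int" where
  "cartan k l m j i = (if i = j then 2
     else if j = Suc i \<or> i = Suc j
       then (if period k l m (max i j) = 3 then - 1 else - 2)
     else 0)"

lemma gram_cartan:
  assumes "i < cox_rank k l m" "j < cox_rank k l m"
  shows "2 * gram k l m $$ (j, i) = of_int (cartan k l m j i)"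
  using assms by (auto simp: gram_def cartan_def max.commute)

lemma refl_mat_integral:
  assumes "i < cox_rank k l m" "a < cox_rank k l m" "j < cox_rank k l m"
  shows "refl_mat k l m i $$ (a, j) \<in> \<int>"
  using assms by (auto simp: refl_mat_entry gram_cartan)

lemma int_refl_carrier [simp]:
  "int_refl k l m i \<in> carrier_mat (cox_rank k l m) (cox_rank k l m)"
  by (simp add: int_refl_def refl_mat_def)

lemma int_refl_dim [simp]:
  "dim_row (int_refl k l m i) = cox_rank k l m" "dim_col (int_refl k l m i) = cox_rank k l m"
  by (simp_all add: int_refl_def refl_mat_def)

lemma int_refl_entry:
  assumes "i < cox_rank k l m" "a < cox_rank k l m" "j < cox_rank k l m"
  shows "int_refl k l m i $$ (a, j)
       = (if a = j then 1 else 0) - (if a = i then cartan k l m j i else 0)"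
proof -
  have *: "refl_mat k l m i $$ (a, j)
        = of_int ((if a = j then 1 else 0) - (if a = i then cartan k l m j i else 0))"
    using assms by (simp add: refl_mat_entry gram_cartan)
  have "int_refl k l m i $$ (a, j) = floor (refl_mat k l m i $$ (a, j))"
    using assms by (simp add: int_refl_def refl_mat_def)
  then show ?thesis unfolding * by (simp only: floor_of_int)
qed

lemma int_refl_mult_entry:
  assumes "i < cox_rank k l m" "i' < cox_rank k l m" "a < cox_rank k l m" "j < cox_rank k l m"
  shows "(int_refl k l m i * int_refl k l m i') $$ (a, j)
       = int_refl k l m i' $$ (a, j)
         - (if a = i then \<Sum>c<cox_rank k l m. cartan k l m c i * int_refl k l m i' $$ (c, j) else 0)"
proof -
  let ?n = "cox_rank k l m"
  have "(int_refl k l m i * int_refl k l m i') $$ (a, j)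
      = (\<Sum>c<?n. int_refl k l m i $$ (a, c) * int_refl k l m i' $$ (c, j))"
    using assms by (simp add: scalar_prod_def atLeast0LessThan)
  also have "\<dots> = (\<Sum>c<?n. (if c = a then int_refl k l m i' $$ (c, j) else 0)
      - (if a = i then cartan k l m c i * int_refl k l m i' $$ (c, j) else 0))"
    using assms by (intro sum.cong) (auto simp: int_refl_entry algebra_simps)
  also have "\<dots> = int_refl k l m i' $$ (a, j)
      - (if a = i then \<Sum>c<?n. cartan k l m c i * int_refl k l m i' $$ (c, j) else 0)"
    using assms by (simp add: sum_subtractf)
  finally show ?thesis .
qed

lemma sum_cartan_int_refl:
  assumes "i < cox_rank k l m" "i' < cox_rank k l m" "j < cox_rank k l m"
  shows "(\<Sum>c<cox_rank k l m. cartan k l m c i * int_refl k l m i' $$ (c, j))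
       = cartan k l m j i - cartan k l m i' i * cartan k l m j i'"
proof -
  let ?n = "cox_rank k l m"
  have "(\<Sum>c<?n. cartan k l m c i * int_refl k l m i' $$ (c, j))
      = (\<Sum>c<?n. (if c = j then cartan k l m c i else 0)
          - (if c = i' then cartan k l m c i * cartan k l m j i' else 0))"
    using assms by (intro sum.cong) (auto simp: int_refl_entry algebra_simps)
  also have "\<dots> = cartan k l m j i - cartan k l m i' i * cartan k l m j i'"
    using assms by (simp add: sum_subtractf)
  finally show ?thesis .
qed

lemma int_refl_mult_entry':
  assumes "i < cox_rank k l m" "i' < cox_rank k l m" "a < cox_rank k l m" "j < cox_rank k l m"
  shows "(int_refl k l m i * int_refl k l m i') $$ (a, j)
       = int_refl k l m i' $$ (a, j)
         - (if a = i then cartan k l m j i - cartan k l m i' i * cartan k l m j i' else 0)"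
  by (simp only: int_refl_mult_entry[OF assms] sum_cartan_int_refl[OF assms(1,2,4)])

lemma int_refl_involution:
  assumes "i < cox_rank k l m"
  shows "int_refl k l m i * int_refl k l m i = 1\<^sub>m (cox_rank k l m)"
proof (rule eq_matI)
  fix a j
  assume "a < dim_row (1\<^sub>m (cox_rank k l m) :: int mat)" "j < dim_col (1\<^sub>m (cox_rank k l m) :: int mat)"
  then show "(int_refl k l m i * int_refl k l m i) $$ (a, j) = 1\<^sub>m (cox_rank k l m) $$ (a, j)"
    using assms by (simp add: int_refl_mult_entry' int_refl_entry cartan_def
        del: index_mult_mat)
qed simp_all

lemma int_refl_commute:
  assumes "i < cox_rank k l m" "j < cox_rank k l m" "i + 2 \<le> j"
  shows "int_refl k l m i * int_refl k l m j = int_refl k l m j * int_refl k l m i"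
proof (rule eq_matI)
  fix a c
  assume "a < dim_row (int_refl k l m j * int_refl k l m i)"
    and "c < dim_col (int_refl k l m j * int_refl k l m i)"
  then have ac: "a < cox_rank k l m" "c < cox_rank k l m"
    by simp_all
  have "cartan k l m i j = 0" "cartan k l m j i = 0"
    using assms by (auto simp: cartan_def)
  with ac assms show "(int_refl k l m i * int_refl k l m j) $$ (a, c)
      = (int_refl k l m j * int_refl k l m i) $$ (a, c)"
    by (simp add: int_refl_mult_entry' int_refl_entry del: index_mult_mat)
qed simp_all

lemma mod_mat_mult:
  assumes "A \<in> carrier_mat n n" "B \<in> carrier_mat n n"
  shows "mod_mat p (mod_mat p A * B) = mod_mat p (A * B)"
    and "mod_mat p (A * mod_mat p B) = mod_mat p (A * B)"
proof -
  have 1: "(\<Sum>c = 0..<n. (f c mod int p) * g c) mod int p = (\<Sum>c = 0..<n. f c * g c) mod int p"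
    for f g
  proof -
    have "(\<Sum>c = 0..<n. ((f c mod int p) * g c) mod int p) = (\<Sum>c = 0..<n. (f c * g c) mod int p)"
      by (simp only: mod_mult_left_eq)
    then show ?thesis by (metis (no_types) mod_sum_eq)
  qed
  have 2: "(\<Sum>c = 0..<n. g c * (f c mod int p)) mod int p = (\<Sum>c = 0..<n. g c * f c) mod int p"
    for f g
    using 1[of f g] by (simp only: mult.commute)
  show "mod_mat p (mod_mat p A * B) = mod_mat p (A * B)"
    "mod_mat p (A * mod_mat p B) = mod_mat p (A * B)"
    using assms by (auto intro!: eq_matI simp: mod_mat_def scalar_prod_def 1 2)
qed

lemma mod_mat_carrier:
  assumes "A \<in> carrier_mat n n" "p > 0"
  shows "mod_mat p A \<in> carrier (mat_monoid n p)"
  using assms by (auto simp: mat_monoid_def mod_mat_def)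

lemma mod_mat_id:
  assumes "A \<in> carrier (mat_monoid n p)"
  shows "mod_mat p A = A"
  using assms by (auto intro!: eq_matI simp: mat_monoid_def mod_mat_def)

lemma monoid_mat_monoid:
  assumes "p > 0"
  shows "monoid (mat_monoid n p)"
proof (rule monoidI)
  have c: "A \<in> carrier_mat n n" if "A \<in> carrier (mat_monoid n p)" for A
    using that by (simp add: mat_monoid_def)
  show "x \<otimes>\<^bsub>mat_monoid n p\<^esub> y \<in> carrier (mat_monoid n p)"
    if "x \<in> carrier (mat_monoid n p)" "y \<in> carrier (mat_monoid n p)" for x y
    using mod_mat_carrier[OF mult_carrier_mat[OF c c] assms, OF that]
    by (simp add: mat_monoid_def)
  show "\<one>\<^bsub>mat_monoid n p\<^esub> \<in> carrier (mat_monoid n p)"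
    using mod_mat_carrier[OF one_carrier_mat assms] by (simp add: mat_monoid_def)
  show "x \<otimes>\<^bsub>mat_monoid n p\<^esub> y \<otimes>\<^bsub>mat_monoid n p\<^esub> z
      = x \<otimes>\<^bsub>mat_monoid n p\<^esub> (y \<otimes>\<^bsub>mat_monoid n p\<^esub> z)"
    if "x \<in> carrier (mat_monoid n p)" "y \<in> carrier (mat_monoid n p)"
      "z \<in> carrier (mat_monoid n p)" for x y z
    using c[OF that(1)] c[OF that(2)] c[OF that(3)]
    by (simp add: mat_monoid_def mod_mat_mult[where n = n] assoc_mult_mat[where ?n\<^sub>1 = n])
  show "\<one>\<^bsub>mat_monoid n p\<^esub> \<otimes>\<^bsub>mat_monoid n p\<^esub> x = x"
    "x \<otimes>\<^bsub>mat_monoid n p\<^esub> \<one>\<^bsub>mat_monoid n p\<^esub> = x"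
    if "x \<in> carrier (mat_monoid n p)" for x
    using c[OF that] mod_mat_id[OF that]
    by (simp_all add: mat_monoid_def mod_mat_mult[where n = n])
qed

lemma group_GL:
  assumes "p > 0"
  shows "group (GL n p)"
  unfolding GL_def by (rule monoid.units_group[OF monoid_mat_monoid[OF assms]])

lemma red_refl_int_refl: "red_refl k l m p i = mod_mat p (int_refl k l m i)"
  by (simp add: red_refl_def int_refl_def)

lemma red_refl_involution:
  assumes "i < cox_rank k l m"
  shows "red_refl k l m p i \<otimes>\<^bsub>GL (cox_rank k l m) p\<^esub> red_refl k l m p i = \<one>\<^bsub>GL (cox_rank k l m) p\<^esub>"
proof -
  have "mod_mat p (int_refl k l m i) \<in> carrier_mat (cox_rank k l m) (cox_rank k l m)"
    by (simp add: mod_mat_def)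
  then show ?thesis
    using int_refl_involution[OF assms]
    by (simp add: GL_def units_of_def mat_monoid_def red_refl_int_refl
        mod_mat_mult[where n = "cox_rank k l m"])
qed

lemma red_refl_carrier:
  assumes "i < cox_rank k l m" "p > 0"
  shows "red_refl k l m p i \<in> carrier (GL (cox_rank k l m) p)"
proof -
  have "red_refl k l m p i \<in> carrier (mat_monoid (cox_rank k l m) p)"
    using mod_mat_carrier[OF int_refl_carrier assms(2)] by (simp add: red_refl_int_refl)
  then show ?thesis
    using red_refl_involution[OF assms(1), of p]
    by (auto simp: GL_def units_of_def Units_def)
qed

lemma red_refl_ne_one:
  assumes "i < cox_rank k l m" "p > 2"
  shows "red_refl k l m p i \<noteq> \<one>\<^bsub>GL (cox_rank k l m) p\<^esub>"
proof
  assume "red_refl k l m p i = \<one>\<^bsub>GL (cox_rank k l m) p\<^esub>"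
  then have "mod_mat p (int_refl k l m i) $$ (i, i) = mod_mat p (1\<^sub>m (cox_rank k l m)) $$ (i, i)"
    by (simp add: GL_def units_of_def mat_monoid_def red_refl_int_refl)
  then have "(- 1) mod int p = 1 mod int p"
    using assms
    by (simp add: mod_mat_def int_refl_entry cartan_def)
  then have "int p dvd 2"
    by (metis mod_eq_dvd_iff diff_minus_eq_add dvd_minus_iff minus_diff_eq one_add_one)
  with assms(2) show False by (auto dest: zdvd_imp_le)
qed

lemma red_refl_commute:
  assumes "i < cox_rank k l m" "j < cox_rank k l m" "i + 2 \<le> j"
  shows "red_refl k l m p i \<otimes>\<^bsub>GL (cox_rank k l m) p\<^esub> red_refl k l m p j
       = red_refl k l m p j \<otimes>\<^bsub>GL (cox_rank k l m) p\<^esub> red_refl k l m p i"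
proof -
  have "mod_mat p (int_refl k l m i) \<in> carrier_mat (cox_rank k l m) (cox_rank k l m)" for i
    by (simp add: mod_mat_def)
  then show ?thesis
    using int_refl_commute[OF assms]
    by (simp add: GL_def units_of_def mat_monoid_def red_refl_int_refl
        mod_mat_mult[where n = "cox_rank k l m"])
qed

end

theory Submission
  imports Defs "HOL-Number_Theory.Cong" "HOL-Combinatorics.Permutations"
begin

text \<open>
  For a connected parabolic subgroup generated by the nodes in an interval \<open>[a, c]\<close>, it suffices
  that the subgroups of \<open>[a, c)\<close> and \<open>(a, c]\<close> meet in the subgroup \<open>G\<^sub>K\<close> of \<open>K = (a, c)\<close>. An
  element \<open>g\<close> of the intersection is an isometry that moves every vector by an element of the span
  \<open>V\<^sub>K\<close> of the \<open>b\<^sub>i\<close>, \<open>i \<in> K\<close>.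

  If all bonds of \<open>K\<close> and one neighbouring bond have order \<open>3\<close> modulo \<open>p\<close>, this is the
  coset decomposition of a symmetric group. Otherwise \<open>G\<^sub>K\<close> contains all reflections in vectors
  of \<open>V\<^sub>K\<close> of norm \<open>1\<close> and all products of two reflections in vectors of \<open>V\<^sub>K\<close> of a fixed
  nonsquare norm \<open>\<nu>\<close>: an infinite bond produces isotropic vectors \<open>c\<close> and Eichler transformations
  along \<open>c\<close>, which act transitively on the vectors of given norm. By the argument of Cartan and
  Dieudonne \<open>g\<close> is a product of reflections of \<open>V\<^sub>K\<close>, also when \<open>V\<^sub>K\<close> is singular, because
  \<open>b\<^sub>a\<close> is not orthogonal to the radical of \<open>V\<^sub>K\<close>. Hence \<open>g \<in> G\<^sub>K\<close> or \<open>g\<close> is an element of \<open>G\<^sub>K\<close>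
  times one reflection of norm \<open>\<nu>\<close>. The latter is excluded by the sign of the permutation of the
  set of vectors of norm \<open>\<nu>\<close>: a reflection \<open>r\<^sub>u\<close> moves these vectors in orbits \<open>{\<plusminus> x, \<plusminus> r\<^sub>u x}\<close> of
  size four, except for the multiples of \<open>u\<close>, so it is odd iff \<open>u\<close> has norm \<open>\<nu>\<close> up to squares.
\<close>

section \<open>String C-groups from intersections of intervals\<close>

text \<open>Eichler transformations arise as products of reflections in two roots that differ by a
  multiple of an isotropic \<open>c\<close>. They are additive in their second vector, so a spanning
  set of the complement of \<open>c\<close> in the span of \<open>K\<close> must be reached. Along
  the path this is easy once started; the obstacle is to get past the nodes that support the
  isotropic vectors. \<open>eichler_in_torus\<close> does so if \<open>3 * \<rho> * \<kappa>\<close>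
  is invertible, and an auxiliary root in \<open>full_three_infinity\<close> does so for
  \<open>p > 17\<close>.

  These bounds decide which primes are covered. If \<open>k = m = 1\<close>, the nodes strictly
  inside an interval are joined by infinite bonds only, and \<open>p > 3\<close> suffices; bonds of
  order 3 inside \<open>K\<close> next to infinite ones, which need a larger \<open>k\<close> or
  \<open>m\<close>, cost the bound 17. For \<open>p = 3\<close> an infinite bond satisfies
  \<open>2 * 2 = 1\<close> modulo \<open>p\<close>, so the generators obey the braid relations of a
  symmetric group.

  Reflections of norm \<open>nu\<close> are only asked for in pairs because a single one is an odd
  permutation and never lies in the group.\<close>

context group
begin

lemma generate_commute:
  assumes "S \<subseteq> carrier G" "T \<subseteq> carrier G" "\<And>x y. x \<in> S \<Longrightarrow> y \<in> T \<Longrightarrow> x \<otimes> y = y \<otimes> x"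
    and "x \<in> generate G S" "y \<in> generate G T"
  shows "x \<otimes> y = y \<otimes> x"
proof -
  have inv_comm: "inv u \<otimes> z = z \<otimes> inv u" if "u \<in> carrier G" "z \<in> carrier G" "u \<otimes> z = z \<otimes> u" for u z
  proof -
    have "(z \<otimes> u) \<otimes> inv u = z" using that(1,2) by (simp add: m_assoc)
    then have "inv u \<otimes> z = inv u \<otimes> ((z \<otimes> u) \<otimes> inv u)" by (simp only:)
    also have "\<dots> = inv u \<otimes> ((u \<otimes> z) \<otimes> inv u)" by (simp only: that(3))
    also have "\<dots> = z \<otimes> inv u" using that(1,2) by (simp add: m_assoc[symmetric])
    finally show ?thesis .
  qed
  have 1: "u \<otimes> y = y \<otimes> u" if "u \<in> S" for u
    using assms(5)
  proof (induction rule: generate.induct)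
    case (incl h)
    then show ?case using that assms by blast
  next
    case (inv h)
    then have c: "h \<in> carrier G" "u \<in> carrier G" using that assms(1,2) by auto
    show ?case using inv_comm[OF c] assms(3)[OF that inv] by simp
  next
    case (eng h1 h2)
    then have "h1 \<in> carrier G" "h2 \<in> carrier G" "u \<in> carrier G"
      using generate_in_carrier assms that by auto
    then show ?case using eng by (metis m_assoc)
  qed (use that assms in auto)
  have y: "y \<in> carrier G" using generate_in_carrier assms by blast
  show ?thesis
    using assms(4)
  proof (induction rule: generate.induct)
    case (inv h)
    then have c: "h \<in> carrier G" using assms(1) by auto
    show ?case using inv_comm[OF c y] 1[OF inv] by simp
  next
    case (eng h1 h2)
    then have "h1 \<in> carrier G" "h2 \<in> carrier G"
      using generate_in_carrier assms by auto
    then show ?case using eng y by (metis m_assoc)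
  qed (use 1 y in auto)
qed

lemma generate_Un_commute:
  assumes "S \<subseteq> carrier G" "T \<subseteq> carrier G" "\<And>x y. x \<in> S \<Longrightarrow> y \<in> T \<Longrightarrow> x \<otimes> y = y \<otimes> x"
    and "g \<in> generate G (S \<union> T)"
  shows "\<exists>x\<in>generate G S. \<exists>y\<in>generate G T. g = x \<otimes> y"
  using assms(4)
proof (induction rule: generate.induct)
  case one
  show ?case by (intro bexI[of _ \<one>] generate.one) simp
next
  case (incl h)
  then show ?case
  proof
    assume h: "h \<in> S"
    then show ?thesis using assms by (intro bexI[of _ h] bexI[of _ \<one>] generate.one generate.incl) auto
  next
    assume h: "h \<in> T"
    then show ?thesis using assms by (intro bexI[of _ \<one>] bexI[of _ h] generate.one generate.incl) auto
  qed
next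
  case (inv h)
  then show ?case
  proof
    assume h: "h \<in> S"
    then show ?thesis using assms by (intro bexI[of _ "inv h"] bexI[of _ \<one>] generate.one generate.inv) auto
  next
    assume h: "h \<in> T"
    then show ?thesis using assms by (intro bexI[of _ \<one>] bexI[of _ "inv h"] generate.one generate.inv) auto
  qed
next
  case (eng h1 h2)
  then obtain x1 y1 x2 y2 where xy: "x1 \<in> generate G S" "y1 \<in> generate G T" "h1 = x1 \<otimes> y1"
    "x2 \<in> generate G S" "y2 \<in> generate G T" "h2 = x2 \<otimes> y2" by blast
  have c: "x1 \<in> carrier G" "x2 \<in> carrier G" "y1 \<in> carrier G" "y2 \<in> carrier G"
    using xy generate_in_carrier assms(1,2) by auto
  have "y1 \<otimes> x2 = x2 \<otimes> y1" using generate_commute[OF assms(1-3) xy(4) xy(2)] by simp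
  then have "h1 \<otimes> h2 = (x1 \<otimes> x2) \<otimes> (y1 \<otimes> y2)" using c xy by (metis m_assoc m_closed)
  then show ?case
    using generate.eng[OF xy(1,4)] generate.eng[OF xy(2,5)]
    by (intro bexI[of _ "x1 \<otimes> x2"] bexI[of _ "y1 \<otimes> y2"])
qed

end

locale string_gens = group G for G (structure) +
  fixes r :: "nat \<Rightarrow> 'a" and n :: nat
  assumes r_carrier: "i < n \<Longrightarrow> r i \<in> carrier G"
    and r_commute: "i + 2 \<le> j \<Longrightarrow> j < n \<Longrightarrow> r i \<otimes> r j = r j \<otimes> r i"
begin

definition S :: "nat set \<Rightarrow> 'a set" where "S I = generate G (r ` I)"

lemma S_mono: "I \<subseteq> J \<Longrightarrow> S I \<subseteq> S J"
  unfolding S_def by (intro mono_generate image_mono)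

lemma S_carrier: "I \<subseteq> {..<n} \<Longrightarrow> x \<in> S I \<Longrightarrow> x \<in> carrier G"
  unfolding S_def by (rule generate_in_carrier) (use r_carrier in auto)

lemma S_mult: "x \<in> S I \<Longrightarrow> y \<in> S I \<Longrightarrow> x \<otimes> y \<in> S I"
  unfolding S_def by (rule generate.eng)

lemma S_inv: "I \<subseteq> {..<n} \<Longrightarrow> x \<in> S I \<Longrightarrow> inv x \<in> S I"
  unfolding S_def by (rule generate_m_inv_closed) (use r_carrier in auto)

lemma S_split:
  assumes "I \<subseteq> {..<n}" "J \<subseteq> {..<n}" "\<And>i j. i \<in> I \<Longrightarrow> j \<in> J \<Longrightarrow> i + 2 \<le> j" "g \<in> S (I \<union> J)"
  obtains x y where "x \<in> S I" "y \<in> S J" "g = x \<otimes> y"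
proof -
  have comm: "r i \<otimes> r j = r j \<otimes> r i" if "i \<in> I" "j \<in> J" for i j
  proof (rule r_commute)
    show "i + 2 \<le> j" by (rule assms(3)[OF that])
    show "j < n" using that assms(2) by auto
  qed
  have "\<exists>x\<in>generate G (r ` I). \<exists>y\<in>generate G (r ` J). g = x \<otimes> y"
  proof (rule generate_Un_commute)
    show "r ` I \<subseteq> carrier G" "r ` J \<subseteq> carrier G" using assms(1,2) r_carrier by blast+
    show "x \<otimes> y = y \<otimes> x" if "x \<in> r ` I" "y \<in> r ` J" for x y
      using that comm by auto
    show "g \<in> generate G (r ` I \<union> r ` J)" using assms(4) by (simp only: S_def image_Un)
  qed
  then show ?thesis using that unfolding S_def by blast
qed

text \<open>A missing node separates the others into two sets at distance at least two, whose
  generators commute.\<close>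

lemma S_split_at:
  assumes "I \<subseteq> {..<n}" "i \<notin> I" "g \<in> S I"
  obtains x y where "x \<in> S (I \<inter> {..<i})" "y \<in> S (I \<inter> {i<..})" "g = x \<otimes> y"
proof (rule S_split[of "I \<inter> {..<i}" "I \<inter> {i<..}" g])
  have "x < i \<or> i < x" if "x \<in> I" for x
    using that assms(2) by (metis linorder_neqE_nat)
  then have "I = (I \<inter> {..<i}) \<union> (I \<inter> {i<..})" by auto
  then show "g \<in> S ((I \<inter> {..<i}) \<union> (I \<inter> {i<..}))" using assms(3) by simp
qed (use assms that in auto)

text \<open>Only the inclusion with content is recorded; the other one is
  \<open>S_mono\<close>.\<close>

definition ip :: "nat set \<Rightarrow> bool"
  where "ip T \<longleftrightarrow> (\<forall>I J. I \<subseteq> T \<longrightarrow> J \<subseteq> T \<longrightarrow> S I \<inter> S J \<subseteq> S (I \<inter> J))"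

text \<open>A proper subset of an interval has a gap, which factors its elements into a left and a
  right part. Each part lies in one of the two maximal parabolic subgroups, where the property is
  known, so only their overlap \<open>LU\<close> has to be assumed.\<close>

lemma ip_step:
  assumes hi: "a \<le> c" "c < n"
    and L: "ip {a..<c}" and U: "ip {Suc a..c}"
    and LU: "S {a..<c} \<inter> S {Suc a..c} \<subseteq> S {Suc a..<c}"
  shows "ip {a..c}"
proof -
  have sub: "I \<subseteq> {a..c} \<Longrightarrow> I \<subseteq> {..<n}" for I using hi by auto
  note mult = S_mult and invS = S_inv[OF sub] and car = S_carrier[OF sub]
  \<comment> \<open>If \<open>i\<close> is missing from \<open>J\<close>, the left factor
    \<open>x\<close> lies in \<open>S {a..<c}\<close> anyway, hence so does \<open>y\<close>. Thus
    \<open>y\<close> lies in both maximal parabolic subgroups, \<open>LU\<close> applies, and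
    \<open>U\<close> finishes. \<open>stepU\<close> is the mirror image.\<close>
  have stepL: "S {a..<c} \<inter> S J \<subseteq> S (J \<inter> {a..<c})" if J: "J \<subseteq> {a..c}" for J
  proof
    fix g assume g: "g \<in> S {a..<c} \<inter> S J"
    consider "J = {a..c}" | "c \<notin> J" | i where "i \<in> {a..<c}" "i \<notin> J"
      using J hi(1) by fastforce
    then show "g \<in> S (J \<inter> {a..<c})"
    proof cases
      case 1
      then have "J \<inter> {a..<c} = {a..<c}" by auto
      then show ?thesis using g by simp
    next
      case 2
      then have "J \<subseteq> {a..<c}" using J by (auto simp: order_less_le)
      then have "S {a..<c} \<inter> S J \<subseteq> S ({a..<c} \<inter> J)" using L unfolding ip_def by blast
      then show ?thesis using g by (auto simp: Int_commute)
    next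
      case 3
      obtain x y where xy: "x \<in> S (J \<inter> {..<i})" "y \<in> S (J \<inter> {i<..})" "g = x \<otimes> y"
        using S_split_at[OF sub[OF J] 3(2)] g by blast
      have sJ: "J \<inter> {..<i} \<subseteq> {a..<c}" "J \<inter> {i<..} \<subseteq> {Suc a..c}" using J 3 by auto
      have xc: "x \<in> carrier G" "y \<in> carrier G"
        using xy car[of "J \<inter> {..<i}"] car[of "J \<inter> {i<..}"] J by auto
      have xL: "x \<in> S {a..<c}" using xy(1) S_mono[OF sJ(1)] by blast
      then have "inv x \<otimes> g \<in> S {a..<c}" using g by (intro mult invS) auto
      moreover have "inv x \<otimes> g = y" using xy xc by (simp add: m_assoc[symmetric])
      ultimately have "y \<in> S {a..<c} \<inter> S {Suc a..c}" using xy(2) S_mono[OF sJ(2)] by auto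
      then have "y \<in> S {Suc a..<c} \<inter> S (J \<inter> {i<..})" using LU xy by blast
      moreover have "{Suc a..<c} \<subseteq> {Suc a..c}" by auto
      ultimately have "y \<in> S ({Suc a..<c} \<inter> (J \<inter> {i<..}))"
        using U sJ(2) unfolding ip_def by blast
      moreover have "{Suc a..<c} \<inter> (J \<inter> {i<..}) \<subseteq> J \<inter> {a..<c}" by auto
      ultimately have "y \<in> S (J \<inter> {a..<c})" using S_mono by blast
      moreover have "x \<in> S (J \<inter> {a..<c})"
        using xy(1) S_mono[of "J \<inter> {..<i}" "J \<inter> {a..<c}"] sJ(1) by blast
      ultimately show ?thesis using xy(3) mult by simp
    qed
  qed
  have stepU: "S {Suc a..c} \<inter> S J \<subseteq> S (J \<inter> {Suc a..c})" if J: "J \<subseteq> {a..c}" for J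
  proof
    fix g assume g: "g \<in> S {Suc a..c} \<inter> S J"
    have "J = {a..c}" if "a \<in> J" "{Suc a..c} \<subseteq> J"
    proof
      have "insert a {Suc a..c} \<subseteq> J" using that by simp
      then show "{a..c} \<subseteq> J" by (simp only: atLeastAtMost_insertL[OF hi(1)])
    qed (rule J)
    then consider "J = {a..c}" | "a \<notin> J" | i where "i \<in> {Suc a..c}" "i \<notin> J"
      by blast
    then show "g \<in> S (J \<inter> {Suc a..c})"
    proof cases
      case 1
      then have "J \<inter> {Suc a..c} = {Suc a..c}" by auto
      then show ?thesis using g by simp
    next
      case 2
      have "J \<subseteq> insert a {Suc a..c}" by (simp only: atLeastAtMost_insertL[OF hi(1)] J)
      then have "J \<subseteq> {Suc a..c}" using 2 by blast
      then have "S {Suc a..c} \<inter> S J \<subseteq> S ({Suc a..c} \<inter> J)" using U unfolding ip_def by blast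
      then show ?thesis using g by (auto simp: Int_commute)
    next
      case 3
      obtain x y where xy: "x \<in> S (J \<inter> {..<i})" "y \<in> S (J \<inter> {i<..})" "g = x \<otimes> y"
        using S_split_at[OF sub[OF J] 3(2)] g by blast
      have sJ: "J \<inter> {..<i} \<subseteq> {a..<c}" "J \<inter> {i<..} \<subseteq> {Suc a..c}" using J 3 by auto
      have xc: "x \<in> carrier G" "y \<in> carrier G"
        using xy car[of "J \<inter> {..<i}"] car[of "J \<inter> {i<..}"] J by auto
      have yU: "y \<in> S {Suc a..c}" using xy(2) S_mono[OF sJ(2)] by blast
      then have "g \<otimes> inv y \<in> S {Suc a..c}" using g by (intro mult invS) auto
      moreover have "g \<otimes> inv y = x" using xy xc by (simp add: m_assoc)
      ultimately have "x \<in> S {a..<c} \<inter> S {Suc a..c}" using xy(1) S_mono[OF sJ(1)] by auto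
      then have "x \<in> S {Suc a..<c} \<inter> S (J \<inter> {..<i})" using LU xy by blast
      moreover have "{Suc a..<c} \<subseteq> {a..<c}" by auto
      ultimately have "x \<in> S ({Suc a..<c} \<inter> (J \<inter> {..<i}))"
        using L sJ(1) unfolding ip_def by blast
      moreover have "{Suc a..<c} \<inter> (J \<inter> {..<i}) \<subseteq> J \<inter> {Suc a..c}" by auto
      ultimately have "x \<in> S (J \<inter> {Suc a..c})" using S_mono by blast
      moreover have "y \<in> S (J \<inter> {Suc a..c})"
        using xy(2) S_mono[of "J \<inter> {i<..}" "J \<inter> {Suc a..c}"] sJ(2) by blast
      ultimately show ?thesis using xy(3) mult by simp
    qed
  qed
  have step2: "S I \<inter> S J \<subseteq> S (I \<inter> J)"
    if "I \<subseteq> {a..<c} \<or> I \<subseteq> {Suc a..c}" and J: "J \<subseteq> {a..c}" for I J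
    using that(1)
  proof
    assume I: "I \<subseteq> {a..<c}"
    have "S I \<inter> S J \<subseteq> S {a..<c} \<inter> S J" using S_mono[OF I] by blast
    also have "\<dots> \<subseteq> S (J \<inter> {a..<c})" by (rule stepL[OF J])
    finally have "S I \<inter> S J \<subseteq> S I \<inter> S (J \<inter> {a..<c})" by blast
    also have "\<dots> \<subseteq> S (I \<inter> (J \<inter> {a..<c}))" using L I unfolding ip_def by blast
    also have "\<dots> \<subseteq> S (I \<inter> J)" by (rule S_mono) blast
    finally show ?thesis .
  next
    assume I: "I \<subseteq> {Suc a..c}"
    have "S I \<inter> S J \<subseteq> S {Suc a..c} \<inter> S J" using S_mono[OF I] by blast
    also have "\<dots> \<subseteq> S (J \<inter> {Suc a..c})" by (rule stepU[OF J])
    finally have "S I \<inter> S J \<subseteq> S I \<inter> S (J \<inter> {Suc a..c})" by blast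
    also have "\<dots> \<subseteq> S (I \<inter> (J \<inter> {Suc a..c}))" using U I unfolding ip_def by blast
    also have "\<dots> \<subseteq> S (I \<inter> J)" by (rule S_mono) blast
    finally show ?thesis .
  qed
  have step3: "S I \<inter> S J \<subseteq> S (I \<inter> J)"
    if I: "I \<subseteq> {a..c}" and J: "J \<subseteq> {a..c}" and ij: "i \<notin> I" "j \<notin> J" "i \<in> {a..c}" "j \<in> {a..c}" "i \<le> j" for I J i j
  proof
    fix g assume g: "g \<in> S I \<inter> S J"
    obtain x1 x2 where x: "x1 \<in> S (I \<inter> {..<i})" "x2 \<in> S (I \<inter> {i<..})" "g = x1 \<otimes> x2"
      using S_split_at[OF sub[OF I] ij(1)] g by blast
    obtain y1 y2 where y: "y1 \<in> S (J \<inter> {..<j})" "y2 \<in> S (J \<inter> {j<..})" "g = y1 \<otimes> y2"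
      using S_split_at[OF sub[OF J] ij(2)] g by blast
    have carr: "x1 \<in> carrier G" "x2 \<in> carrier G" "y1 \<in> carrier G" "y2 \<in> carrier G"
      by (rule car[OF le_infI1 x(1)] car[OF le_infI1 x(2)] car[OF le_infI1 y(1)] car[OF le_infI1 y(2)], rule I J)+
    define M where "M = {Suc i..<j}"
    \<comment> \<open>\<open>\<delta>\<close> compares the factorizations of \<open>g\<close> at the
      two gaps. It also equals \<open>y2 \<otimes> inv x2\<close>, and therefore needs only the
      nodes strictly between \<open>i\<close> and \<open>j\<close>.\<close>
    define \<delta> where "\<delta> = inv y1 \<otimes> x1"
    have \<delta>c: "\<delta> \<in> carrier G" using carr by (simp add: \<delta>_def)
    have x1: "x1 = y1 \<otimes> \<delta>" using carr by (simp add: \<delta>_def m_assoc[symmetric])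
    have y2: "y2 = \<delta> \<otimes> x2"
    proof -
      have "y1 \<otimes> y2 = y1 \<otimes> (\<delta> \<otimes> x2)"
        using x(3) y(3) x1 carr \<delta>c by (metis m_assoc)
      then show ?thesis using carr \<delta>c by simp
    qed
    then have \<delta>': "\<delta> = y2 \<otimes> inv x2" using carr \<delta>c by (simp add: m_assoc)
    have "\<delta> \<in> S {a..<j}"
      unfolding \<delta>_def
    proof (intro mult invS)
      show "{a..<j} \<subseteq> {a..c}" using ij by auto
      have "J \<inter> {..<j} \<subseteq> {a..<j}" using J by auto
      then show "y1 \<in> S {a..<j}" using y(1) S_mono by blast
      have "I \<inter> {..<i} \<subseteq> {a..<j}" using I ij by auto
      then show "x1 \<in> S {a..<j}" using x(1) S_mono by blast
    qed
    moreover have "\<delta> \<in> S {Suc i..c}"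
      unfolding \<delta>'
    proof (intro mult invS)
      show "{Suc i..c} \<subseteq> {a..c}" using ij by auto
      have "J \<inter> {j<..} \<subseteq> {Suc i..c}" using J ij by auto
      then show "y2 \<in> S {Suc i..c}" using y(2) S_mono by blast
      have "I \<inter> {i<..} \<subseteq> {Suc i..c}" using I by auto
      then show "x2 \<in> S {Suc i..c}" using x(2) S_mono by blast
    qed
    ultimately have "\<delta> \<in> S ({a..<j} \<inter> {Suc i..c})"
      using step2[of "{a..<j}" "{Suc i..c}"] ij by auto
    moreover have "{a..<j} \<inter> {Suc i..c} = M" using ij by (auto simp: M_def)
    ultimately have \<delta>M: "\<delta> \<in> S M" by simp
    have "x1 \<in> S ((J \<inter> {..<j}) \<union> M)"
      unfolding x1 using y(1) \<delta>M S_mono[of "J \<inter> {..<j}" "(J \<inter> {..<j}) \<union> M"] S_mono[of M "(J \<inter> {..<j}) \<union> M"]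
      by (intro mult) auto
    then have "x1 \<in> S (I \<inter> {..<i}) \<inter> S ((J \<inter> {..<j}) \<union> M)" using x(1) by blast
    moreover have "I \<inter> {..<i} \<subseteq> {a..<c}" "(J \<inter> {..<j}) \<union> M \<subseteq> {a..<c}"
      using I J ij by (auto simp: M_def)
    ultimately have "x1 \<in> S ((I \<inter> {..<i}) \<inter> ((J \<inter> {..<j}) \<union> M))"
      using L unfolding ip_def by blast
    moreover have "(I \<inter> {..<i}) \<inter> ((J \<inter> {..<j}) \<union> M) \<subseteq> I \<inter> J" by (auto simp: M_def)
    ultimately have x1': "x1 \<in> S (I \<inter> J)" using S_mono by blast
    have "x2 = inv \<delta> \<otimes> y2" unfolding y2 using carr \<delta>c by (simp add: m_assoc[symmetric])
    moreover have Mc: "M \<subseteq> {a..c}" using ij by (auto simp: M_def)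
    have "inv \<delta> \<otimes> y2 \<in> S (M \<union> (J \<inter> {j<..}))"
      using invS[OF Mc \<delta>M] y(2) S_mono[of M "M \<union> (J \<inter> {j<..})"] S_mono[of "J \<inter> {j<..}" "M \<union> (J \<inter> {j<..})"]
      by (intro mult) auto
    ultimately have "x2 \<in> S (I \<inter> {i<..}) \<inter> S (M \<union> (J \<inter> {j<..}))" using x(2) by simp
    moreover have "I \<inter> {i<..} \<subseteq> {Suc a..c}" "M \<union> (J \<inter> {j<..}) \<subseteq> {Suc a..c}"
      using I J ij by (auto simp: M_def)
    ultimately have "x2 \<in> S ((I \<inter> {i<..}) \<inter> (M \<union> (J \<inter> {j<..})))"
      using U unfolding ip_def by blast
    moreover have "(I \<inter> {i<..}) \<inter> (M \<union> (J \<inter> {j<..})) = (I \<inter> M) \<union> (I \<inter> J \<inter> {j<..})"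
      using ij by (auto simp: M_def)
    ultimately have "x2 \<in> S ((I \<inter> M) \<union> (I \<inter> J \<inter> {j<..}))" by simp
    \<comment> \<open>The node \<open>j\<close> is a second gap, in the support of
      \<open>x2\<close>. Only the middle factor \<open>u\<close> is not yet known to lie in
      \<open>S J\<close>; it equals \<open>g\<close> stripped of factors from
      \<open>S (I \<inter> J)\<close>, so \<open>step2\<close> catches it.\<close>
    then obtain u w where u: "u \<in> S (I \<inter> M)" "w \<in> S (I \<inter> J \<inter> {j<..})" "x2 = u \<otimes> w"
      by (rule S_split[rotated 3]) (use sub[OF I] in \<open>auto simp: M_def\<close>)
    have uc: "u \<in> carrier G" "w \<in> carrier G"
      by (rule car[OF le_infI1 u(1)] car[OF le_infI1[OF le_infI1] u(2)], rule I)+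
    have w': "w \<in> S (I \<inter> J)" using u(2) S_mono[of "I \<inter> J \<inter> {j<..}" "I \<inter> J"] by blast
    have IJ: "S (I \<inter> J) \<subseteq> S J" by (rule S_mono) blast
    have "inv x1 \<otimes> g \<otimes> inv w \<in> S J"
      using x1' w' IJ g J by (intro mult invS) auto
    moreover have "inv x1 \<otimes> g \<otimes> inv w = u"
    proof -
      have "inv x1 \<otimes> (x1 \<otimes> u) = u" using carr uc by (simp add: m_assoc[symmetric])
      then show ?thesis unfolding x(3) u(3) using carr uc by (simp add: m_assoc)
    qed
    ultimately have "u \<in> S (I \<inter> M) \<inter> S J" using u by simp
    moreover have "I \<inter> M \<subseteq> {Suc a..c}" using I ij by (auto simp: M_def)
    ultimately have "u \<in> S (I \<inter> M \<inter> J)" using step2[of "I \<inter> M" J] J by blast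
    then have "u \<in> S (I \<inter> J)" using S_mono[of "I \<inter> M \<inter> J" "I \<inter> J"] by blast
    then show "g \<in> S (I \<inter> J)" unfolding x(3) u(3) using x1' w' by (intro mult)
  qed
  show ?thesis
    unfolding ip_def
  proof (intro allI impI)
    fix I J assume I: "I \<subseteq> {a..c}" and J: "J \<subseteq> {a..c}"
    consider "I = {a..c}" | "J = {a..c}" | i j where "i \<in> {a..c}" "i \<notin> I" "j \<in> {a..c}" "j \<notin> J"
      using I J by blast
    then show "S I \<inter> S J \<subseteq> S (I \<inter> J)"
    proof cases
      case 1
      then have "I \<inter> J = J" using J by blast
      then show ?thesis by simp
    next
      case 2
      then have "I \<inter> J = I" using I by blast
      then show ?thesis by simp
    next
      case 3
      show ?thesis
      proof (cases "i \<le> j")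
        case True
        then show ?thesis using step3[OF I J 3(2,4,1,3)] by simp
      next
        case False
        then show ?thesis using step3[OF J I 3(4,2,3,1)] by (simp add: Int_commute)
      qed
    qed
  qed
qed

lemma ip_all:
  assumes "\<And>a c. a < c \<Longrightarrow> c < n \<Longrightarrow> S {a..<c} \<inter> S {Suc a..c} \<subseteq> S {Suc a..<c}"
  shows "ip {..<n}"
proof -
  have empty: "ip {}" by (simp add: ip_def)
  have main: "ip {a..c}" if "a \<le> c" "c < n" for a c
    using that
  proof (induction "c - a" arbitrary: a c)
    case 0
    then have "{a..<c} = {}" "{Suc a..c} = {}" "{Suc a..<c} = {}" by auto
    then show ?case using ip_step[OF 0(2,3)] empty by simp
  next
    case (Suc m)
    then have ac: "a < c" by simp
    have "m = c - 1 - a" "a \<le> c - 1" "c - 1 < n" "m = c - Suc a" "Suc a \<le> c"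
      using Suc by auto
    then have "ip {a..c - 1}" "ip {Suc a..c}"
      using Suc.hyps(1)[of "c - 1" a] Suc.hyps(1)[of c "Suc a"] Suc.prems(2) by simp_all
    moreover have "{a..c - 1} = {a..<c}" using ac by auto
    ultimately show ?case
      using ip_step[OF Suc.prems(1,2)] assms[OF ac Suc.prems(2)] by simp
  qed
  show ?thesis
  proof (cases n)
    case 0
    then show ?thesis using empty by simp
  next
    case (Suc m)
    have "{..<n} = {0..m}" using Suc by auto
    then show ?thesis using main[of 0 m] Suc by simp
  qed
qed

end

section \<open>Reflections and Eichler transformations modulo \<open>p\<close>\<close>

text \<open>All vectors share one type with infinitely many coordinates, so no dimension is carried
  along. The form below reads only the coordinates below \<open>n\<close>, and words in
  \<open>{..<n}\<close> change only these.\<close>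

typedef ivec = "UNIV :: (nat \<Rightarrow> int) set"
  morphisms coord Coord ..

setup_lifting type_definition_ivec

lemma coord_ext: "(\<And>i. coord x i = coord y i) \<Longrightarrow> x = y"
  by transfer auto

instantiation ivec :: ab_group_add
begin

lift_definition zero_ivec :: ivec is "\<lambda>_. 0" .
lift_definition plus_ivec :: "ivec \<Rightarrow> ivec \<Rightarrow> ivec" is "\<lambda>x y i. x i + y i" .
lift_definition minus_ivec :: "ivec \<Rightarrow> ivec \<Rightarrow> ivec" is "\<lambda>x y i. x i - y i" .
lift_definition uminus_ivec :: "ivec \<Rightarrow> ivec" is "\<lambda>x i. - x i" .

instance
  by standard (transfer; auto simp: algebra_simps)+

end

lift_definition smul :: "int \<Rightarrow> ivec \<Rightarrow> ivec" (infixr "*\<^sub>Z" 75) is "\<lambda>t x i. t * x i" .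

lift_definition bas :: "nat \<Rightarrow> ivec" is "\<lambda>i j. if j = i then 1 else 0" .

lemma coord_simps [simp]:
  "coord 0 i = 0" "coord (x + y) i = coord x i + coord y i"
  "coord (x - y) i = coord x i - coord y i" "coord (- x) i = - coord x i"
  "coord (t *\<^sub>Z x) i = t * coord x i"
  by (transfer; simp)+

lemma coord_bas: "coord (bas i) j = (if j = i then 1 else 0)"
  by transfer simp

lemma smul_1 [simp]: "1 *\<^sub>Z x = x" and smul_0 [simp]: "0 *\<^sub>Z x = 0"
  by (rule coord_ext, simp)+

locale refl_rep =
  fixes n :: nat and A :: "nat \<Rightarrow> nat \<Rightarrow> int" and p :: int
  assumes A_sym: "A i j = A j i"
    and A_diag: "A i i = 2"
    and prime_p: "prime p"
    and p_gt_2: "p > 2"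
begin

text \<open>Twice the inner product of the paper, so that \<open>B b\<^sub>i b\<^sub>i = 2\<close> and all values are integers.\<close>

definition B :: "ivec \<Rightarrow> ivec \<Rightarrow> int"
  where "B x y = (\<Sum>i<n. \<Sum>j<n. coord x i * A i j * coord y j)"

lemma B_add_left: "B (x + y) z = B x z + B y z"
  by (simp add: B_def sum.distrib algebra_simps)

lemma B_smul_left: "B (t *\<^sub>Z x) z = t * B x z"
  by (simp add: B_def sum_distrib_left algebra_simps)

lemma B_sym: "B x y = B y x"
  unfolding B_def by (subst sum.swap) (simp add: A_sym[of _ "_ :: nat"] mult_ac cong: sum.cong)

lemma B_add_right: "B z (x + y) = B z x + B z y"
  by (simp add: B_sym[of z] B_add_left)

lemma B_smul_right: "B z (t *\<^sub>Z x) = t * B z x"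
  by (simp add: B_sym[of z] B_smul_left)

lemma B_diff_left: "B (x - y) z = B x z - B y z"
  by (simp add: B_def sum_subtractf algebra_simps)

lemma B_diff_right: "B z (x - y) = B z x - B z y"
  by (simp add: B_sym[of z] B_diff_left)

lemmas B_lin = B_add_left B_add_right B_diff_left B_diff_right B_smul_left B_smul_right

lemma B_bas_right: "i < n \<Longrightarrow> B x (bas i) = (\<Sum>j<n. coord x j * A j i)"
  by (simp add: B_def coord_bas if_distrib if_distribR cong: if_cong)

lemma B_bas: "i < n \<Longrightarrow> j < n \<Longrightarrow> B (bas i) (bas j) = A i j"
  by (simp add: B_bas_right coord_bas if_distrib[of "\<lambda>x. x * _"] cong: if_cong)

text \<open>All coordinates are compared, also those from \<open>n\<close> on, which the form
  ignores; the weaker \<open>weq\<close> for the parity count compares only the first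
  \<open>n\<close>.\<close>

definition veq :: "ivec \<Rightarrow> ivec \<Rightarrow> bool" (infix "\<approx>" 50)
  where "x \<approx> y \<longleftrightarrow> (\<forall>i. [coord x i = coord y i] (mod p))"

lemma veq_refl [simp, intro]: "x \<approx> x"
  by (simp add: veq_def)

lemma veq_sym: "x \<approx> y \<Longrightarrow> y \<approx> x"
  by (simp add: veq_def cong_sym)

lemma veq_trans [trans]: "x \<approx> y \<Longrightarrow> y \<approx> z \<Longrightarrow> x \<approx> z"
  unfolding veq_def by (blast intro: cong_trans)

lemma veq_add: "x \<approx> x' \<Longrightarrow> y \<approx> y' \<Longrightarrow> x + y \<approx> x' + y'"
  by (simp add: veq_def cong_add)

lemma veq_diff: "x \<approx> x' \<Longrightarrow> y \<approx> y' \<Longrightarrow> x - y \<approx> x' - y'"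
  by (simp add: veq_def cong_diff)

lemma veq_smul: "[s = t] (mod p) \<Longrightarrow> x \<approx> y \<Longrightarrow> s *\<^sub>Z x \<approx> t *\<^sub>Z y"
  by (simp add: veq_def cong_mult)

lemma B_cong: "x \<approx> x' \<Longrightarrow> y \<approx> y' \<Longrightarrow> [B x y = B x' y'] (mod p)"
  unfolding B_def veq_def by (intro cong_sum cong_mult) auto

lemma cong_cancel:
  assumes "[a * t = b * t] (mod p)" "\<not> p dvd t"
  shows "[a = b] (mod p)"
  using assms prime_p
  by (metis cong_iff_dvd_diff left_diff_distrib prime_dvd_mult_iff)

lemma inv_mod:
  assumes "\<not> p dvd a"
  obtains t where "[t * a = 1] (mod p)"
proof -
  have "coprime a p"
    using assms prime_p prime_imp_coprime[of p a] by (simp add: coprime_commute)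
  then obtain t where "[a * t = 1] (mod p)"
    using cong_solve_coprime_int by blast
  then show ?thesis using that by (simp add: mult.commute)
qed

lemma not_p_dvd_2: "\<not> p dvd 2"
  using p_gt_2 by (auto dest: zdvd_imp_le)

text \<open>An inverse of \<open>2\<close> modulo \<open>p\<close>.\<close>

definition hf :: int where "hf = (p + 1) div 2"

lemma odd_p: "odd p"
  using prime_p p_gt_2 by (simp add: prime_odd_int)

lemma two_hf: "2 * hf = p + 1"
  using odd_p by (auto simp: hf_def elim!: oddE)

lemma hf_cong: "[2 * hf = 1] (mod p)"
  by (simp add: two_hf cong_def)

text \<open>This is the reflection in \<open>v\<close> when \<open>s * B v v = 2\<close> modulo
  \<open>p\<close>. Keeping the scalar as an argument avoids division and allows vectors of any
  nonzero norm.\<close>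

definition R :: "int \<Rightarrow> ivec \<Rightarrow> ivec \<Rightarrow> ivec"
  where "R s v x = x - (s * B x v) *\<^sub>Z v"

primrec act :: "nat list \<Rightarrow> ivec \<Rightarrow> ivec" where
  "act [] x = x"
| "act (i # w) x = R 1 (bas i) (act w x)"

lemma act_append: "act (u @ w) x = act u (act w x)"
  by (induction u) simp_all

lemma R_add: "R s v (x + y) = R s v x + R s v y"
  by (rule coord_ext) (simp add: R_def B_lin algebra_simps)

lemma R_diff: "R s v (x - y) = R s v x - R s v y"
  by (rule coord_ext) (simp add: R_def B_lin algebra_simps)

lemma R_smul: "R s v (t *\<^sub>Z x) = t *\<^sub>Z R s v x"
  by (rule coord_ext) (simp add: R_def B_lin algebra_simps)

lemma act_add: "act w (x + y) = act w x + act w y"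
  by (induction w) (simp_all add: R_add)

lemma act_diff: "act w (x - y) = act w x - act w y"
  by (induction w) (simp_all add: R_diff)

lemma act_smul: "act w (t *\<^sub>Z x) = t *\<^sub>Z act w x"
  by (induction w) (simp_all add: R_smul)

lemmas act_lin = act_add act_diff act_smul

lemma R_bas_B: "i < n \<Longrightarrow> B (R 1 (bas i) x) (R 1 (bas i) y) = B x y"
  by (simp add: R_def B_lin B_bas A_diag B_sym[of "bas i" y] algebra_simps)

lemma R_bas_invol: "i < n \<Longrightarrow> R 1 (bas i) (R 1 (bas i) x) = x"
  by (rule coord_ext) (simp add: R_def B_lin B_bas A_diag algebra_simps)

lemma act_B: "w \<in> lists {..<n} \<Longrightarrow> B (act w x) (act w y) = B x y"
  by (induction w) (simp_all add: R_bas_B)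

lemma act_rev1: "w \<in> lists {..<n} \<Longrightarrow> act (rev w) (act w x) = x"
  by (induction w arbitrary: x) (simp_all add: act_append R_bas_invol)

lemma act_rev2: "w \<in> lists {..<n} \<Longrightarrow> act w (act (rev w) x) = x"
  using act_rev1[of "rev w" x] by (auto simp: lists_eq_set)

lemma R_veq: "x \<approx> y \<Longrightarrow> u \<approx> v \<Longrightarrow> [s = t] (mod p) \<Longrightarrow> R s u x \<approx> R t v y"
  unfolding R_def by (intro veq_diff veq_smul cong_mult B_cong)

lemma act_veq: "x \<approx> y \<Longrightarrow> act w x \<approx> act w y"
  by (induction w) (auto intro: R_veq)

lemma act_R: "w \<in> lists {..<n} \<Longrightarrow> act w (R s v x) = R s (act w v) (act w x)"
  by (simp add: R_def act_lin act_B)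

definition supp_on :: "nat set \<Rightarrow> ivec \<Rightarrow> bool"
  where "supp_on K x \<longleftrightarrow> (\<forall>i. i \<notin> K \<longrightarrow> p dvd coord x i)"

lemma supp_on_add: "supp_on K x \<Longrightarrow> supp_on K y \<Longrightarrow> supp_on K (x + y)"
  by (simp add: supp_on_def)

lemma supp_on_diff: "supp_on K x \<Longrightarrow> supp_on K y \<Longrightarrow> supp_on K (x - y)"
  by (simp add: supp_on_def)

lemma supp_on_smul: "supp_on K x \<Longrightarrow> supp_on K (t *\<^sub>Z x)"
  by (simp add: supp_on_def)

lemma supp_on_bas: "i \<in> K \<Longrightarrow> supp_on K (bas i)"
  by (auto simp: supp_on_def coord_bas)

lemmas supp_on_lin = supp_on_add supp_on_diff supp_on_smul supp_on_bas

lemma supp_on_mono: "supp_on K x \<Longrightarrow> K \<subseteq> K' \<Longrightarrow> supp_on K' x"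
  by (auto simp: supp_on_def)

lemma supp_on_veq: "supp_on K x \<Longrightarrow> x \<approx> y \<Longrightarrow> supp_on K y"
  unfolding supp_on_def veq_def by (metis cong_dvd_iff)

lemma act_diff_supp: "w \<in> lists K \<Longrightarrow> supp_on K (act w x - x)"
proof (induction w)
  case (Cons i w)
  have "act (i # w) x - x = (act w x - x) - B (act w x) (bas i) *\<^sub>Z bas i"
    by (rule coord_ext) (simp add: R_def)
  moreover have "supp_on K (act w x - x)" "i \<in> K"
    using Cons by auto
  ultimately show ?case
    by (simp only: supp_on_lin)
qed (simp add: supp_on_def)

lemma act_supp: "w \<in> lists K \<Longrightarrow> supp_on K x \<Longrightarrow> supp_on K (act w x)"
  using supp_on_add[OF act_diff_supp, of w K x x] by simp

definition inG :: "nat set \<Rightarrow> (ivec \<Rightarrow> ivec) \<Rightarrow> bool"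
  where "inG K T \<longleftrightarrow> (\<exists>w\<in>lists K. \<forall>x. act w x \<approx> T x)"

lemma inG_act: "w \<in> lists K \<Longrightarrow> inG K (act w)"
  by (auto simp: inG_def)

lemma inG_comp: "inG K S \<Longrightarrow> inG K T \<Longrightarrow> inG K (\<lambda>x. S (T x))"
proof -
  assume "inG K S" "inG K T"
  then obtain u w where uw: "u \<in> lists K" "w \<in> lists K"
    "\<And>x. act u x \<approx> S x" "\<And>x. act w x \<approx> T x"
    by (auto simp: inG_def)
  have "act (u @ w) x \<approx> S (T x)" for x
    unfolding act_append using act_veq[OF uw(4)] uw(3) veq_trans by blast
  then show ?thesis using uw unfolding inG_def
    by (metis append_in_lists_conv)
qed

lemma inG_cong: "inG K S \<Longrightarrow> (\<And>x. S x \<approx> T x) \<Longrightarrow> inG K T"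
  unfolding inG_def by (meson veq_trans)

lemma inG_mono: "inG K T \<Longrightarrow> K \<subseteq> K' \<Longrightarrow> inG K' T"
  unfolding inG_def using lists_mono by blast

lemma inG_id: "inG K (\<lambda>x. x)"
  unfolding inG_def by (rule bexI[of _ "[]"]) auto

lemma inG_bas: "i \<in> K \<Longrightarrow> inG K (R 1 (bas i))"
  unfolding inG_def by (rule bexI[of _ "[i]"]) auto

text \<open>The Eichler transformation along \<open>c\<close>; an isometry if \<open>c\<close> is isotropic and orthogonal to \<open>v\<close>.\<close>

definition E :: "ivec \<Rightarrow> ivec \<Rightarrow> ivec \<Rightarrow> ivec"
  where "E c v x = x + B x c *\<^sub>Z v - (B x v + hf * B v v * B x c) *\<^sub>Z c"

lemma E_veq: "x \<approx> y \<Longrightarrow> c \<approx> d \<Longrightarrow> u \<approx> v \<Longrightarrow> E c u x \<approx> E d v y"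
  unfolding E_def by (intro veq_diff veq_add veq_smul cong_mult cong_add B_cong cong_refl)

text \<open>For fixed isotropic \<open>c\<close> the Eichler transformations form an additive group
  indexed by the complement of \<open>c\<close>. This turns membership in a parabolic subgroup into
  linear algebra on the vectors \<open>v\<close>.\<close>

lemma E_add:
  assumes "[B c c = 0] (mod p)" "[B u c = 0] (mod p)" "[B v c = 0] (mod p)"
  shows "E c u (E c v x) \<approx> E c (u + v) x"
proof -
  define y where "y = E c v x"
  have yc: "[B y c = B x c] (mod p)"
  proof -
    have "[B x c + B x c * B v c - (B x v + hf * B v v * B x c) * B c c
        = B x c + B x c * 0 - (B x v + hf * B v v * B x c) * 0] (mod p)"
      using assms by (intro cong_add cong_diff cong_mult cong_refl)
    then show ?thesis by (simp add: y_def E_def B_lin)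
  qed
  have yu: "[B y u = B x u + B x c * B v u] (mod p)"
  proof -
    have "[B x u + B x c * B v u - (B x v + hf * B v v * B x c) * B u c
        = B x u + B x c * B v u - (B x v + hf * B v v * B x c) * 0] (mod p)"
      using assms by (intro cong_add cong_diff cong_mult cong_refl)
    then show ?thesis by (simp add: y_def E_def B_lin B_sym[of u c])
  qed
  have h: "[hf * (B u u + B v v + 2 * B u v) = hf * (B u u + B v v) + B u v] (mod p)"
    using cong_add[OF cong_refl[of "hf * (B u u + B v v)"] cong_mult[OF hf_cong cong_refl[of "B u v"]]]
    by (simp add: algebra_simps)
  have "E c u y \<approx> y + B x c *\<^sub>Z u - ((B x u + B x c * B v u) + hf * B u u * B x c) *\<^sub>Z c"
    unfolding E_def using yc yu
    by (intro veq_diff veq_add veq_smul cong_mult cong_add cong_refl veq_refl)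
  also have "\<dots> = x + B x c *\<^sub>Z (u + v)
      - (B x (u + v) + (hf * (B u u + B v v) + B u v) * B x c) *\<^sub>Z c"
    by (rule coord_ext) (simp add: y_def E_def B_lin B_sym[of v u] algebra_simps)
  also have "\<dots> \<approx> E c (u + v) x"
    unfolding E_def using cong_sym[OF h]
    by (intro veq_diff veq_add veq_smul cong_mult cong_add veq_refl)
      (auto simp: B_lin B_sym[of v u] algebra_simps)
  finally show ?thesis unfolding y_def .
qed

lemma E_self:
  assumes "[B c c = 0] (mod p)"
  shows "E c (t *\<^sub>Z c) x \<approx> x"
proof -
  have "[t * B x c + hf * (t * (t * B c c)) * B x c = t * B x c + hf * (t * (t * 0)) * B x c] (mod p)"
    using assms by (intro cong_add cong_mult cong_refl)
  then have "x + (t * B x c) *\<^sub>Z c - (t * B x c + hf * (t * (t * B c c)) * B x c) *\<^sub>Z c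
     \<approx> x + (t * B x c) *\<^sub>Z c - (t * B x c) *\<^sub>Z c"
    by (intro veq_diff veq_add veq_smul veq_refl) simp_all
  moreover have "E c (t *\<^sub>Z c) x = x + (t * B x c) *\<^sub>Z c - (t * B x c + hf * (t * (t * B c c)) * B x c) *\<^sub>Z c"
    by (rule coord_ext) (simp add: E_def B_lin algebra_simps)
  ultimately show ?thesis by simp
qed

text \<open>The source of every Eichler transformation used here: \<open>a\<close> and
  \<open>a + t *\<^sub>Z c\<close> are roots of equal norm that agree modulo
  \<open>c\<close>.\<close>

lemma R_R_E:
  assumes "[B c c = 0] (mod p)" "[B a c = 0] (mod p)" "[B a a = 2] (mod p)"
  shows "R 1 a (R 1 (a + t *\<^sub>Z c) x) \<approx> E c (t *\<^sub>Z a) x"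
proof -
  define b where "b = B x a + t * B x c"
  define y where "y = R 1 (a + t *\<^sub>Z c) x"
  have y: "y = x - b *\<^sub>Z (a + t *\<^sub>Z c)"
    by (rule coord_ext) (simp add: y_def R_def b_def B_lin)
  have "[B x a - b * (B a a + t * B a c) = B x a - b * (2 + t * 0)] (mod p)"
    using assms by (intro cong_diff cong_add cong_mult cong_refl)
  then have ya: "[B y a = B x a - 2 * b] (mod p)"
    by (simp add: y B_lin B_sym[of c a] algebra_simps)
  have "[hf * (t * (t * B a a)) * B x c = hf * (t * (t * 2)) * B x c] (mod p)"
    using assms by (intro cong_mult cong_refl)
  also have "[hf * (t * (t * 2)) * B x c = t * t * B x c] (mod p)"
    using cong_mult[OF hf_cong cong_refl[of "t * t * B x c"]] by (simp add: mult_ac)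
  finally have q: "[hf * (t * (t * B a a)) * B x c = t * t * B x c] (mod p)" .
  have "R 1 a y \<approx> y - (B x a - 2 * b) *\<^sub>Z a"
    unfolding R_def using ya by (intro veq_diff veq_smul veq_refl) simp
  also have "\<dots> = x + B x c *\<^sub>Z (t *\<^sub>Z a) - (t * B x a + t * t * B x c) *\<^sub>Z c"
    by (rule coord_ext) (simp add: y b_def algebra_simps)
  also have "\<dots> \<approx> E c (t *\<^sub>Z a) x"
    unfolding E_def using cong_sym[OF q]
    by (intro veq_diff veq_smul veq_add cong_add veq_refl) (simp_all add: B_lin mult_ac)
  finally show ?thesis unfolding y_def .
qed

lemma E_conj: "w \<in> lists {..<n} \<Longrightarrow> act w (E c v (act (rev w) x)) = E (act w c) (act w v) x"
proof -
  assume w: "w \<in> lists {..<n}"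
  have "B (act (rev w) x) u = B x (act w u)" for u
    using act_B[OF w, of "act (rev w) x" u] by (simp add: act_rev2[OF w])
  then show ?thesis using w by (simp add: E_def act_lin act_rev2 act_B)
qed

text \<open>The image of \<open>x\<close> is \<open>x\<close> plus \<open>B x c\<close> times the
  vector, up to a multiple of \<open>c\<close>. Dividing \<open>y - x\<close> by
  \<open>B x c\<close> makes the main part equal to \<open>y\<close>, and equality of the norms is
  exactly what kills the coefficient of \<open>c\<close>.\<close>

lemma E_trans:
  assumes "[B c c = 0] (mod p)" "[B x c = B y c] (mod p)" "[B x x = B y y] (mod p)"
    and t: "[t * B x c = 1] (mod p)"
  shows "E c (t *\<^sub>Z (y - x)) x \<approx> y"
proof -
  define b where "b = B x c"
  define v where "v = t *\<^sub>Z (y - x)"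
  have "[hf * B v v * b + B x v = 0] (mod p)"
  proof -
    have "hf * B v v * b + B x v = hf * t * (B y y + B x x - 2 * B x y) * (t * b) + t * (B x y - B x x)"
      by (simp add: v_def B_lin B_sym[of y x] algebra_simps)
    also have "[\<dots> = hf * t * (B x x + B x x - 2 * B x y) * 1 + t * (B x y - B x x)] (mod p)"
      using assms unfolding b_def by (intro cong_add cong_diff cong_mult cong_refl) (auto intro: cong_sym)
    also have "hf * t * (B x x + B x x - 2 * B x y) * 1 + t * (B x y - B x x)
        = (2 * hf) * (t * (B x x - B x y)) + t * (B x y - B x x)"
      by (simp add: algebra_simps)
    also have "[(2 * hf) * (t * (B x x - B x y)) + t * (B x y - B x x) = 1 * (t * (B x x - B x y)) + t * (B x y - B x x)] (mod p)"
      by (intro cong_add cong_mult hf_cong cong_refl)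
    also have "1 * (t * (B x x - B x y)) + t * (B x y - B x x) = 0"
      by (simp add: algebra_simps)
    finally show ?thesis .
  qed
  then have "x + b *\<^sub>Z v - (B x v + hf * B v v * b) *\<^sub>Z c \<approx> x + b *\<^sub>Z v - 0 *\<^sub>Z c"
    by (intro veq_diff veq_smul veq_refl) (simp add: add.commute)
  also have "\<dots> = x + (t * B x c) *\<^sub>Z (y - x)"
    by (rule coord_ext) (simp add: v_def b_def)
  also have "\<dots> \<approx> x + 1 *\<^sub>Z (y - x)"
    using t by (intro veq_add veq_smul veq_refl)
  also have "\<dots> = y" by (rule coord_ext) simp
  finally show ?thesis by (simp add: E_def v_def b_def)
qed

end

context refl_rep
begin

lemma p_pos: "p > 0"
  using p_gt_2 by simp

section \<open>Squares modulo \<open>p\<close>\<close>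

lemma sq_cong_cases:
  assumes "[x * x = y * y] (mod p)"
  shows "[x = y] (mod p) \<or> [x = - y] (mod p)"
proof -
  have "p dvd (x - y) * (x + y)"
    using assms by (simp add: cong_iff_dvd_diff algebra_simps)
  then have "p dvd x - y \<or> p dvd x + y"
    using prime_p by (simp add: prime_dvd_mult_iff)
  then show ?thesis by (auto simp: cong_iff_dvd_diff)
qed

definition hp :: int where "hp = (p - 1) div 2"

lemma two_hp: "2 * hp = p - 1"
  using odd_p by (auto simp: hp_def elim!: oddE)

lemma sq_inj:
  assumes "\<not> p dvd a"
  shows "inj_on (\<lambda>x. (a * (x * x) + d) mod p) {0..hp}"
proof (rule inj_onI)
  fix x y assume xy: "x \<in> {0..hp}" "y \<in> {0..hp}"
    and "(a * (x * x) + d) mod p = (a * (y * y) + d) mod p"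
  then have "[a * (x * x) + d = a * (y * y) + d] (mod p)"
    by (simp add: cong_def)
  then have "[x * x * a = y * y * a] (mod p)"
    by (simp add: cong_add_rcancel mult.commute)
  then have "[x * x = y * y] (mod p)"
    using assms cong_cancel by blast
  then have "p dvd x - y \<or> p dvd x + y"
    using sq_cong_cases by (auto simp: cong_iff_dvd_diff)
  moreover have "x = y" if "p dvd x - y"
  proof (rule ccontr)
    assume "x \<noteq> y"
    then have "0 < x - y \<and> x - y < p \<or> 0 < y - x \<and> y - x < p"
      using xy two_hp by auto
    then show False
      using that zdvd_not_zless[of "x - y" p] zdvd_not_zless[of "y - x" p]
      by (auto simp: dvd_diff_commute)
  qed
  moreover have "x = y" if "p dvd x + y"
    using that xy two_hp p_pos zdvd_not_zless[of "x + y" p] by fastforce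
  ultimately show "x = y" by blast
qed

text \<open>Pigeonhole: \<open>a * (x * x)\<close> and \<open>d - b * (y * y)\<close> each take
  \<open>(p + 1) / 2\<close> values modulo \<open>p\<close>, so a value is shared.\<close>

lemma conic_mod:
  assumes "\<not> p dvd a" "\<not> p dvd b"
  obtains x y where "[a * (x * x) + b * (y * y) = d] (mod p)"
proof -
  let ?f = "\<lambda>x. (a * (x * x) + 0) mod p" and ?g = "\<lambda>y. ((- b) * (y * y) + d) mod p"
  have inj: "inj_on ?f {0..hp}" "inj_on ?g {0..hp}"
    using assms by (intro sq_inj; simp)+
  have hp0: "hp \<ge> 0" using two_hp p_gt_2 by simp
  have "?f ` {0..hp} \<inter> ?g ` {0..hp} \<noteq> {}"
  proof
    assume "?f ` {0..hp} \<inter> ?g ` {0..hp} = {}"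
    then have "card (?f ` {0..hp} \<union> ?g ` {0..hp}) = nat (hp + 1) + nat (hp + 1)"
      by (subst card_Un_disjoint) (use inj in \<open>simp_all add: card_image\<close>)
    moreover have "card (?f ` {0..hp} \<union> ?g ` {0..hp}) \<le> card {0..<p}"
      using p_pos by (intro card_mono) auto
    ultimately show False using two_hp hp0 by simp
  qed
  then obtain x y where "?f x = ?g y" by blast
  then have "[a * (x * x) = d - b * (y * y)] (mod p)"
    by (simp add: cong_def)
  from cong_add[OF this cong_refl[of "b * (y * y)"]]
  have "[a * (x * x) + b * (y * y) = d] (mod p)"
    by (simp only: diff_add_cancel)
  then show ?thesis by (rule that)
qed

section \<open>Reflections, Eichler transformations and orbits of a parabolic subgroup\<close>

lemma R_scale: "R s (t *\<^sub>Z v) x = R (s * t * t) v x"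
  by (rule coord_ext) (simp add: R_def B_lin algebra_simps)

lemma R_adj: "B (R s x z) u = B z (R s x u)"
  by (simp add: R_def B_lin B_sym[of x u])

lemma R_invol:
  assumes "[s * B x x = 2] (mod p)"
  shows "R s x (R s x z) \<approx> z"
proof -
  have "R s x (R s x z) = z - (2 * (s * B z x) - (s * B z x) * (s * B x x)) *\<^sub>Z x"
    by (rule coord_ext) (simp add: R_def B_lin algebra_simps)
  also have "\<dots> \<approx> z - (2 * (s * B z x) - (s * B z x) * 2) *\<^sub>Z x"
    using assms by (intro veq_diff veq_smul veq_refl cong_diff cong_mult cong_refl)
  finally show ?thesis by simp
qed

lemma R_isom:
  assumes "[s * B x x = 2] (mod p)"
  shows "[B (R s x u) (R s x v) = B u v] (mod p)"
  unfolding R_adj by (intro B_cong R_invol assms veq_refl)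

lemma R_conj:
  assumes "[s * B x x = 2] (mod p)"
  shows "R s x (R t u (R s x z)) \<approx> R t (R s x u) z"
proof -
  have "R s x (R t u (R s x z)) = R s x (R s x z) - (t * B z (R s x u)) *\<^sub>Z R s x u"
    unfolding R_def[of t] by (simp add: R_diff R_smul R_adj)
  also have "\<dots> \<approx> z - (t * B z (R s x u)) *\<^sub>Z R s x u"
    by (intro veq_diff veq_refl R_invol assms)
  finally show ?thesis by (simp add: R_def[of t])
qed

lemma R_supp: "supp_on K x \<Longrightarrow> supp_on K z \<Longrightarrow> supp_on K (R s x z)"
  unfolding R_def by (intro supp_on_lin)

definition eichler_in :: "nat set \<Rightarrow> ivec \<Rightarrow> ivec \<Rightarrow> bool"
  where "eichler_in K c v \<longleftrightarrow> inG K (E c v)"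

lemma eichler_in_veq: "eichler_in K c v \<Longrightarrow> c \<approx> d \<Longrightarrow> v \<approx> u \<Longrightarrow> eichler_in K d u"
  unfolding eichler_in_def by (erule inG_cong) (intro E_veq veq_refl)

lemma eichler_in_add:
  assumes "eichler_in K c u" "eichler_in K c v" "[B c c = 0] (mod p)" "[B u c = 0] (mod p)" "[B v c = 0] (mod p)"
  shows "eichler_in K c (u + v)"
  unfolding eichler_in_def
  by (rule inG_cong[OF inG_comp[OF assms(1,2)[unfolded eichler_in_def]]]) (intro E_add assms)

lemma eichler_in_zero: "eichler_in K c 0"
proof -
  have "E c 0 x = x" for x
    using B_smul_left[of 0 0] B_smul_right[of x 0 0] by (intro coord_ext) (simp add: E_def)
  then show ?thesis unfolding eichler_in_def using inG_cong[OF inG_id] by simp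
qed

lemma eichler_in_self: "[B c c = 0] (mod p) \<Longrightarrow> eichler_in K c (t *\<^sub>Z c)"
  unfolding eichler_in_def by (rule inG_cong[OF inG_id]) (rule veq_sym, rule E_self)

lemma eichler_in_smul:
  assumes "eichler_in K c v" "[B c c = 0] (mod p)" "[B v c = 0] (mod p)"
  shows "eichler_in K c (t *\<^sub>Z v)"
proof -
  have nat: "eichler_in K c (int k *\<^sub>Z v)" for k
  proof (induction k)
    case (Suc k)
    have "[B (int k *\<^sub>Z v) c = int k * 0] (mod p)"
      unfolding B_lin using assms(3) by (intro cong_mult cong_refl)
    then have "eichler_in K c (v + int k *\<^sub>Z v)"
      using Suc assms by (intro eichler_in_add) simp_all
    moreover have "v + int k *\<^sub>Z v = int (Suc k) *\<^sub>Z v"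
      by (rule coord_ext) (simp add: algebra_simps)
    ultimately show ?case by simp
  qed (use eichler_in_zero in simp)
  \<comment> \<open>Modulo \<open>p\<close> every scalar is a natural number, so repeated addition
    reaches all multiples.\<close>
  have "[t mod p = t] (mod p)" by (simp add: cong_def)
  moreover have "t mod p = int (nat (t mod p))" using p_pos by simp
  ultimately have "int (nat (t mod p)) *\<^sub>Z v \<approx> t *\<^sub>Z v"
    by (intro veq_smul) auto
  then show ?thesis using nat eichler_in_veq veq_refl by blast
qed

lemma eichler_in_act:
  assumes "K \<subseteq> {..<n}" "w \<in> lists K" "eichler_in K c v"
  shows "eichler_in K (act w c) (act w v)"
proof -
  have w: "w \<in> lists {..<n}" using assms lists_mono by blast
  have "inG K (\<lambda>x. act w (E c v (act (rev w) x)))"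
    by (rule inG_comp[OF inG_act[OF assms(2)] inG_comp[OF assms(3)[unfolded eichler_in_def] inG_act]])
      (use assms(2) in \<open>auto simp: in_lists_conv_set\<close>)
  then show ?thesis unfolding eichler_in_def by (simp add: E_conj[OF w])
qed

definition orb :: "nat set \<Rightarrow> ivec \<Rightarrow> ivec \<Rightarrow> bool"
  where "orb K x y \<longleftrightarrow> (\<exists>w\<in>lists K. act w x \<approx> y)"

lemma orb_trans [trans]:
  assumes "orb K x y" "orb K y z"
  shows "orb K x z"
proof -
  obtain u w where "u \<in> lists K" "w \<in> lists K" "act u x \<approx> y" "act w y \<approx> z"
    using assms by (auto simp: orb_def)
  moreover from this have "act (w @ u) x \<approx> z"
    unfolding act_append using act_veq veq_trans by blast
  ultimately show ?thesis
    unfolding orb_def by (intro bexI[of _ "w @ u"]) auto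
qed

lemma orb_sym:
  assumes "K \<subseteq> {..<n}" "orb K x y"
  shows "orb K y x"
proof -
  obtain w where w: "w \<in> lists K" "act w x \<approx> y"
    using assms by (auto simp: orb_def)
  then have "w \<in> lists {..<n}" using assms(1) lists_mono by blast
  then have "act (rev w) y \<approx> x"
    using act_veq[OF veq_sym[OF w(2)], of "rev w"] by (simp add: act_rev1)
  then show ?thesis using w unfolding orb_def
    by (intro bexI[of _ "rev w"]) (auto simp: in_lists_conv_set)
qed

lemma orb_inG: "inG K T \<Longrightarrow> T x \<approx> y \<Longrightarrow> orb K x y"
  unfolding inG_def orb_def using veq_trans by blast

lemma orb_supp: "orb K x y \<Longrightarrow> supp_on K x \<Longrightarrow> supp_on K y"
  unfolding orb_def using act_supp supp_on_veq by blast

lemma orb_B: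
  assumes "orb K x y" "K \<subseteq> {..<n}"
  shows "[B y y = B x x] (mod p)"
proof -
  obtain w where w: "w \<in> lists K" "act w x \<approx> y"
    using assms by (auto simp: orb_def)
  then have "w \<in> lists {..<n}" using assms(2) lists_mono by blast
  then show ?thesis
    using B_cong[OF w(2) w(2)] by (simp add: act_B cong_sym)
qed

lemma inG_R_orb:
  assumes "K \<subseteq> {..<n}" "orb K x y" "inG K (R s x)"
  shows "inG K (R s y)"
proof -
  obtain w where w: "w \<in> lists K" "act w x \<approx> y"
    using assms by (auto simp: orb_def)
  then have wn: "w \<in> lists {..<n}" using assms(1) lists_mono by blast
  have "inG K (\<lambda>z. act w (R s x (act (rev w) z)))"
    using assms w by (intro inG_comp[OF inG_act] inG_comp[OF assms(3) inG_act]) (auto simp: in_lists_conv_set)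
  then show ?thesis
    by (rule inG_cong) (use w in \<open>auto simp: act_R[OF wn] act_rev2[OF wn] intro: R_veq\<close>)
qed

lemma orb_E:
  assumes "\<And>t. eichler_in K c (t *\<^sub>Z (y - x))" "[B c c = 0] (mod p)"
    "[B x c = B y c] (mod p)" "[B x x = B y y] (mod p)" "\<not> p dvd B x c"
  shows "orb K x y"
proof -
  obtain t where "[t * B x c = 1] (mod p)" using inv_mod[OF assms(5)] by blast
  then have "E c (t *\<^sub>Z (y - x)) x \<approx> y"
    using assms by (intro E_trans)
  then show ?thesis using assms(1)[of t] orb_inG unfolding eichler_in_def by blast
qed

end

text \<open>\<open>nu\<close> represents the nonsquare class, and its inverse \<open>s\<close> is
  the scalar of the reflections of norm \<open>nu\<close>. As the form is doubled, norm
  \<open>nu\<close> means \<open>B x x = 2 * nu\<close>.\<close>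

locale refl_nu = refl_rep +
  fixes nu s :: int
  assumes nu_nonsquare: "\<not> [t * t = nu] (mod p)"
    and s_nu: "[s * nu = 1] (mod p)"
begin

lemma nu_nonzero: "\<not> p dvd nu"
  using nu_nonsquare[of 0] by (simp add: cong_iff_dvd_diff)

lemma s_norm:
  assumes "[B x x = 2 * nu] (mod p)"
  shows "[s * B x x = 2] (mod p)"
proof -
  have "[s * B x x = s * (2 * nu)] (mod p)"
    using assms by (intro cong_mult cong_refl)
  also have "s * (2 * nu) = 2 * (s * nu)" by simp
  also have "[2 * (s * nu) = 2 * 1] (mod p)"
    using s_nu by (intro cong_mult cong_refl)
  finally show ?thesis by simp
qed

text \<open>The \<open>hp\<close> nonzero squares and their \<open>hp\<close> multiples by
  \<open>nu\<close> are disjoint, since a common value would make \<open>nu\<close> a square;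
  together they exhaust the \<open>2 * hp\<close> nonzero residues.\<close>

lemma square_or_nu_square:
  assumes "\<not> p dvd a"
  obtains t where "[a = t * t] (mod p)" | t where "[a = nu * (t * t)] (mod p)"
proof -
  let ?f = "\<lambda>x. (1 * (x * x) + 0) mod p" and ?g = "\<lambda>y. (nu * (y * y) + 0) mod p"
  have inj: "inj_on ?f {1..hp}" "inj_on ?g {1..hp}"
    by (rule inj_on_subset[OF sq_inj]; use p_gt_2 zdvd_imp_le[of p 1] nu_nonzero in force)+
  have hp0: "hp \<ge> 0" using two_hp p_gt_2 by simp
  have nz: "\<not> p dvd x" if "x \<in> {1..hp}" for x
    using that two_hp zdvd_not_zless[of x p] by auto
  have "?f ` {1..hp} \<inter> ?g ` {1..hp} = {}"
  proof (rule ccontr)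
    assume "?f ` {1..hp} \<inter> ?g ` {1..hp} \<noteq> {}"
    then obtain x y where xy: "y \<in> {1..hp}" "?f x = ?g y" by blast
    then have c: "[x * x = nu * (y * y)] (mod p)" by (simp add: cong_def)
    obtain t where t: "[t * y = 1] (mod p)" using inv_mod[OF nz[OF xy(1)]] by blast
    have "(t * x) * (t * x) = t * t * (x * x)" by simp
    also have "[t * t * (x * x) = t * t * (nu * (y * y))] (mod p)"
      by (rule cong_mult[OF cong_refl c])
    also have "t * t * (nu * (y * y)) = nu * ((t * y) * (t * y))" by simp
    also have "[nu * ((t * y) * (t * y)) = nu * (1 * 1)] (mod p)"
      using t by (intro cong_mult cong_refl)
    finally show False using nu_nonsquare[of "t * x"] by simp
  qed
  then have "card (?f ` {1..hp} \<union> ?g ` {1..hp}) = nat hp + nat hp"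
    by (subst card_Un_disjoint) (use inj in \<open>simp_all add: card_image\<close>)
  moreover have "card {1..<p} = nat hp + nat hp" using two_hp hp0 by simp
  moreover have "?f ` {1..hp} \<union> ?g ` {1..hp} \<subseteq> {1..<p}"
  proof -
    have zmod: "z mod p \<in> {1..<p}" if "\<not> p dvd z" for z
    proof -
      have "z mod p \<noteq> 0" "0 \<le> z mod p" "z mod p < p"
        using that p_pos by (simp_all add: dvd_eq_mod_eq_0)
      then show ?thesis by simp
    qed
    have "?f x \<in> {1..<p} \<and> ?g x \<in> {1..<p}" if "x \<in> {1..hp}" for x
    proof -
      have "\<not> p dvd x * x" "\<not> p dvd nu * (x * x)"
        using nz[OF that] nu_nonzero prime_p by (simp_all add: prime_dvd_mult_iff)
      then show ?thesis using zmod[of "x * x"] zmod[of "nu * (x * x)"] by simp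
    qed
    then show ?thesis by blast
  qed
  ultimately have "?f ` {1..hp} \<union> ?g ` {1..hp} = {1..<p}"
    by (intro card_subset_eq) auto
  moreover have "a mod p \<in> {1..<p}"
  proof -
    have "a mod p \<noteq> 0" "0 \<le> a mod p" "a mod p < p"
      using assms p_pos by (simp_all add: dvd_eq_mod_eq_0)
    then show ?thesis by simp
  qed
  ultimately have "a mod p \<in> ?f ` {1..hp} \<or> a mod p \<in> ?g ` {1..hp}" by blast
  then obtain x where "a mod p = ?f x \<or> a mod p = ?g x" by blast
  then have "[a = x * x] (mod p) \<or> [a = nu * (x * x)] (mod p)"
    by (simp add: cong_def)
  then show ?thesis using that by blast
qed

definition full :: "nat set \<Rightarrow> bool"
  where "full K \<longleftrightarrow>
    (\<forall>x. supp_on K x \<and> [B x x = 2] (mod p) \<longrightarrow> inG K (R 1 x)) \<and>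
    (\<forall>x y. supp_on K x \<and> supp_on K y \<and> [B x x = 2 * nu] (mod p) \<and> [B y y = 2 * nu] (mod p)
       \<longrightarrow> inG K (\<lambda>z. R s x (R s y z)))"

text \<open>Reflections of the span of \<open>K\<close> normalize the subgroup: conjugation turns a
  generator into the reflection in another vector of norm 1, which \<open>F1\<close>
  provides.\<close>

lemma conj_in:
  assumes F1: "\<And>x. supp_on K x \<Longrightarrow> [B x x = 2] (mod p) \<Longrightarrow> inG K (R 1 x)"
    and K: "K \<subseteq> {..<n}" and x: "supp_on K x" "[s * B x x = 2] (mod p)"
    and w: "w \<in> lists K"
  shows "inG K (\<lambda>z. R s x (act w (R s x z)))"
  using w
proof (induction w)
  case Nil
  show ?case
    unfolding act.simps by (rule inG_cong[OF inG_id]) (rule veq_sym[OF R_invol[OF x(2)]])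
next
  case (Cons k w)
  have k: "k < n" "k \<in> K" using Cons K by auto
  have "[B (R s x (bas k)) (R s x (bas k)) = 2] (mod p)"
    using R_isom[OF x(2), of "bas k" "bas k"] B_bas[OF k(1) k(1)] by (simp add: A_diag)
  then have Rk: "inG K (R 1 (R s x (bas k)))"
    using k x by (intro F1 R_supp supp_on_bas) auto
  have IH: "inG K (\<lambda>z. R s x (act w (R s x z)))"
    using Cons by simp
  have step: "R 1 (R s x (bas k)) (R s x (act w (R s x z))) \<approx> R s x (act (k # w) (R s x z))" for z
  proof -
    have "R 1 (R s x (bas k)) (R s x (act w (R s x z)))
      \<approx> R s x (R 1 (bas k) (R s x (R s x (act w (R s x z)))))"
      using veq_sym[OF R_conj[OF x(2)]] .
    also have "\<dots> \<approx> R s x (R 1 (bas k) (act w (R s x z)))"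
      by (intro R_veq R_invol x veq_refl cong_refl)
    finally show ?thesis by simp
  qed
  show ?case
    by (rule inG_cong[OF inG_comp[OF Rk IH]]) (rule step)
qed

text \<open>If \<open>w\<close> carries \<open>x\<close> to \<open>y\<close>, then
  \<open>R s y\<close> is the conjugate of \<open>R s x\<close> by \<open>w\<close>. Hence the
  product of both reflections is the conjugate of \<open>w\<close> by \<open>R s x\<close>, an
  element of the subgroup by \<open>conj_in\<close>, followed by the inverse of
  \<open>w\<close>.\<close>

lemma full_if_transitive:
  assumes K: "K \<subseteq> {..<n}" and k: "k \<in> K"
    and tr1: "\<And>x. supp_on K x \<Longrightarrow> [B x x = 2] (mod p) \<Longrightarrow> orb K x e"
    and trnu: "\<And>x. supp_on K x \<Longrightarrow> [B x x = 2 * nu] (mod p) \<Longrightarrow> orb K x N"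
  shows "full K"
proof -
  have F1: "inG K (R 1 x)" if x: "supp_on K x" "[B x x = 2] (mod p)" for x
  proof -
    have "orb K (bas k) e"
      using k K B_bas[of k k] by (intro tr1 supp_on_bas) (auto simp: A_diag)
    also have "orb K e x" using tr1[OF x] K orb_sym by blast
    finally show ?thesis using inG_R_orb[OF K _ inG_bas[OF k]] by blast
  qed
  have F2: "inG K (\<lambda>z. R s x (R s y z))"
    if x: "supp_on K x" "[B x x = 2 * nu] (mod p)" and y: "supp_on K y" "[B y y = 2 * nu] (mod p)" for x y
  proof -
    have "orb K x y" using trnu[OF x] orb_sym[OF K trnu[OF y]] orb_trans by blast
    then obtain w where w: "w \<in> lists K" "act w x \<approx> y" by (auto simp: orb_def)
    then have wn: "w \<in> lists {..<n}" using K lists_mono by blast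
    have "inG K (\<lambda>z. R s x (act w (R s x (act (rev w) z))))"
      by (rule inG_comp[OF conj_in[OF F1 K x(1) s_norm[OF x(2)] w(1)] inG_act])
        (use w in \<open>auto simp: in_lists_conv_set\<close>)
    then show ?thesis
      by (rule inG_cong) (use w in \<open>auto simp: act_R[OF wn] act_rev2[OF wn] intro!: R_veq\<close>)
  qed
  show ?thesis
    unfolding full_def by (intro conjI allI impI; elim conjE) (rule F1 F2; assumption)+
qed

end

section \<open>A criterion for containing all reflections of one square class\<close>

context refl_nu
begin

lemma cong_sum3:
  fixes x y z :: int
  assumes "[u1 = v1] (mod p)" "[u2 = v2] (mod p)" "[u3 = v3] (mod p)"
  shows "[x * u1 + y * u2 + z * u3 = x * v1 + y * v2 + z * v3] (mod p)"
  using assms by (intro cong_add cong_mult cong_refl)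

text \<open>\<open>c\<close> and \<open>c'\<close> span a hyperbolic plane and \<open>e\<close> is a
  root orthogonal to it. All Eichler transformations along \<open>c\<close> bring a vector into the
  span of the three; a single one along \<open>c'\<close> then suffices to normalize it.\<close>

lemma full_if_E:
  assumes K: "K \<subseteq> {..<n}" "k \<in> K"
    and supp: "supp_on K c" "supp_on K c'" "supp_on K e"
    and cc: "[B c c = 0] (mod p)" "[B c' c' = 0] (mod p)" "\<not> p dvd B c c'"
    and ee: "[B e c = 0] (mod p)" "[B e c' = 0] (mod p)" "[B e e = 2] (mod p)"
    and S: "\<And>v. supp_on K v \<Longrightarrow> [B v c = 0] (mod p) \<Longrightarrow> eichler_in K c v"
    and S': "eichler_in K c' e"
  shows "full K"
proof -
  define \<kappa> where "\<kappa> = B c c'"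
  have \<kappa>: "\<not> p dvd \<kappa>" using cc by (simp add: \<kappa>_def)
  obtain ki where ki: "[ki * \<kappa> = 1] (mod p)" using inv_mod[OF \<kappa>] by blast
  define y where "y g a b = g *\<^sub>Z e + a *\<^sub>Z c + b *\<^sub>Z c'" for g a b
  have yc: "[B (y g a b) c = b * \<kappa>] (mod p)" for g a b
    using cong_sum3[OF ee(1) cc(1) cong_refl[of "B c' c"], of g a b]
    by (simp add: y_def B_lin \<kappa>_def B_sym[of c' c])
  have yc': "[B (y g a b) c' = a * \<kappa>] (mod p)" for g a b
    using cong_sum3[OF ee(2) cong_refl[of "B c c'"] cc(2), of g a b]
    by (simp add: y_def B_lin \<kappa>_def)
  have ye: "[B (y g a b) e = 2 * g] (mod p)" for g a b
    using cong_sum3[OF ee(3,1,2), of g a b]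
    by (simp add: y_def B_lin B_sym[of c e] B_sym[of c' e] mult.commute)
  have yy: "[B (y g a b) (y g a b) = 2 * (g * g + a * b * \<kappa>)] (mod p)" for g a b
  proof -
    have "B (y g a b) (y g a b) = g * B (y g a b) e + a * B (y g a b) c + b * B (y g a b) c'"
      using B_lin unfolding y_def[of g a b] by (simp only: B_lin)
    also have "[g * B (y g a b) e + a * B (y g a b) c + b * B (y g a b) c'
      = g * (2 * g) + a * (b * \<kappa>) + b * (a * \<kappa>)] (mod p)"
      by (rule cong_sum3[OF ye yc yc'])
    finally show ?thesis by (simp add: algebra_simps)
  qed
  have ysupp: "supp_on K (y g a b)" for g a b
    unfolding y_def by (intro supp_on_lin supp)
  have moveE: "orb K x z"
    if "supp_on K x" "supp_on K z" "[B x c = B z c] (mod p)" "[B x x = B z z] (mod p)" "\<not> p dvd B x c" for x z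
  proof (rule orb_E[OF _ cc(1) that(3-5)])
    fix t
    have "[t * (B z c - B x c) = t * (B z c - B z c)] (mod p)"
      using that by (intro cong_mult cong_diff cong_refl)
    then show "eichler_in K c (t *\<^sub>Z (z - x))"
      using that by (intro S supp_on_lin) (simp_all add: B_lin)
  qed
  have BE_c: "[B (E c' (t *\<^sub>Z e) x) c = B x c - t * (B x e + t * B x c') * \<kappa>] (mod p)" for t x
  proof -
    have "B (E c' (t *\<^sub>Z e) x) c
      = B x c + (B x c' * t) * B e c - (t * B x e + t * t * (hf * B e e) * B x c') * B c' c"
      by (simp add: E_def B_lin algebra_simps)
    also have "[\<dots> = B x c + (B x c' * t) * 0 - (t * B x e + t * t * (hf * 2) * B x c') * B c' c] (mod p)"
      using ee by (intro cong_add cong_diff cong_mult cong_refl)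
    also have "[B x c + (B x c' * t) * 0 - (t * B x e + t * t * (hf * 2) * B x c') * B c' c
      = B x c + (B x c' * t) * 0 - (t * B x e + t * t * 1 * B x c') * B c' c] (mod p)"
      using hf_cong by (intro cong_add cong_diff cong_mult cong_refl) (simp add: mult.commute)
    finally show ?thesis by (simp add: \<kappa>_def B_sym[of c' c] algebra_simps)
  qed
  have S't: "inG K (E c' (t *\<^sub>Z e))" for t
    using eichler_in_smul[OF S' cc(2) ee(2)] by (simp add: eichler_in_def)
  \<comment> \<open>After \<open>E c' (t *\<^sub>Z e)\<close> the product with \<open>c\<close> has
    changed by a quadratic polynomial in \<open>t\<close>. If it vanished for both
    \<open>t = 1\<close> and \<open>t = - 1\<close>, adding the two conditions would give
    \<open>p dvd 2 * B x c'\<close>.\<close>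
  have step0: "\<exists>x'. orb K x x' \<and> \<not> p dvd B x' c" if "\<not> p dvd B x c'" for x
  proof (cases "p dvd B x c")
    case True
    show ?thesis
    proof (rule ccontr)
      assume "\<nexists>x'. orb K x x' \<and> \<not> p dvd B x' c"
      then have "p dvd B (E c' (t *\<^sub>Z e) x) c" for t
        using orb_inG[OF S't veq_refl] by blast
      then have "p dvd B x c - t * (B x e + t * B x c') * \<kappa>" for t
        using BE_c cong_dvd_iff by blast
      then have "p dvd t * (B x e + t * B x c') * \<kappa>" for t
        using True by (metis dvd_diff_right_iff)
      from this[of 1] this[of "-1"] have "p dvd (B x e + B x c') * \<kappa>" "p dvd (B x c' - B x e) * \<kappa>"
        by simp_all
      then have "p dvd B x e + B x c'" "p dvd B x c' - B x e"
        using \<kappa> prime_p prime_dvd_mult_iff by blast+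
      then have "p dvd (B x e + B x c') + (B x c' - B x e)" by (rule dvd_add)
      then have "p dvd 2 * B x c'" by simp
      then show False
        using that not_p_dvd_2 prime_p by (auto simp: prime_dvd_mult_iff)
    qed
  next
    case False
    then show ?thesis using orb_inG[OF inG_id veq_refl] by blast
  qed
  \<comment> \<open>A vector orthogonal to both \<open>c\<close> and \<open>c'\<close> is moved by
    the Eichler transformation along \<open>c\<close> with itself as vector: this subtracts
    \<open>B x x\<close> times \<open>c\<close>, which \<open>c'\<close> detects.\<close>
  have step1: "\<exists>x'. orb K x x' \<and> \<not> p dvd B x' c"
    if x: "supp_on K x" "[B x x = 2 * \<mu>] (mod p)" "\<not> p dvd \<mu>" for x \<mu>
  proof (cases "p dvd B x c \<and> p dvd B x c'")
    case True
    then have xc: "[B x c = 0] (mod p)" "[B x c' = 0] (mod p)" by (simp_all add: cong_0_iff)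
    have "B (E c x x) c' = B x c' + B x c * B x c' - (B x x + hf * B x x * B x c) * \<kappa>"
      by (simp add: E_def B_lin \<kappa>_def)
    also have "[\<dots> = 0 + 0 * 0 - (2 * \<mu> + hf * (2 * \<mu>) * 0) * \<kappa>] (mod p)"
      using xc x by (intro cong_add cong_diff cong_mult cong_refl)
    finally have "[B (E c x x) c' = - (2 * \<mu> * \<kappa>)] (mod p)" by simp
    moreover have "\<not> p dvd - (2 * \<mu> * \<kappa>)"
      using x(3) \<kappa> not_p_dvd_2 prime_p by (simp add: prime_dvd_mult_iff)
    ultimately have "\<not> p dvd B (E c x x) c'"
      using cong_dvd_iff by blast
    from step0[OF this] obtain x' where "orb K (E c x x) x'" "\<not> p dvd B x' c" by blast
    moreover have "orb K x (E c x x)"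
      using S[OF x(1) xc(1)] orb_inG veq_refl unfolding eichler_in_def by blast
    ultimately show ?thesis using orb_trans by blast
  next
    case False
    then show ?thesis using step0[of x] orb_inG[OF inG_id veq_refl] by blast
  qed
  \<comment> \<open>All \<open>y g a b\<close> with \<open>b = B x' c / \<kappa>\<close> have the
    same product with \<open>c\<close> as \<open>x'\<close>, so transitivity along \<open>c\<close>
    reaches each of them that has the right norm.\<close>
  have step2: "\<exists>b. \<not> p dvd b \<and> (\<forall>g a. [g * g + a * b * \<kappa> = \<mu>] (mod p) \<longrightarrow> orb K x (y g a b))"
    if x: "supp_on K x" "[B x x = 2 * \<mu>] (mod p)" "\<not> p dvd \<mu>" for x \<mu>
  proof -
    obtain x' where x': "orb K x x'" "\<not> p dvd B x' c" using step1[OF x] by blast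
    have bk: "[B x' c * ki * \<kappa> = B x' c] (mod p)"
      using cong_mult[OF cong_refl[of "B x' c"] ki] by (simp add: mult_ac)
    have "\<not> p dvd B x' c * ki"
      using x'(2) bk by (metis cong_dvd_iff dvd_mult2)
    moreover have "orb K x (y g a (B x' c * ki))"
      if eq: "[g * g + a * (B x' c * ki) * \<kappa> = \<mu>] (mod p)" for g a
    proof (rule orb_trans[OF x'(1)], rule moveE)
      show "supp_on K x'" using x' x orb_supp by blast
      show "[B x' c = B (y g a (B x' c * ki)) c] (mod p)"
        using cong_trans[OF yc bk] cong_sym by blast
      have "[B x' x' = 2 * \<mu>] (mod p)"
        using orb_B[OF x'(1) K(1)] x(2) cong_trans by blast
      moreover have "[B (y g a (B x' c * ki)) (y g a (B x' c * ki)) = 2 * \<mu>] (mod p)"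
        using cong_trans[OF yy cong_mult[OF cong_refl eq]] .
      ultimately show "[B x' x' = B (y g a (B x' c * ki)) (y g a (B x' c * ki))] (mod p)"
        using cong_trans cong_sym by blast
    qed (use x' ysupp in auto)
    ultimately show ?thesis by blast
  qed
  show ?thesis
  proof (rule full_if_transitive[OF K])
    fix x assume x: "supp_on K x" "[B x x = 2] (mod p)"
    have "\<not> p dvd 1" using p_gt_2 zdvd_imp_le[of p 1] by auto
    with step2[OF x(1), of 1] x(2) obtain b
      where "\<And>g a. [g * g + a * b * \<kappa> = 1] (mod p) \<Longrightarrow> orb K x (y g a b)"
      by auto
    from this[of 1 0] have b: "orb K x (y 1 0 b)" by simp
    \<comment> \<open>Half of \<open>b\<close>: this choice removes \<open>b *\<^sub>Z c'\<close>
      from \<open>e + b *\<^sub>Z c'\<close>.\<close>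
    define t where "t = b * hf"
    define z where "z = y 1 0 b"
    have "E c' (t *\<^sub>Z e) z = z + (t * B z c') *\<^sub>Z e - (t * B z e + t * t * hf * B e e * B z c') *\<^sub>Z c'"
      by (rule coord_ext) (simp add: E_def B_lin algebra_simps)
    also have "\<dots> \<approx> z + (t * (0 * \<kappa>)) *\<^sub>Z e - (t * (2 * 1) + t * t * hf * B e e * (0 * \<kappa>)) *\<^sub>Z c'"
      unfolding z_def
      by (intro veq_add veq_diff veq_smul cong_add cong_diff cong_mult cong_refl veq_refl yc' ye)
    also have "\<dots> = e + (b * 1) *\<^sub>Z c' - (b * (2 * hf)) *\<^sub>Z c'"
      by (rule coord_ext) (simp add: z_def y_def t_def algebra_simps)
    also have "\<dots> \<approx> e + (b * 1) *\<^sub>Z c' - (b * 1) *\<^sub>Z c'"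
      by (intro veq_add veq_diff veq_smul cong_mult cong_refl veq_refl hf_cong)
    finally have "E c' (t *\<^sub>Z e) z \<approx> e" by simp
    then show "orb K x e"
      using b orb_inG[OF S't] orb_trans z_def by blast
  next
    fix x assume x: "supp_on K x" "[B x x = 2 * nu] (mod p)"
    obtain b where b: "\<not> p dvd b"
      "\<And>g a. [g * g + a * b * \<kappa> = nu] (mod p) \<Longrightarrow> orb K x (y g a b)"
      using step2[OF x nu_nonzero] by blast
    \<comment> \<open>The coefficient \<open>b\<close> must become 1, but moves along
      \<open>c\<close> preserve it. The conic supplies two vectors of norm \<open>nu\<close> with
      the same coefficient \<open>a\<close> of \<open>c\<close>, one with \<open>b\<close> and one
      with 1; they have equal product with \<open>c'\<close>, so a move along \<open>c'\<close>
      joins them. That product is nonzero because \<open>nu - g' * g'\<close> cannot vanish.\<close>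
    obtain g g' where "[1 * (g * g) + (- b) * (g' * g') = nu * (1 - b)] (mod p)"
      using conic_mod[of 1 "- b" "nu * (1 - b)"] b(1) p_gt_2 zdvd_imp_le[of p 1] by auto
    then have conic: "[g * g - b * (g' * g') = nu - b * nu] (mod p)" by (simp add: algebra_simps)
    define a where "a = (nu - g' * g') * ki"
    have ak: "[a * \<kappa> = nu - g' * g'] (mod p)"
      using cong_mult[OF cong_refl[of "nu - g' * g'"] ki] by (simp add: a_def mult_ac)
    have "\<not> p dvd nu - g' * g'"
      using nu_nonsquare[of g'] by (simp add: cong_iff_dvd_diff dvd_diff_commute)
    then have ak0: "\<not> p dvd a * \<kappa>" using ak cong_dvd_iff by blast
    have "g * g + a * b * \<kappa> = (g * g - b * (g' * g')) + b * (g' * g') + b * (a * \<kappa>)" by simp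
    also have "[\<dots> = (nu - b * nu) + b * (g' * g') + b * (nu - g' * g')] (mod p)"
      using conic ak by (intro cong_add cong_mult cong_refl)
    also have "(nu - b * nu) + b * (g' * g') + b * (nu - g' * g') = nu" by (simp add: algebra_simps)
    finally have n1: "[g * g + a * b * \<kappa> = nu] (mod p)" .
    have n2: "[g' * g' + a * 1 * \<kappa> = nu] (mod p)"
      using cong_add[OF cong_refl[of "g' * g'"] ak] by simp
    have n3: "[0 * 0 + (nu * ki) * 1 * \<kappa> = nu] (mod p)"
      using cong_mult[OF cong_refl[of nu] ki] by (simp add: mult_ac)
    note norm = cong_trans[OF yy cong_mult[OF cong_refl[of 2]]]
    have "orb K x (y g a b)" using b(2)[OF n1] .
    also have "orb K (y g a b) (y g' a 1)"
    proof (rule orb_E)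
      show "eichler_in K c' (t *\<^sub>Z (y g' a 1 - y g a b))" for t
      proof -
        have "t *\<^sub>Z (y g' a 1 - y g a b) = (t * (g' - g)) *\<^sub>Z e + (t * (1 - b)) *\<^sub>Z c'"
          by (rule coord_ext) (simp add: y_def algebra_simps)
        moreover have "[(t * (g' - g)) * B e c' = (t * (g' - g)) * 0] (mod p)"
          "[(t * (1 - b)) * B c' c' = (t * (1 - b)) * 0] (mod p)"
          by (rule cong_mult[OF cong_refl ee(2)], rule cong_mult[OF cong_refl cc(2)])
        ultimately show ?thesis
          using eichler_in_smul[OF S' cc(2) ee(2)] cc ee by (auto intro!: eichler_in_add eichler_in_self simp: B_lin)
      qed
      show "[B (y g a b) c' = B (y g' a 1) c'] (mod p)"
        using cong_trans[OF yc' cong_sym[OF yc']] .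
      show "[B (y g a b) (y g a b) = B (y g' a 1) (y g' a 1)] (mod p)"
        using cong_trans[OF norm[OF n1] cong_sym[OF norm[OF n2]]] .
      show "\<not> p dvd B (y g a b) c'"
        using ak0 cong_dvd_iff[OF yc'] by blast
    qed (rule cc)
    also have "orb K (y g' a 1) (y 0 (nu * ki) 1)"
    proof (rule moveE[OF ysupp ysupp])
      show "[B (y g' a 1) c = B (y 0 (nu * ki) 1) c] (mod p)"
        using cong_trans[OF yc cong_sym[OF yc]] .
      show "[B (y g' a 1) (y g' a 1) = B (y 0 (nu * ki) 1) (y 0 (nu * ki) 1)] (mod p)"
        using cong_trans[OF norm[OF n2] cong_sym[OF norm[OF n3]]] .
      show "\<not> p dvd B (y g' a 1) c"
        using \<kappa> cong_dvd_iff[OF yc[of g' a 1]] by simp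
    qed
    finally show "orb K x (y 0 (nu * ki) 1)" .
  qed
qed

end

section \<open>Parity on the vectors of nonsquare norm\<close>

text \<open>Composing with the transposition of \<open>a\<close> and \<open>f a\<close> removes one
  of the disjoint two-cycles; induction counts them.\<close>

lemma sign_involution:
  assumes "finite {x. f x \<noteq> x}" "\<And>x. f (f x) = x"
  shows "permutation f \<and> sign f = (- 1) ^ (card {x. f x \<noteq> x} div 2)"
  using assms
proof (induction "card {x. f x \<noteq> x}" arbitrary: f rule: less_induct)
  case less
  show ?case
  proof (cases "{x. f x \<noteq> x} = {}")
    case True
    then have "f = id" by auto
    then show ?thesis by (simp add: permutation_id sign_id)
  next
    case False
    then obtain a where a: "f a \<noteq> a" by auto
    define b where "b = f a"
    define g where "g = Transposition.transpose a b \<circ> f"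
    have fb: "f b = a" by (simp add: b_def less)
    have ab: "a \<noteq> b" using a by (simp add: b_def)
    have fab: "f x \<noteq> a" "f x \<noteq> b" if "x \<noteq> a" "x \<noteq> b" for x
      using that less(3)[of x] fb b_def by metis+
    have gx: "g x = (if x = a \<or> x = b then x else f x)" for x
      using fab[of x] fb by (auto simp: g_def b_def[symmetric] transpose_def)
    have mg: "{x. f x \<noteq> x} = insert a (insert b {x. g x \<noteq> x})"
      using a fb ab by (auto simp: gx)
    have fin: "finite {x. g x \<noteq> x}"
      using less(2) mg by simp
    have c: "card {x. f x \<noteq> x} = Suc (Suc (card {x. g x \<noteq> x}))"
      unfolding mg using fin ab by (subst card_insert_disjoint, simp_all add: gx)+
    have "permutation g \<and> sign g = (- 1) ^ (card {x. g x \<noteq> x} div 2)"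
    proof (rule less(1))
      show "g (g x) = x" for x
        using fab[of x] less(3)[of x] by (simp add: gx)
    qed (use c fin in auto)
    moreover have "f = Transposition.transpose a b \<circ> g"
      by (simp add: g_def fun_eq_iff)
    ultimately show ?thesis
      using c ab sign_compose[OF permutation_swap_id[of a b], of g]
      by (simp add: sign_swap_id permutation_compose permutation_swap_id)
  qed
qed

text \<open>\<open>f\<close> and \<open>g\<close> generate a Klein four-group acting freely on
  \<open>M\<close>.\<close>

lemma card_dvd_4:
  assumes "finite M"
    and "\<And>x. x \<in> M \<Longrightarrow> f x \<in> M \<and> g x \<in> M"
    and "\<And>x. x \<in> M \<Longrightarrow> f (f x) = x \<and> g (g x) = x \<and> f (g x) = g (f x)"
    and "\<And>x. x \<in> M \<Longrightarrow> f x \<noteq> x \<and> g x \<noteq> x \<and> f (g x) \<noteq> x"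
  shows "4 dvd card M"
proof -
  define Or where "Or x = {x, f x, g x, f (g x)}" for x
  have card: "card (Or x) = 4" if "x \<in> M" for x
  proof -
    have "f x \<noteq> x" "g x \<noteq> x" "f (g x) \<noteq> x" using assms(4)[OF that] by auto
    moreover have "f x \<noteq> g x" "f (g x) \<noteq> g x" "f (g x) \<noteq> f x"
      using assms(2-4) that by metis+
    ultimately show ?thesis unfolding Or_def by (simp add: card_insert_if)
  qed
  have same: "Or y = Or x" if "x \<in> M" "y \<in> Or x" for x y
  proof -
    have "f (f x) = x" "g (g x) = x" "f (g x) = g (f x)" "f (f (g x)) = g x" "g (g (f x)) = f x"
      using assms(2,3) that(1) by metis+
    then show ?thesis using that(2) unfolding Or_def by (elim insertE emptyE) auto
  qed
  have U: "\<Union> (Or ` M) = M"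
    using assms(2) unfolding Or_def by auto
  have "4 * card (Or ` M) = card (\<Union> (Or ` M))"
  proof (rule card_partition)
    show "c1 \<inter> c2 = {}" if "c1 \<in> Or ` M" "c2 \<in> Or ` M" "c1 \<noteq> c2" for c1 c2
      using that same by blast
  qed (use assms(1) card U in auto)
  then show ?thesis unfolding U by (metis dvd_triv_left)
qed

context refl_nu
begin

section \<open>Reduced representatives and the permutations induced on them\<close>

definition red :: "ivec \<Rightarrow> ivec"
  where "red x = Coord (\<lambda>i. if i < n then coord x i mod p else 0)"

lemma coord_red: "coord (red x) i = (if i < n then coord x i mod p else 0)"
  by (simp add: red_def Coord_inverse)

definition Fv :: "ivec set" where "Fv = range red"

lemma finite_Fv: "finite Fv"
proof -
  have "finite {f. \<forall>i. (i \<in> {..<n} \<longrightarrow> f i \<in> {0..<p}) \<and> (i \<notin> {..<n} \<longrightarrow> f i = 0)}"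
    by (rule finite_set_of_finite_funs) auto
  moreover have "Fv \<subseteq> Coord ` {f. \<forall>i. (i \<in> {..<n} \<longrightarrow> f i \<in> {0..<p}) \<and> (i \<notin> {..<n} \<longrightarrow> f i = 0)}"
    using p_pos by (auto simp: Fv_def red_def intro!: imageI)
  ultimately show ?thesis using finite_subset finite_imageI by blast
qed

definition weq :: "ivec \<Rightarrow> ivec \<Rightarrow> bool"
  where "weq x y \<longleftrightarrow> (\<forall>i<n. [coord x i = coord y i] (mod p))"

lemma red_eq_iff: "red x = red y \<longleftrightarrow> weq x y"
proof
  assume "red x = red y"
  then have "coord (red x) i = coord (red y) i" for i by simp
  then show "weq x y" unfolding weq_def coord_red by (metis cong_def)
next
  assume "weq x y"
  then show "red x = red y"
    by (intro coord_ext) (auto simp: weq_def coord_red cong_def)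
qed

lemma weq_red: "weq (red x) x"
  by (simp add: weq_def coord_red)

lemma red_Fv: "x \<in> Fv \<Longrightarrow> red x = x"
  by (auto simp: Fv_def red_eq_iff weq_red)

lemma veq_weq: "x \<approx> y \<Longrightarrow> weq x y"
  by (simp add: veq_def weq_def)

lemma weq_sym: "weq x y \<Longrightarrow> weq y x"
  by (simp add: weq_def cong_sym)

lemma weq_trans: "weq x y \<Longrightarrow> weq y z \<Longrightarrow> weq x z"
  unfolding weq_def by (blast intro: cong_trans)

lemma B_weq: "weq x x' \<Longrightarrow> weq y y' \<Longrightarrow> [B x y = B x' y'] (mod p)"
  unfolding B_def weq_def by (intro cong_sum cong_mult) auto

lemma R_weq: "weq x y \<Longrightarrow> weq (R t v x) (R t v y)"
  using B_weq[of x y v v] unfolding weq_def R_def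
  by (auto intro!: cong_diff cong_mult simp: weq_def)

definition Snu :: "ivec set"
  where "Snu = {x \<in> Fv. [B x x = 2 * nu] (mod p)}"

text \<open>Extending by the identity gives a permutation of the whole type with finite support, as
  \<open>sign\<close> requires.\<close>

definition perm :: "(ivec \<Rightarrow> ivec) \<Rightarrow> ivec \<Rightarrow> ivec"
  where "perm T x = (if x \<in> Snu then red (T x) else x)"

lemma perm_comp:
  assumes "\<And>x y. weq x y \<Longrightarrow> weq (S x) (S y)" "\<And>x. [B (T x) (T x) = B x x] (mod p)"
  shows "perm (\<lambda>x. S (T x)) = perm S \<circ> perm T"
proof
  fix x
  have "red (T x) \<in> Snu" if "x \<in> Snu"
    using that cong_trans[OF cong_trans[OF B_weq[OF weq_red weq_red] assms(2)]]
    by (auto simp: Snu_def Fv_def)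
  then show "perm (\<lambda>x. S (T x)) x = (perm S \<circ> perm T) x"
    using assms(1)[OF weq_sym[OF weq_red]] by (auto simp: perm_def red_eq_iff)
qed

lemma red_Snu: "[B x x = 2 * nu] (mod p) \<Longrightarrow> red x \<in> Snu"
  using cong_trans[OF B_weq[OF weq_red weq_red]] by (simp add: Snu_def Fv_def)

lemma B_minus: "B (- x) y = - B x y" "B x (- y) = - B x y"
  by (simp_all add: B_def sum_negf)

lemma weq_neg: "weq x y \<Longrightarrow> weq (- x) (- y)"
  by (simp add: weq_def cong_minus_minus_iff)

lemma R_neg: "R t v (- x) = - R t v x"
  by (rule coord_ext) (simp add: R_def B_minus)

lemma weq_smul: "[a = b] (mod p) \<Longrightarrow> weq x y \<Longrightarrow> weq (a *\<^sub>Z x) (b *\<^sub>Z y)"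
  by (simp add: weq_def cong_mult)

lemma norm_nu_nonzero: "[B x x = 2 * nu] (mod p) \<Longrightarrow> \<not> p dvd B x x"
  using nu_nonzero not_p_dvd_2 prime_p cong_dvd_iff prime_dvd_mult_iff by metis

lemma double_weq:
  assumes "weq (t *\<^sub>Z x) (t *\<^sub>Z y)" "\<not> p dvd t"
  shows "weq x y"
  using assms cong_cancel[of _ t] unfolding weq_def by (simp add: mult.commute)

lemma sign_perm_R:
  assumes v: "[t * B v v = 2] (mod p)"
  defines "D \<equiv> {x \<in> Snu. weq (- R t v x) x}"
  assumes D: "finite D" "D = {} \<and> e = 1 \<or> card D = 2 \<and> e = (- 1 :: int)"
  shows "permutation (perm (R t v)) \<and> sign (perm (R t v)) = e"
proof -
  define r where "r = perm (R t v)"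
  have RB: "[B (R t v x) (R t v y) = B x y] (mod p)" for x y using R_isom[OF v] .
  have rr: "r (r x) = x" for x
  proof -
    have "perm (\<lambda>x. R t v (R t v x)) = r \<circ> r"
      unfolding r_def by (rule perm_comp[OF R_weq RB])
    moreover have "perm (\<lambda>x. R t v (R t v x)) x = x"
      using veq_weq[OF R_invol[OF v], of x] red_Fv[of x]
      by (simp add: perm_def Snu_def red_eq_iff[symmetric])
    ultimately show ?thesis by (metis comp_apply)
  qed
  define ng where "ng x = red (- x)" for x
  define M where "M = {x. r x \<noteq> x}"
  have MS: "M \<subseteq> Snu" by (auto simp: M_def r_def perm_def)
  have SF: "Snu \<subseteq> Fv" by (auto simp: Snu_def)
  have finM: "finite M" using finite_subset[OF MS finite_subset[OF SF finite_Fv]] .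
  have rS: "r x \<in> Snu" if "x \<in> Snu" for x
  proof -
    have "[B x x = 2 * nu] (mod p)" using that by (simp add: Snu_def)
    then show ?thesis using that cong_trans[OF RB[of x x]] by (simp add: r_def perm_def red_Snu)
  qed
  have nS: "ng x \<in> Snu" if "x \<in> Snu" for x
  proof -
    have "[B (- x) (- x) = 2 * nu] (mod p)" using that by (simp add: Snu_def B_minus)
    then show ?thesis by (simp add: ng_def red_Snu)
  qed
  have nn: "ng (ng x) = x" if "x \<in> Snu" for x
  proof -
    have "ng (ng x) = red x"
      unfolding ng_def red_eq_iff using weq_neg[OF weq_red[of "- x"]] by (simp only: minus_minus)
    then show ?thesis using that red_Fv[of x] by (simp add: Snu_def)
  qed
  have rn: "r (ng x) = ng (r x)" if "x \<in> Snu" for x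
  proof -
    have "weq (R t v (red (- x))) (R t v (- x))" by (intro R_weq weq_red)
    moreover have "weq (- red (R t v x)) (R t v (- x))"
      unfolding R_neg by (intro weq_neg weq_red)
    ultimately have "weq (R t v (red (- x))) (- red (R t v x))"
      using weq_trans weq_sym by blast
    then show ?thesis
      using that nS[OF that] by (simp add: r_def perm_def ng_def red_eq_iff)
  qed
  have nx: "ng x \<noteq> x" if "x \<in> Snu" for x
  proof
    assume "ng x = x"
    then have "red (- x) = red x" using that SF red_Fv by (auto simp: ng_def)
    then have "weq (- x) x" by (simp add: red_eq_iff)
    then have "weq (2 *\<^sub>Z x) (2 *\<^sub>Z 0)"
      by (auto simp: weq_def cong_iff_dvd_diff dvd_diff_commute[of p] algebra_simps)
    then have "weq x 0" using double_weq not_p_dvd_2 by blast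
    then have "[B x x = B x 0] (mod p)" by (intro B_weq) (auto simp: weq_def)
    then have "p dvd B x x" using B_smul_right[of x 0 0] by (simp add: cong_0_iff)
    then show False using norm_nu_nonzero that by (auto simp: Snu_def)
  qed
  have D_iff: "x \<in> D \<longleftrightarrow> x \<in> Snu \<and> ng (r x) = x" for x
  proof -
    have "ng (r x) = x \<longleftrightarrow> weq (- R t v x) x" if "x \<in> Snu"
    proof -
      have "ng (r x) = x \<longleftrightarrow> red (- red (R t v x)) = red x"
        using that SF red_Fv by (auto simp: ng_def r_def perm_def)
      also have "\<dots> \<longleftrightarrow> weq (- R t v x) x"
        unfolding red_eq_iff using weq_neg[OF weq_red] weq_trans weq_sym by blast
      finally show ?thesis .
    qed
    then show ?thesis by (auto simp: D_def)
  qed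
  have DM: "D \<subseteq> M"
    using D_iff nx by (auto simp: M_def)
  \<comment> \<open>Negation and the reflection act on \<open>M - D\<close> as two commuting
    involutions; what makes this action free is that the vectors negated by the reflection have been
    removed.\<close>
  have "4 dvd card (M - D)"
  proof (rule card_dvd_4[where f = ng and g = r])
    fix x assume "x \<in> M - D"
    then have x: "x \<in> Snu" "r x \<noteq> x" "ng (r x) \<noteq> x" using MS D_iff by (auto simp: M_def)
    then have "r (ng x) \<noteq> ng x" using rn nn rS by metis
    moreover have "ng (r (ng x)) \<noteq> ng x" using x rn nn rS nS by metis
    moreover have "r (r x) \<noteq> r x" using x rr by metis
    moreover have "ng (r (r x)) \<noteq> r x" using x rr nn rS by metis
    ultimately show "ng x \<in> M - D \<and> r x \<in> M - D"
      using D_iff by (auto simp: M_def)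
    show "ng (ng x) = x \<and> r (r x) = x \<and> ng (r x) = r (ng x)"
      using x nn rr rn by auto
    show "ng x \<noteq> x \<and> r x \<noteq> x \<and> ng (r x) \<noteq> x"
      using x nx by auto
  qed (use finM in simp)
  then obtain q where q: "card (M - D) = 4 * q" by (auto elim: dvdE)
  have cM: "card M = 4 * q + card D"
    using q card_Diff_subset[OF D(1) DM] card_mono[OF finM DM] by simp
  have "permutation r \<and> sign r = (- 1) ^ (card M div 2)"
    using sign_involution[of r] finM rr by (simp add: M_def)
  moreover have "(- 1 :: int) ^ (card M div 2) = e"
    using D(2) unfolding cM by (auto simp: power_add power_mult)
  ultimately show ?thesis by (simp add: r_def)
qed

lemma neg_R_fixed:
  assumes "weq (- R t v x) x" "[t * B v v = 2] (mod p)"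
  obtains l where "weq x (l *\<^sub>Z v)"
proof (rule that[of "hf * (t * B x v)"])
  have "weq (2 *\<^sub>Z x) ((t * B x v) *\<^sub>Z v)"
    using assms(1) by (auto simp: weq_def R_def cong_iff_dvd_diff algebra_simps dvd_diff_commute)
  then have "weq (hf *\<^sub>Z 2 *\<^sub>Z x) (hf *\<^sub>Z (t * B x v) *\<^sub>Z v)"
    by (rule weq_smul[OF cong_refl])
  then have 1: "weq ((2 * hf) *\<^sub>Z x) ((hf * (t * B x v)) *\<^sub>Z v)"
    by (simp add: weq_def mult_ac)
  have "weq ((2 * hf) *\<^sub>Z x) (1 *\<^sub>Z x)"
    by (intro weq_smul hf_cong) (simp add: weq_def)
  then show "weq x ((hf * (t * B x v)) *\<^sub>Z v)"
    using 1 weq_sym weq_trans by (metis smul_1)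
qed

text \<open>A vector negated by a generator is a multiple of \<open>bas i\<close> and so has square
  norm. Hence none lies in \<open>Snu\<close>, and every generator is even.\<close>

lemma sign_act:
  assumes "w \<in> lists {..<n}"
  shows "permutation (perm (act w)) \<and> sign (perm (act w)) = 1"
  using assms
proof (induction w)
  case Nil
  have "perm (act []) = id"
    using red_Fv by (auto simp: perm_def Snu_def)
  then show ?case by (simp only: permutation_id sign_id)
next
  case (Cons i w)
  then have i: "i < n" by simp
  have norm: "[1 * B (bas i) (bas i) = 2] (mod p)"
    using B_bas[OF i i] by (simp add: A_diag)
  have D: "{x \<in> Snu. weq (- R 1 (bas i) x) x} = {}"
  proof (rule ccontr)
    assume "{x \<in> Snu. weq (- R 1 (bas i) x) x} \<noteq> {}"
    then obtain x where x: "x \<in> Snu" "weq (- R 1 (bas i) x) x" by auto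
    obtain l where "weq x (l *\<^sub>Z bas i)" using neg_R_fixed[OF x(2) norm] .
    then have "[B x x = B (l *\<^sub>Z bas i) (l *\<^sub>Z bas i)] (mod p)" by (intro B_weq)
    moreover have "B (l *\<^sub>Z bas i) (l *\<^sub>Z bas i) = l * l * 2"
      using B_bas[OF i i] by (simp add: B_lin A_diag)
    moreover have "[B x x = nu * 2] (mod p)"
      using x(1) by (simp add: Snu_def mult.commute)
    ultimately have "[nu * 2 = l * l * 2] (mod p)"
      using cong_trans[OF cong_sym] by simp
    then have "[l * l = nu] (mod p)" using cong_cancel not_p_dvd_2 cong_sym by blast
    then show False using nu_nonsquare by blast
  qed
  have "permutation (perm (R 1 (bas i))) \<and> sign (perm (R 1 (bas i))) = 1"
    by (rule sign_perm_R[OF norm]) (simp_all add: D)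
  moreover have "perm (act (i # w)) = perm (R 1 (bas i)) \<circ> perm (act w)"
    unfolding act.simps using Cons act_B by (intro perm_comp R_weq) auto
  moreover have "permutation (perm (act w))" "sign (perm (act w)) = 1"
    using Cons by simp_all
  ultimately show ?case
    by (simp only: sign_compose permutation_compose mult_1)
qed

text \<open>Among the multiples of \<open>v\<close>, exactly \<open>v\<close> and \<open>- v\<close>
  have norm \<open>nu\<close>, which leaves one two-cycle besides the orbits of size four.\<close>

lemma sign_R_nu:
  assumes v: "[B v v = 2 * nu] (mod p)"
  shows "sign (perm (R s v)) = - 1"
proof -
  define vp where "vp = red v"
  define vm where "vm = red (- v)"
  have norm: "[s * B v v = 2] (mod p)" using s_norm[OF v] .
  have ne: "vp \<noteq> vm"
  proof
    assume "vp = vm"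
    then have "weq v (- v)" by (simp add: vp_def vm_def red_eq_iff)
    then have "[B v v = B v (- v)] (mod p)" by (intro B_weq) (auto simp: weq_def)
    then have "p dvd 2 * B v v"
      by (simp add: cong_iff_dvd_diff B_minus)
    then show False using norm_nu_nonzero[OF v] not_p_dvd_2 prime_p prime_dvd_mult_iff by blast
  qed
  have "{x \<in> Snu. weq (- R s v x) x} = {vp, vm}"
  proof (intro equalityI subsetI)
    fix x assume "x \<in> {x \<in> Snu. weq (- R s v x) x}"
    then have x: "x \<in> Snu" "weq (- R s v x) x" by auto
    obtain l where l: "weq x (l *\<^sub>Z v)" using neg_R_fixed[OF x(2) norm] .
    then have "[B x x = B (l *\<^sub>Z v) (l *\<^sub>Z v)] (mod p)" by (intro B_weq)
    moreover have "B (l *\<^sub>Z v) (l *\<^sub>Z v) = l * l * B v v"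
      by (simp add: B_lin)
    moreover have "[B x x = 2 * nu] (mod p)"
      using x(1) by (simp add: Snu_def)
    ultimately have a: "[2 * nu = l * l * B v v] (mod p)"
      using cong_trans[OF cong_sym] by simp
    have "[l * l * B v v = 1 * B v v] (mod p)"
      using cong_trans[OF v a] by (simp add: cong_sym)
    then have "[l * l = 1 * 1] (mod p)" using cong_cancel norm_nu_nonzero[OF v] by auto
    from sq_cong_cases[OF this] have "[l = 1] (mod p) \<or> [l = - 1] (mod p)" .
    then have "weq (l *\<^sub>Z v) v \<or> weq (l *\<^sub>Z v) (- v)"
    proof
      assume "[l = 1] (mod p)"
      then have "weq (l *\<^sub>Z v) (1 *\<^sub>Z v)" by (intro weq_smul) (auto simp: weq_def)
      then show ?thesis by simp
    next
      assume "[l = - 1] (mod p)"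
      then have "weq (l *\<^sub>Z v) ((- 1) *\<^sub>Z v)" by (intro weq_smul) (auto simp: weq_def)
      moreover have "(- 1) *\<^sub>Z v = - v" by (rule coord_ext) simp
      ultimately show ?thesis by simp
    qed
    then have "weq x v \<or> weq x (- v)" using l weq_trans by blast
    then show "x \<in> {vp, vm}"
      using x(1) red_Fv by (auto simp: vp_def vm_def Snu_def red_eq_iff[symmetric])
  next
    have Rv: "weq (R s v v) (- v)"
    proof -
      have "v - (s * B v v) *\<^sub>Z v \<approx> v - 2 *\<^sub>Z v"
        using norm by (intro veq_diff veq_smul veq_refl)
      moreover have "v - 2 *\<^sub>Z v = - v" by (rule coord_ext) simp
      ultimately show ?thesis unfolding R_def using veq_weq by simp
    qed
    have key: "red u \<in> Snu \<and> weq (- R s v (red u)) (red u)" if u: "u = v \<or> u = - v" for u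
    proof -
      have "B u u = B v v"
        using u by (auto simp: B_minus)
      then have "red u \<in> Snu"
        using v by (simp add: red_Snu)
      moreover have "weq (R s v u) (- u)"
        using u Rv weq_neg[OF Rv] by (auto simp: R_neg)
      then have "weq (R s v (red u)) (- red u)"
        using weq_trans[OF weq_trans[OF R_weq[OF weq_red]] weq_neg[OF weq_sym[OF weq_red]]] by blast
      then have "weq (- R s v (red u)) (red u)"
        using weq_neg by fastforce
      ultimately show ?thesis by blast
    qed
    fix x assume "x \<in> {vp, vm}"
    then show "x \<in> {x \<in> Snu. weq (- R s v x) x}"
      using key by (auto simp: vp_def vm_def)
  qed
  then show ?thesis
    using sign_perm_R[OF norm, of "- 1"] ne by simp
qed

lemma parity:
  assumes "w \<in> lists {..<n}" "[B v v = 2 * nu] (mod p)"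
  shows "\<not> (\<forall>x. act w x \<approx> R s v x)"
proof
  assume "\<forall>x. act w x \<approx> R s v x"
  then have "perm (act w) = perm (R s v)"
    using veq_weq red_eq_iff by (auto simp: perm_def)
  then show False using sign_act[OF assms(1)] sign_R_nu[OF assms(2)] by simp
qed

end

section \<open>Isometries that only move a coordinate subspace\<close>

context refl_nu
begin

definition good :: "nat set \<Rightarrow> (ivec \<Rightarrow> ivec) \<Rightarrow> bool"
  where "good K T \<longleftrightarrow> (\<forall>x y. [B (T x) (T y) = B x y] (mod p)) \<and> (\<forall>x. supp_on K (T x - x))"

lemma good_R:
  assumes "good K T" "supp_on K u" "[t * B u u = 2] (mod p)"
  shows "good K (\<lambda>x. R t u (T x))"
proof -
  have "R t u (T x) - x = (T x - x) - (t * B (T x) u) *\<^sub>Z u" for x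
    by (rule coord_ext) (simp add: R_def)
  then show ?thesis
    using assms R_isom[OF assms(3)] cong_trans unfolding good_def
    by (metis supp_on_diff supp_on_smul)
qed

text \<open>The invariant of the reduction: \<open>T\<close> agrees with \<open>T'\<close> up to an
  element of the subgroup and at most one reflection of norm \<open>nu\<close>.\<close>

definition upto_refl :: "nat set \<Rightarrow> (ivec \<Rightarrow> ivec) \<Rightarrow> (ivec \<Rightarrow> ivec) \<Rightarrow> bool"
  where "upto_refl K T T' \<longleftrightarrow> (\<exists>w\<in>lists K. \<forall>x. T x \<approx> act w (T' x)) \<or>
    (\<exists>w\<in>lists K. \<exists>v. supp_on K v \<and> [B v v = 2 * nu] (mod p) \<and> (\<forall>x. T x \<approx> act w (R s v (T' x))))"

text \<open>Dividing \<open>u\<close> by \<open>r\<close> normalizes its norm to \<open>m\<close>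
  and leaves the reflection unchanged, provided the scalar is adapted; it is used with
  \<open>m = 1\<close> and \<open>m = nu\<close>.\<close>

lemma scaled_norm:
  assumes "[t * B u u = 2] (mod p)" "[B u u = 2 * (m * (r * r))] (mod p)" "[q * m = 1] (mod p)"
  obtains z where "[B (z *\<^sub>Z u) (z *\<^sub>Z u) = 2 * m] (mod p)" "[q * z * z = t] (mod p)"
proof -
  have t2: "[t * (m * (r * r)) = 1] (mod p)"
  proof -
    have "[t * (2 * (m * (r * r))) = t * B u u] (mod p)"
      using assms(2) by (intro cong_mult cong_refl) (rule cong_sym)
    also note assms(1)
    finally have "[t * (m * (r * r)) * 2 = 1 * 2] (mod p)" by (simp add: mult_ac)
    then show ?thesis using cong_cancel not_p_dvd_2 by blast
  qed
  have "\<not> p dvd r"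
  proof
    assume "p dvd r"
    then have "p dvd t * (m * (r * r))" by simp
    then have "p dvd 1" using t2 cong_dvd_iff by blast
    then show False using p_gt_2 zdvd_imp_le[of p 1] by simp
  qed
  then obtain z where z: "[z * r = 1] (mod p)" using inv_mod by blast
  have "B (z *\<^sub>Z u) (z *\<^sub>Z u) = z * z * B u u" by (simp add: B_lin)
  also have "[z * z * B u u = z * z * (2 * (m * (r * r)))] (mod p)"
    using assms by (intro cong_mult cong_refl)
  also have "z * z * (2 * (m * (r * r))) = 2 * m * ((z * r) * (z * r))" by simp
  also have "[2 * m * ((z * r) * (z * r)) = 2 * m * (1 * 1)] (mod p)"
    using z by (intro cong_mult cong_refl)
  finally have 1: "[B (z *\<^sub>Z u) (z *\<^sub>Z u) = 2 * m] (mod p)" by simp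
  have "[q * z * z * 1 = q * z * z * (t * (m * (r * r)))] (mod p)"
    using t2 by (intro cong_mult cong_refl) (rule cong_sym)
  also have "q * z * z * (t * (m * (r * r))) = t * (q * m) * ((z * r) * (z * r))" by simp
  also have "[t * (q * m) * ((z * r) * (z * r)) = t * 1 * (1 * 1)] (mod p)"
    using z assms by (intro cong_mult cong_refl)
  finally show ?thesis using 1 that[of z] by simp
qed

text \<open>After rescaling, \<open>u\<close> has norm 1 or \<open>nu\<close>. In the first case its
  reflection is absorbed, if necessary after conjugation past \<open>R s v\<close>. In the second
  case it becomes the pending reflection, or pairs up with the pending one to an element of the
  subgroup.\<close>

lemma upto_refl_step:
  assumes full: "full K" and cl: "upto_refl K T T'" and u: "supp_on K u" "[t * B u u = 2] (mod p)"
  shows "upto_refl K T (\<lambda>x. R t u (T' x))"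
proof -
  define m where "m = hf * B u u"
  have Bm: "[B u u = 2 * m] (mod p)"
    using cong_sym[OF cong_mult[OF hf_cong cong_refl[of "B u u"]]] by (simp add: m_def mult_ac)
  have "\<not> p dvd m"
  proof
    assume "p dvd m"
    then have "p dvd B u u" using Bm cong_dvd_iff by (metis dvd_mult)
    then have "p dvd 2" using u(2) cong_dvd_iff by (metis dvd_mult)
    then show False using not_p_dvd_2 by blast
  qed
  have F1: "\<And>x. supp_on K x \<Longrightarrow> [B x x = 2] (mod p) \<Longrightarrow> inG K (R 1 x)"
    and F2: "\<And>x y. supp_on K x \<Longrightarrow> supp_on K y \<Longrightarrow> [B x x = 2 * nu] (mod p) \<Longrightarrow> [B y y = 2 * nu] (mod p)
       \<Longrightarrow> inG K (\<lambda>z. R s x (R s y z))"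
    using full unfolding full_def by blast+
  have Rback: "R q u' (R t u x) \<approx> x"
    if "R q u' (R t u x) \<approx> R t u (R t u x)" for q u' x
    using veq_trans[OF that R_invol[OF u(2)]] .
  consider (1) r where "[m = 1 * (r * r)] (mod p)" | (2) r where "[m = nu * (r * r)] (mod p)"
    using square_or_nu_square[OF \<open>\<not> p dvd m\<close>] by (metis mult_1)
  then show ?thesis
  proof cases
    case 1
    then have "[B u u = 2 * (1 * (r * r))] (mod p)"
      using cong_trans[OF Bm cong_mult[OF cong_refl]] by blast
    then obtain z where z: "[B (z *\<^sub>Z u) (z *\<^sub>Z u) = 2 * 1] (mod p)" "[1 * z * z = t] (mod p)"
      using scaled_norm[OF u(2), of 1 r 1] by auto
    define u' where "u' = z *\<^sub>Z u"
    have us: "supp_on K u'" "[B u' u' = 2] (mod p)"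
      using z u by (simp_all add: u'_def supp_on_smul)
    have Ru: "R 1 u' x \<approx> R t u x" for x
      unfolding u'_def R_scale using z(2) by (intro R_veq veq_refl)
    note bk = Rback[OF Ru]
    show ?thesis
      using cl unfolding upto_refl_def
    proof (elim disjE bexE exE conjE)
      fix w assume w: "w \<in> lists K" "\<forall>x. T x \<approx> act w (T' x)"
      obtain w1 where w1: "w1 \<in> lists K" "\<And>x. act w1 x \<approx> R 1 u' x"
        using F1[OF us] by (auto simp: inG_def)
      have "T x \<approx> act (w @ w1) (R t u (T' x))" for x
      proof -
        have "T x \<approx> act w (T' x)" using w by blast
        also have "\<dots> \<approx> act w (act w1 (R t u (T' x)))"
          by (rule act_veq, rule veq_sym, rule veq_trans[OF w1(2) bk])
        finally show ?thesis by (simp add: act_append)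
      qed
      then have "\<exists>w\<in>lists K. \<forall>x. T x \<approx> act w (R t u (T' x))"
        using w w1 by (intro bexI[of _ "w @ w1"]) auto
      then show "(\<exists>w\<in>lists K. \<forall>x. T x \<approx> act w (R t u (T' x))) \<or>
        (\<exists>w\<in>lists K. \<exists>v. supp_on K v \<and> [B v v = 2 * nu] (mod p) \<and> (\<forall>x. T x \<approx> act w (R s v (R t u (T' x)))))" ..
    next
      fix w v assume w: "w \<in> lists K" "\<forall>x. T x \<approx> act w (R s v (T' x))"
        and v: "supp_on K v" "[B v v = 2 * nu] (mod p)"
      have "[B (R s v u') (R s v u') = 2] (mod p)"
        using cong_trans[OF R_isom[OF s_norm[OF v(2)]] us(2)] .
      then have "inG K (R 1 (R s v u'))"
        by (rule F1[OF R_supp[OF v(1) us(1)]])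
      then obtain w1 where w1: "w1 \<in> lists K" "\<And>x. act w1 x \<approx> R 1 (R s v u') x"
        by (auto simp: inG_def)
      have "T x \<approx> act (w @ w1) (R s v (R t u (T' x)))" for x
      proof -
        define y where "y = R t u (T' x)"
        have "R s v (R 1 u' y) \<approx> R s v (R 1 u' (R s v (R s v y)))"
          by (intro R_veq veq_refl cong_refl) (rule veq_sym, rule R_invol, rule s_norm, rule v)
        also have "\<dots> \<approx> R 1 (R s v u') (R s v y)"
          by (rule R_conj[OF s_norm[OF v(2)]])
        finally have *: "R s v (R 1 u' y) \<approx> act w1 (R s v y)"
          using w1(2) veq_sym veq_trans by blast
        have "T x \<approx> act w (R s v (T' x))" using w by blast
        also have "\<dots> \<approx> act w (R s v (R 1 u' y))"
          unfolding y_def by (rule act_veq, rule R_veq[OF veq_sym[OF bk]]) auto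
        also have "\<dots> \<approx> act w (act w1 (R s v y))" by (rule act_veq[OF *])
        finally show ?thesis by (simp add: act_append y_def)
      qed
      then have "\<exists>w\<in>lists K. \<exists>v. supp_on K v \<and> [B v v = 2 * nu] (mod p) \<and> (\<forall>x. T x \<approx> act w (R s v (R t u (T' x))))"
        using w(1) w1(1) v by (intro bexI[of _ "w @ w1"] exI[of _ v]) auto
      then show "(\<exists>w\<in>lists K. \<forall>x. T x \<approx> act w (R t u (T' x))) \<or>
        (\<exists>w\<in>lists K. \<exists>v. supp_on K v \<and> [B v v = 2 * nu] (mod p) \<and> (\<forall>x. T x \<approx> act w (R s v (R t u (T' x)))))" ..
    qed
  next
    case 2
    then have "[B u u = 2 * (nu * (r * r))] (mod p)"
      using cong_trans[OF Bm cong_mult[OF cong_refl]] by blast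
    then obtain z where z: "[B (z *\<^sub>Z u) (z *\<^sub>Z u) = 2 * nu] (mod p)" "[s * z * z = t] (mod p)"
      using scaled_norm[OF u(2), of nu r s] s_nu by auto
    define u' where "u' = z *\<^sub>Z u"
    have us: "supp_on K u'" "[B u' u' = 2 * nu] (mod p)"
      using z u by (simp_all add: u'_def supp_on_smul)
    have Ru: "R s u' x \<approx> R t u x" for x
      unfolding u'_def R_scale using z(2) by (intro R_veq veq_refl)
    note bk = Rback[OF Ru]
    show ?thesis
      using cl unfolding upto_refl_def
    proof (elim disjE bexE exE conjE)
      fix w assume w: "w \<in> lists K" "\<forall>x. T x \<approx> act w (T' x)"
      have "T x \<approx> act w (R s u' (R t u (T' x)))" for x
        using w(2) act_veq[OF veq_sym[OF bk]] veq_trans by blast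
      then have "\<exists>w\<in>lists K. \<exists>v. supp_on K v \<and> [B v v = 2 * nu] (mod p) \<and> (\<forall>x. T x \<approx> act w (R s v (R t u (T' x))))"
        using w(1) us by (intro bexI[of _ w] exI[of _ u']) auto
      then show "(\<exists>w\<in>lists K. \<forall>x. T x \<approx> act w (R t u (T' x))) \<or>
        (\<exists>w\<in>lists K. \<exists>v. supp_on K v \<and> [B v v = 2 * nu] (mod p) \<and> (\<forall>x. T x \<approx> act w (R s v (R t u (T' x)))))" ..
    next
      fix w v assume w: "w \<in> lists K" "\<forall>x. T x \<approx> act w (R s v (T' x))"
        and v: "supp_on K v" "[B v v = 2 * nu] (mod p)"
      obtain w1 where w1: "w1 \<in> lists K" "\<And>x. act w1 x \<approx> R s v (R s u' x)"
        using F2[OF v(1) us(1) v(2) us(2)] by (auto simp: inG_def)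
      have "T x \<approx> act (w @ w1) (R t u (T' x))" for x
      proof -
        have "T x \<approx> act w (R s v (T' x))" using w by blast
        also have "\<dots> \<approx> act w (R s v (R s u' (R t u (T' x))))"
          by (rule act_veq, rule R_veq[OF veq_sym[OF bk]]) auto
        also have "\<dots> \<approx> act w (act w1 (R t u (T' x)))"
          by (rule act_veq[OF veq_sym[OF w1(2)]])
        finally show ?thesis by (simp add: act_append)
      qed
      then have "\<exists>w\<in>lists K. \<forall>x. T x \<approx> act w (R t u (T' x))"
        using w(1) w1(1) by (intro bexI[of _ "w @ w1"]) auto
      then show "(\<exists>w\<in>lists K. \<forall>x. T x \<approx> act w (R t u (T' x))) \<or>
        (\<exists>w\<in>lists K. \<exists>v. supp_on K v \<and> [B v v = 2 * nu] (mod p) \<and> (\<forall>x. T x \<approx> act w (R s v (R t u (T' x)))))" ..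
    qed
  qed
qed

text \<open>The members are reduced vectors, so that there are finitely many such sets and a maximal
  one exists.\<close>

definition orth :: "nat set \<Rightarrow> ivec set \<Rightarrow> bool"
  where "orth K F \<longleftrightarrow> F \<subseteq> Fv \<and> (\<forall>a\<in>F. supp_on K a \<and> \<not> p dvd B a a) \<and>
    (\<forall>a\<in>F. \<forall>b\<in>F. a \<noteq> b \<longrightarrow> p dvd B a b)"

lemma R_fix: "p dvd B x u \<Longrightarrow> R t u x \<approx> x"
  by (simp add: veq_def R_def cong_iff_dvd_diff)

lemma R_swap:
  assumes "[B x x = B a a] (mod p)" "[t * B (x - a) (x - a) = 2] (mod p)"
  shows "R t (x - a) x \<approx> a"
proof -
  have "[t * B x (x - a) * 2 = 1 * 2] (mod p)"
  proof -
    have "t * B x (x - a) * 2 = t * (B x x + B x x - 2 * B x a)" by (simp add: B_lin algebra_simps)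
    also have "[t * (B x x + B x x - 2 * B x a) = t * (B x x + B a a - 2 * B x a)] (mod p)"
      using assms(1) by (intro cong_mult cong_diff cong_add cong_refl)
    also have "t * (B x x + B a a - 2 * B x a) = t * B (x - a) (x - a)"
      by (simp add: B_lin B_sym[of a x] algebra_simps)
    also note assms(2)
    finally show ?thesis by simp
  qed
  then have "[t * B x (x - a) = 1] (mod p)" using cong_cancel not_p_dvd_2 by blast
  then have "x - (t * B x (x - a)) *\<^sub>Z (x - a) \<approx> x - 1 *\<^sub>Z (x - a)"
    by (intro veq_diff veq_smul veq_refl)
  then show ?thesis by (simp add: R_def)
qed

lemma two_inv:
  assumes "\<not> p dvd a"
  obtains t where "[t * a = 2] (mod p)"
proof -
  obtain t where "[t * a = 1] (mod p)" using inv_mod[OF assms] .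
  from cong_mult[OF cong_refl[of 2] this] that[of "2 * t"] show ?thesis by (simp add: mult.assoc)
qed

text \<open>The Cartan-Dieudonne step: the image \<open>x\<close> of a new vector \<open>a\<close>
  is carried back to \<open>a\<close> by reflections in \<open>x - a\<close>, or in
  \<open>x + a\<close> and \<open>a\<close>. These vectors are orthogonal to \<open>F\<close>, so
  what was fixed before stays fixed.\<close>

lemma fix_orth:
  assumes full: "full K" and g: "good K T"
    and "finite F" "orth K F"
  shows "\<exists>T'. good K T' \<and> upto_refl K T T' \<and> (\<forall>a\<in>F. T' a \<approx> a)"
  using assms(3,4)
proof (induction F rule: finite_induct)
  case empty
  have "upto_refl K T T" unfolding upto_refl_def by (intro disjI1 bexI[of _ "[]"]) auto
  then show ?case using g by blast
next
  case (insert a F)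
  have "orth K F" using insert.prems unfolding orth_def by blast
  then obtain T' where T': "good K T'" "upto_refl K T T'" "\<And>b. b \<in> F \<Longrightarrow> T' b \<approx> b"
    using insert.IH by blast
  have a: "supp_on K a" "\<not> p dvd B a a" "\<And>b. b \<in> F \<Longrightarrow> p dvd B a b"
    using insert unfolding orth_def by auto
  define x where "x = T' a"
  have xs: "supp_on K x"
    using supp_on_add[of K "T' a - a" a] T'(1) a(1) unfolding good_def x_def by simp
  have xx: "[B x x = B a a] (mod p)" using T'(1) unfolding good_def x_def by blast
  have xb: "p dvd B x b" if "b \<in> F" for b
  proof -
    have "[B x b = B x (T' b)] (mod p)"
      by (rule B_cong[OF veq_refl veq_sym[OF T'(3)[OF that]]])
    also have "[B x (T' b) = B a b] (mod p)" using T'(1) unfolding good_def x_def by blast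
    finally show ?thesis using a(3)[OF that] cong_dvd_iff by blast
  qed
  have fixF: "R t u (T' b) \<approx> b" if "b \<in> F" "p dvd B u b" for t u b
  proof -
    have "R t u (T' b) \<approx> R t u b" by (rule R_veq[OF T'(3)[OF that(1)]]) auto
    also have "\<dots> \<approx> b" using that(2) by (intro R_fix) (simp add: B_sym)
    finally show ?thesis .
  qed
  show ?case
  proof (cases "p dvd B (x - a) (x - a)")
    case False
    then obtain t where t: "[t * B (x - a) (x - a) = 2] (mod p)" using two_inv by blast
    have u: "supp_on K (x - a)" using xs a by (intro supp_on_lin)
    have "R t (x - a) (T' b) \<approx> b" if "b \<in> insert a F" for b
    proof (cases "b = a")
      case True
      then show ?thesis using R_swap[OF xx t] by (simp add: x_def)
    next
      case False
      then show ?thesis using that a(3) xb by (intro fixF) (auto simp: B_lin)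
    qed
    then show ?thesis
      using good_R[OF T'(1) u t] upto_refl_step[OF full T'(2) u t] by blast
  next
    \<comment> \<open>By the parallelogram identity \<open>x + a\<close> and \<open>x - a\<close>
      cannot both be isotropic. The reflection in \<open>x + a\<close> sends \<open>x\<close> to
      \<open>- a\<close>, and the one in \<open>a\<close> repairs the sign.\<close>
    case True
    have "B (x + a) (x + a) + B (x - a) (x - a) = 2 * (B x x + B a a)"
      by (simp add: B_lin algebra_simps)
    moreover have "[2 * (B x x + B a a) = 2 * (B a a + B a a)] (mod p)"
      using xx by (intro cong_mult cong_add cong_refl)
    ultimately have "[B (x + a) (x + a) + B (x - a) (x - a) = 2 * 2 * B a a] (mod p)" by simp
    moreover have "\<not> p dvd 2 * 2 * B a a"
      using a(2) not_p_dvd_2 prime_p by (simp only: prime_dvd_mult_iff) blast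
    ultimately have "\<not> p dvd B (x + a) (x + a) + B (x - a) (x - a)"
      using cong_dvd_iff by blast
    then have "\<not> p dvd B (x + a) (x + a)"
      using True dvd_add by blast
    moreover have "x + a = x - (- 1) *\<^sub>Z a"
      by (rule coord_ext) simp
    ultimately have "\<not> p dvd B (x - (- 1) *\<^sub>Z a) (x - (- 1) *\<^sub>Z a)"
      by metis
    then obtain t where t: "[t * B (x - (- 1) *\<^sub>Z a) (x - (- 1) *\<^sub>Z a) = 2] (mod p)"
      using two_inv by blast
    obtain t' where t': "[t' * B a a = 2] (mod p)" using two_inv[OF a(2)] by blast
    define u where "u = x - (- 1) *\<^sub>Z a"
    have u: "supp_on K u" unfolding u_def using xs a by (intro supp_on_lin)
    have tu: "[t * B u u = 2] (mod p)" using t by (simp add: u_def)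
    have xx': "[B x x = B ((- 1) *\<^sub>Z a) ((- 1) *\<^sub>Z a)] (mod p)"
      using xx by (simp add: B_lin)
    have "R t' a (R t u (T' b)) \<approx> b" if "b \<in> insert a F" for b
    proof (cases "b = a")
      case True
      have "R t' a (R t u x) \<approx> R t' a ((- 1) *\<^sub>Z a)"
        unfolding u_def by (rule R_veq[OF R_swap[OF xx' t]]) auto
      also have "R t' a ((- 1) *\<^sub>Z a) = (t' * B a a) *\<^sub>Z a - a"
        by (rule coord_ext) (simp add: R_def B_lin algebra_simps)
      also have "\<dots> \<approx> 2 *\<^sub>Z a - a"
        using t' by (intro veq_diff veq_smul veq_refl)
      also have "2 *\<^sub>Z a - a = a" by (rule coord_ext) simp
      finally show ?thesis using True by (simp add: x_def)
    next
      case False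
      then have b: "b \<in> F" using that by simp
      have "R t' a (R t u (T' b)) \<approx> R t' a b"
        by (rule R_veq[OF fixF[OF b]]) (use a(3)[OF b] xb[OF b] in \<open>auto simp: u_def B_lin\<close>)
      also have "\<dots> \<approx> b" using a(3)[OF b] by (intro R_fix) (simp add: B_sym)
      finally show ?thesis .
    qed
    then show ?thesis
      using good_R[OF good_R[OF T'(1) u tu] a(1) t'] upto_refl_step[OF full upto_refl_step[OF full T'(2) u tu] a(1) t']
      by blast
  qed
qed

text \<open>Gram-Schmidt: subtracting the components along \<open>F\<close> does not affect products
  with vectors orthogonal to \<open>F\<close>.\<close>

lemma orth_project:
  assumes "finite F" "orth K F" "supp_on K x"
  shows "\<exists>x'. supp_on K x' \<and> (\<forall>a\<in>F. p dvd B x' a) \<and> (\<forall>z. (\<forall>a\<in>F. p dvd B z a) \<longrightarrow> [B z x' = B z x] (mod p))"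
  using assms(1,2)
proof (induction F rule: finite_induct)
  case empty
  then show ?case using assms(3) by auto
next
  case (insert a F)
  have "orth K F" using insert.prems unfolding orth_def by blast
  then obtain x' where x': "supp_on K x'" "\<And>b. b \<in> F \<Longrightarrow> p dvd B x' b"
    "\<And>z. (\<forall>a\<in>F. p dvd B z a) \<Longrightarrow> [B z x' = B z x] (mod p)"
    using insert.IH by blast
  have a: "supp_on K a" "\<not> p dvd B a a" "\<And>b. b \<in> F \<Longrightarrow> p dvd B a b"
    using insert unfolding orth_def by auto
  obtain t where t: "[t * B a a = 1] (mod p)" using inv_mod[OF a(2)] by blast
  define y where "y = x' - (t * B x' a) *\<^sub>Z a"
  have "supp_on K y" unfolding y_def using x' a by (intro supp_on_lin)
  moreover have "p dvd B y b" if "b \<in> insert a F" for b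
  proof (cases "b = a")
    case True
    have "[B x' a - B x' a * (t * B a a) = B x' a - B x' a * 1] (mod p)"
      using t by (intro cong_mult cong_diff cong_refl)
    then show ?thesis using True by (simp add: y_def B_lin cong_0_iff mult_ac)
  next
    case False
    then show ?thesis using that x'(2) a(3) by (auto simp: y_def B_lin)
  qed
  moreover have "[B z y = B z x] (mod p)" if "\<forall>b\<in>insert a F. p dvd B z b" for z
  proof -
    have "[B z x' - (t * B x' a) * B z a = B z x - (t * B x' a) * 0] (mod p)"
      using that x'(3)[of z] by (intro cong_diff cong_mult cong_refl) (auto simp: cong_0_iff)
    then show ?thesis by (simp add: y_def B_lin)
  qed
  ultimately show ?case by blast
qed

theorem full_imp_inG:
  assumes full: "full K" and K: "K \<subseteq> {..<n}"
    and w: "w \<in> lists {..<n}" "\<And>x. supp_on K (act w x - x)"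
    and nondeg: "\<And>z. supp_on K z \<Longrightarrow> (\<And>k. k \<in> K \<Longrightarrow> p dvd B z (bas k)) \<Longrightarrow> p dvd B z b \<Longrightarrow> z \<approx> 0"
  shows "inG K (act w)"
proof -
  have "finite {F. orth K F}"
    using finite_subset[of "{F. orth K F}" "Pow Fv"] finite_Fv by (auto simp: orth_def)
  moreover have "{} \<in> {F. orth K F}" by (simp add: orth_def)
  ultimately obtain F where F: "orth K F" and Fmax: "\<And>F'. orth K F' \<Longrightarrow> F \<subseteq> F' \<Longrightarrow> F' = F"
    using finite_has_maximal[of "{F. orth K F}"] by (metis empty_iff mem_Collect_eq)
  have "F \<subseteq> Fv" using F by (simp add: orth_def)
  then have finF: "finite F" using finite_Fv by (rule finite_subset)
  \<comment> \<open>By maximality the complement of \<open>F\<close> contains only isotropic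
    vectors. Polarization in \<open>rad\<close> then shows that it is the radical of the span of
    \<open>K\<close>, so a map fixing \<open>F\<close> moves every vector by an element of the
    radical.\<close>
  have iso: "p dvd B z z" if z: "supp_on K z" "\<And>a. a \<in> F \<Longrightarrow> p dvd B z a" for z
  proof (rule ccontr)
    assume nz: "\<not> p dvd B z z"
    have za: "p dvd B (red z) a" if "a \<in> F" for a
    proof -
      have "[B (red z) a = B z a] (mod p)" by (intro B_weq weq_red) (simp add: weq_def)
      then show ?thesis using z(2)[OF that] cong_dvd_iff by blast
    qed
    have zz: "\<not> p dvd B (red z) (red z)"
      using nz cong_dvd_iff[OF B_weq[OF weq_red weq_red], of z z] by simp
    have "supp_on K (red z)"
      using z(1) by (simp add: supp_on_def coord_red dvd_mod)
    moreover have "red z \<in> Fv" by (simp add: Fv_def)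
    ultimately have "orth K (insert (red z) F)"
    proof -
      have "p dvd B a (red z)" if "a \<in> F" for a
        using za[OF that] by (simp add: B_sym[of a])
      then show ?thesis
        using F za zz \<open>supp_on K (red z)\<close> \<open>red z \<in> Fv\<close> unfolding orth_def by blast
    qed
    then have "insert (red z) F = F" using Fmax by blast
    then have "red z \<in> F" by blast
    then show False using za zz by blast
  qed
  have rad: "p dvd B z x" if z: "supp_on K z" "\<And>a. a \<in> F \<Longrightarrow> p dvd B z a" and x: "supp_on K x" for z x
  proof -
    obtain x' where x': "supp_on K x'" "\<And>a. a \<in> F \<Longrightarrow> p dvd B x' a" "[B z x' = B z x] (mod p)"
      using orth_project[OF finF F x] z(2) by blast
    have "p dvd B (z + x') (z + x')"
      using z x' by (intro iso supp_on_lin) (auto simp: B_lin)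
    moreover have "B (z + x') (z + x') = B z z + B x' x' + 2 * B z x'"
      by (simp add: B_lin B_sym[of x' z])
    moreover have "p dvd B z z" "p dvd B x' x'" using iso z x' by blast+
    ultimately have "p dvd 2 * B z x'" by (simp add: dvd_add_right_iff)
    then have "p dvd B z x'" using not_p_dvd_2 prime_p prime_dvd_mult_iff by blast
    then show ?thesis using x'(3) cong_dvd_iff by blast
  qed
  have "good K (act w)" using w act_B by (simp add: good_def)
  then obtain T where T: "good K T" "upto_refl K (act w) T" "\<And>a. a \<in> F \<Longrightarrow> T a \<approx> a"
    using fix_orth[OF full _ finF F] by blast
  have TB: "[B (T x) (T y) = B x y] (mod p)" and Ts: "supp_on K (T x - x)" for x y
    using T(1) by (auto simp: good_def)
  have TF: "p dvd B (T x - x) a" if "a \<in> F" for x a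
  proof -
    have "[B (T x) a = B (T x) (T a)] (mod p)"
      by (rule B_cong[OF veq_refl veq_sym[OF T(3)[OF that]]])
    also note TB
    finally show ?thesis by (simp add: B_lin cong_iff_dvd_diff)
  qed
  have Trad: "p dvd B (T x - x) y" if "supp_on K y" for x y
    using rad[OF Ts TF that] .
  have Tzero: "T x - x \<approx> 0" if "p dvd B (T x - x) b" for x
    by (rule nondeg[OF Ts _ that]) (rule Trad, erule supp_on_bas)
  \<comment> \<open>The displacement \<open>z\<close> of \<open>b\<close> lies in the radical and is
    isotropic, so preservation of the norm of \<open>b\<close> reduces to
    \<open>2 * B z b = 0\<close>, and \<open>nondeg\<close> gives \<open>z = 0\<close>. With
    \<open>b\<close> fixed, every other displacement is orthogonal to \<open>b\<close> too and
    vanishes likewise.\<close>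
  have Tb: "T b \<approx> b"
  proof -
    define z where "z = T b - b"
    have "B (T b) (T b) = B b b + 2 * B z b + B z z"
      by (simp add: z_def B_lin B_sym[of b "T b"])
    moreover have "p dvd B z z" unfolding z_def by (rule Trad[OF Ts])
    moreover have "p dvd B (T b) (T b) - B b b" using TB by (simp add: cong_iff_dvd_diff)
    ultimately have "p dvd 2 * B z b" by (simp add: dvd_add_left_iff)
    then have "p dvd B z b" using not_p_dvd_2 prime_p prime_dvd_mult_iff by blast
    then have "z \<approx> 0" unfolding z_def by (rule Tzero)
    then have "z + b \<approx> 0 + b" by (intro veq_add veq_refl)
    then show ?thesis by (simp add: z_def)
  qed
  have Tid: "T x \<approx> x" for x
  proof -
    define z where "z = T x - x"
    have "[B (T x) b = B (T x) (T b)] (mod p)"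
      by (rule B_cong[OF veq_refl veq_sym[OF Tb]])
    also note TB
    finally have "p dvd B z b" by (simp add: z_def B_lin cong_iff_dvd_diff)
    then have "z \<approx> 0" unfolding z_def by (rule Tzero)
    then have "z + x \<approx> 0 + x" by (intro veq_add veq_refl)
    then show ?thesis by (simp add: z_def)
  qed
  show ?thesis
    using T(2) unfolding upto_refl_def
  proof (elim disjE bexE exE conjE)
    fix u assume u: "u \<in> lists K" "\<forall>x. act w x \<approx> act u (T x)"
    have "act u x \<approx> act w x" for x
      using u(2) act_veq[OF Tid] veq_sym veq_trans by blast
    then show ?thesis using u(1) by (auto simp: inG_def)
  next
    fix u v assume u: "u \<in> lists K" "\<forall>x. act w x \<approx> act u (R s v (T x))"
      and v: "supp_on K v" "[B v v = 2 * nu] (mod p)"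
    have un: "u \<in> lists {..<n}" using u K lists_mono by blast
    have "act (rev u @ w) x \<approx> R s v x" for x
    proof -
      have "act (rev u) (act w x) \<approx> act (rev u) (act u (R s v (T x)))"
        using u by (intro act_veq) blast
      also have "\<dots> = R s v (T x)" by (rule act_rev1[OF un])
      also have "\<dots> \<approx> R s v x" by (intro R_veq Tid veq_refl cong_refl)
      finally show ?thesis by (simp add: act_append)
    qed
    moreover have "rev u @ w \<in> lists {..<n}" using un w(1) by (auto simp: in_lists_conv_set)
    ultimately show ?thesis using parity[OF _ v(2)] by blast
  qed
qed

end

section \<open>Parabolic subgroups containing an infinite bond\<close>

context refl_rep
begin

section \<open>Closure properties of the Eichler transformations in a subgroup\<close>

lemma eichler_in_cancel:
  assumes "eichler_in K c (t *\<^sub>Z u)" "\<not> p dvd t" "[B c c = 0] (mod p)" "[B u c = 0] (mod p)"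
  shows "eichler_in K c u"
proof -
  obtain r where r: "[r * t = 1] (mod p)" using inv_mod[OF assms(2)] .
  have "[B (t *\<^sub>Z u) c = t * 0] (mod p)"
    unfolding B_lin using assms(4) by (intro cong_mult cong_refl)
  then have "eichler_in K c (r *\<^sub>Z t *\<^sub>Z u)"
    using eichler_in_smul[OF assms(1,3)] by simp
  moreover have "r *\<^sub>Z t *\<^sub>Z u = (r * t) *\<^sub>Z u" by (rule coord_ext) simp
  moreover have "(r * t) *\<^sub>Z u \<approx> 1 *\<^sub>Z u" using r by (intro veq_smul veq_refl)
  ultimately show ?thesis using eichler_in_veq[OF _ veq_refl] by (metis smul_1)
qed

lemma eichler_in_diff:
  assumes "eichler_in K c u" "eichler_in K c w" "[B c c = 0] (mod p)" "[B u c = 0] (mod p)" "[B w c = 0] (mod p)"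
  shows "eichler_in K c (u - w)"
proof -
  have "[B ((- 1) *\<^sub>Z w) c = (- 1) * 0] (mod p)"
    unfolding B_lin using assms(5) by (intro cong_mult cong_refl)
  then have "eichler_in K c (u + (- 1) *\<^sub>Z w)"
    using assms by (intro eichler_in_add eichler_in_smul) simp_all
  moreover have "u + (- 1) *\<^sub>Z w = u - w" by (rule coord_ext) simp
  ultimately show ?thesis by simp
qed

lemma R_minus: "R s (- u) x = R s u x"
  by (rule coord_ext) (simp add: R_def B_def sum_negf)

lemma eichler_in_of_roots:
  assumes "inG K (R 1 a)" "inG K (R 1 (a + t *\<^sub>Z c))"
    and "[B c c = 0] (mod p)" "[B a c = 0] (mod p)" "[B a a = 2] (mod p)" "\<not> p dvd t"
  shows "eichler_in K c a"
proof -
  have "eichler_in K c (t *\<^sub>Z a)"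
    unfolding eichler_in_def by (rule inG_cong[OF inG_comp[OF assms(1,2)]]) (intro R_R_E assms)
  then show ?thesis using eichler_in_cancel assms by blast
qed

text \<open>The generator at \<open>k\<close> fixes \<open>c\<close> and shifts \<open>z\<close> by
  a nonzero multiple of \<open>bas k\<close>; additivity isolates this multiple. Iterated, it
  propagates membership from node to node along the path.\<close>

lemma eichler_in_next:
  assumes K: "K \<subseteq> {..<n}" "k \<in> K" and S: "eichler_in K c z"
    and c: "[B c c = 0] (mod p)" "[B z c = 0] (mod p)" "B (bas k) c = 0" "\<not> p dvd B z (bas k)"
  shows "eichler_in K c (bas k)"
proof -
  have "eichler_in K (act [k] c) (act [k] z)"
    by (rule eichler_in_act[OF K(1) _ S]) (use K in simp)
  moreover have "act [k] c = c" "act [k] z = z - B z (bas k) *\<^sub>Z bas k"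
    using c(3) by (simp_all add: R_def B_sym[of c])
  ultimately have "eichler_in K c (z - B z (bas k) *\<^sub>Z bas k)" by simp
  then have "eichler_in K c (z - (z - B z (bas k) *\<^sub>Z bas k))"
    by (rule eichler_in_diff[OF S]) (use c in \<open>simp_all add: B_lin\<close>)
  moreover have "z - (z - B z (bas k) *\<^sub>Z bas k) = B z (bas k) *\<^sub>Z bas k" by simp
  ultimately show ?thesis using eichler_in_cancel[of K c "B z (bas k)" "bas k"] c by simp
qed

text \<open>The nodes in \<open>J\<close> are peeled off one by one; \<open>L\<close> collects those
  on which orthogonality to \<open>c\<close> is a real constraint.\<close>

lemma eichler_in_span:
  assumes "finite J" "[B c c = 0] (mod p)"
    and "\<And>k. k \<in> J \<Longrightarrow> eichler_in K c (bas k) \<and> B (bas k) c = 0"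
    and "\<And>x. supp_on L x \<Longrightarrow> [B x c = 0] (mod p) \<Longrightarrow> eichler_in K c x"
    and "supp_on (J \<union> L) x" "[B x c = 0] (mod p)"
  shows "eichler_in K c x"
  using assms(1,3,5,6)
proof (induction J arbitrary: x rule: finite_induct)
  case empty
  then show ?case using assms(4) by simp
next
  case (insert k J)
  define y where "y = x - coord x k *\<^sub>Z bas k"
  have y: "[B y c = 0] (mod p)"
    using insert.prems(1)[of k] insert.prems(3) by (simp add: y_def B_lin)
  have "supp_on (J \<union> L) y"
    using insert.prems(2) unfolding supp_on_def y_def by (auto simp: coord_bas)
  then have "eichler_in K c y" using insert y by blast
  then have "eichler_in K c (y + coord x k *\<^sub>Z bas k)"
    using insert.prems(1)[of k] assms(2) y by (intro eichler_in_add eichler_in_smul) (simp_all add: B_lin)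
  then show ?case by (simp add: y_def)
qed

text \<open>
  Two Eichler transformations carry the root \<open>q = b\<^sub>k\<close> to \<open>q - \<rho> D + \<rho> \<kappa> t\<^sup>2 C\<close>; the values
  \<open>t = 1, 2\<close> give two roots that differ by a multiple of \<open>C\<close>.
\<close>

lemma eichler_in_torus:
  assumes K: "K \<subseteq> {..<n}" "k \<in> K"
    and iso: "B C C = 0" "B D D = 0" "B C D = - \<kappa>" "B e C = 0" "B e D = 0" "B e e = 2"
    and q: "B (bas k) C = - \<rho> * \<kappa>" "B (bas k) D = 0" "B (bas k) e = 0"
    and S: "eichler_in K C e" "eichler_in K D e"
    and p: "\<not> p dvd \<kappa>" "\<not> p dvd 3 * \<rho> * \<kappa>"
  shows "eichler_in K C (bas k - \<rho> *\<^sub>Z D)"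
proof -
  define y where "y t = bas k - \<rho> *\<^sub>Z D + (\<rho> * \<kappa> * t * t) *\<^sub>Z C" for t
  have Ce: "B C e = 0" using iso(4) by (simp add: B_sym[of C e])
  have kk: "B (bas k) (bas k) = 2" using K B_bas[of k k] by (auto simp: A_diag)
  have orb: "orb K (bas k) (y t)" if t: "\<not> p dvd t" for t
  proof -
    obtain r where r: "[r * (\<kappa> * t) = 1] (mod p)"
      using inv_mod[of "\<kappa> * t"] p t prime_p by (auto simp: prime_dvd_mult_iff)
    \<comment> \<open>The second Eichler transformation has to cancel the \<open>e\<close>-component
      \<open>- \<rho> * \<kappa> * t\<close> left by the first, which forces this multiple of
      \<open>e\<close>.\<close>
    define s' where "s' = - r"
    define y1 where "y1 = bas k - (\<rho> * \<kappa> * t) *\<^sub>Z e + (\<rho> * \<kappa> * t * t) *\<^sub>Z C"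
    have "E C (t *\<^sub>Z e) (bas k)
      = bas k - (\<rho> * \<kappa> * t) *\<^sub>Z e + (2 * hf * (\<rho> * \<kappa> * t * t)) *\<^sub>Z C"
      by (rule coord_ext) (simp add: E_def B_lin q iso algebra_simps)
    also have "\<dots> \<approx> bas k - (\<rho> * \<kappa> * t) *\<^sub>Z e + (1 * (\<rho> * \<kappa> * t * t)) *\<^sub>Z C"
      by (intro veq_add veq_smul cong_mult hf_cong veq_refl cong_refl)
    finally have "E C (t *\<^sub>Z e) (bas k) \<approx> y1" by (simp add: y1_def)
    moreover have "inG K (E C (t *\<^sub>Z e))"
      using eichler_in_smul[OF S(1)] iso by (simp add: eichler_in_def)
    ultimately have 1: "orb K (bas k) y1" using orb_inG by blast
    have "E D (s' *\<^sub>Z e) y1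
      = y1 + (\<rho> * \<kappa> * t * (r * (\<kappa> * t))) *\<^sub>Z e
        - (2 * \<rho> * (r * (\<kappa> * t)) - 2 * hf * (\<rho> * (r * (\<kappa> * t)) * (r * (\<kappa> * t)))) *\<^sub>Z D"
      by (rule coord_ext) (simp add: E_def B_lin q iso y1_def s'_def Ce algebra_simps)
    also have "\<dots> \<approx> y1 + (\<rho> * \<kappa> * t * 1) *\<^sub>Z e - (2 * \<rho> * 1 - 1 * (\<rho> * 1 * 1)) *\<^sub>Z D"
      by (intro veq_add veq_diff veq_smul cong_mult cong_diff hf_cong veq_refl cong_refl r)
    also have "\<dots> = y t"
      by (rule coord_ext) (simp add: y1_def y_def algebra_simps)
    finally have "E D (s' *\<^sub>Z e) y1 \<approx> y t" .
    moreover have "inG K (E D (s' *\<^sub>Z e))"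
      using eichler_in_smul[OF S(2)] iso by (simp add: eichler_in_def)
    ultimately show ?thesis using 1 orb_inG orb_trans by blast
  qed
  have "\<not> p dvd 1" using p_gt_2 zdvd_imp_le[of p 1] by auto
  then have G: "inG K (R 1 (y 1))" "inG K (R 1 (y 2))"
    using orb not_p_dvd_2 inG_R_orb[OF K(1) _ inG_bas[OF K(2)]] by auto
  have y2: "y 2 = y 1 + (3 * \<rho> * \<kappa>) *\<^sub>Z C"
    by (rule coord_ext) (simp add: y_def algebra_simps)
  have yC: "B (y 1) C = 0" by (simp add: y_def B_lin q iso B_sym[of D C])
  have "B (y 1) (y 1) = 2"
    by (simp add: y_def B_lin q iso kk B_sym[of D C] B_sym[of D "bas k"] B_sym[of C "bas k"] algebra_simps)
  then have "eichler_in K C (y 1)"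
    using eichler_in_of_roots[OF G(1) G(2)[unfolded y2]] yC iso p by simp
  then have "eichler_in K C (y 1 - (\<rho> * \<kappa>) *\<^sub>Z C)"
    using yC iso by (intro eichler_in_diff eichler_in_self) (simp_all add: B_lin)
  moreover have "y 1 - (\<rho> * \<kappa>) *\<^sub>Z C = bas k - \<rho> *\<^sub>Z D" by (simp add: y_def)
  ultimately show ?thesis by simp
qed

end

context refl_nu
begin

lemma full_single:
  assumes "k < n"
  shows "full {k}"
proof -
  have x: "x \<approx> coord x k *\<^sub>Z bas k" if "supp_on {k} x" for x
    using that by (auto simp: veq_def supp_on_def coord_bas cong_0_iff)
  have norm: "[B x x = coord x k * coord x k * 2] (mod p)" if "supp_on {k} x" for x
    using B_cong[OF x[OF that] x[OF that]] B_bas[OF assms assms] by (simp add: B_lin A_diag mult.assoc)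
  have "inG {k} (R 1 x)" if "supp_on {k} x" "[B x x = 2] (mod p)" for x
  proof -
    have "[coord x k * coord x k * 2 = 1 * 1 * 2] (mod p)"
      using cong_trans[OF cong_sym[OF norm[OF that(1)]] that(2)] by simp
    then have sq: "[coord x k * coord x k = 1 * 1] (mod p)" using cong_cancel not_p_dvd_2 by blast
    have eq: "R 1 (bas k) z \<approx> R 1 x z" for z
    proof -
      have "R 1 (bas k) z \<approx> R (1 * coord x k * coord x k) (bas k) z"
        using cong_sym[OF sq] by (intro R_veq) auto
      also have "\<dots> = R 1 (coord x k *\<^sub>Z bas k) z" by (simp add: R_scale)
      also have "\<dots> \<approx> R 1 x z" by (intro R_veq veq_sym[OF x[OF that(1)]]) auto
      finally show ?thesis .
    qed
    show ?thesis by (rule inG_cong[OF inG_bas]) (simp, rule eq)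
  qed
  moreover have False if "supp_on {k} x" "[B x x = 2 * nu] (mod p)" for x
  proof -
    have "[coord x k * coord x k * 2 = nu * 2] (mod p)"
      using cong_trans[OF cong_sym[OF norm[OF that(1)]] that(2)] by (simp add: mult.commute)
    then show False using cong_cancel not_p_dvd_2 nu_nonsquare by blast
  qed
  ultimately show ?thesis unfolding full_def by blast
qed

text \<open>\<open>c\<close> spans the radical and the norm of
  \<open>l *\<^sub>Z bas i + t *\<^sub>Z c\<close> is \<open>l * l\<close>. So no vector has norm
  \<open>nu\<close>, and those of norm 1 are, up to sign, translates of \<open>bas i\<close> by
  multiples of \<open>c\<close>.\<close>

lemma full_dihedral:
  assumes ij: "i < n" "j < n" "i \<noteq> j" and Aij: "A i j = - 2"
  shows "full {i, j}"
proof -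
  define K where "K = {i, j}"
  define c where "c = bas i + bas j"
  have Bs: "B (bas i) (bas i) = 2" "B (bas j) (bas j) = 2" "B (bas i) (bas j) = - 2" "B (bas j) (bas i) = - 2"
    using ij Aij by (simp_all add: B_bas A_diag A_sym[of j i])
  have cc: "B c c = 0" "B (bas i) c = 0" by (simp_all add: c_def B_lin Bs)
  have Gi: "inG K (R 1 (bas i))" and Gj: "inG K (R 1 (bas j))"
    by (auto simp: K_def intro: inG_bas)
  have S: "eichler_in K c (bas i)"
  proof (rule eichler_in_of_roots[OF Gi])
    have "bas i + (- 1) *\<^sub>Z c = - bas j" by (rule coord_ext) (simp add: c_def)
    then show "inG K (R 1 (bas i + (- 1) *\<^sub>Z c))"
      using Gj inG_cong[OF Gj] R_minus[of 1 "bas j"] by (metis veq_refl)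
    show "\<not> p dvd - 1" using p_gt_2 zdvd_imp_le[of p 1] by auto
  qed (use cc Bs in simp_all)
  have x: "x \<approx> (coord x i - coord x j) *\<^sub>Z bas i + coord x j *\<^sub>Z c" if "supp_on K x" for x
    using that ij by (auto simp: K_def veq_def supp_on_def coord_bas cong_0_iff c_def)
  have norm: "[B x x = (coord x i - coord x j) * (coord x i - coord x j) * 2] (mod p)" if "supp_on K x" for x
    using B_cong[OF x[OF that] x[OF that]] by (simp add: B_lin Bs cc B_sym[of c "bas i"] mult.assoc)
  have rc: "inG K (R 1 (bas i + t *\<^sub>Z c))" for t
  proof -
    have Et: "inG K (E c (t *\<^sub>Z bas i))"
      using eichler_in_smul[OF S] cc by (simp add: eichler_in_def)
    show ?thesis
    proof (rule inG_cong[OF inG_comp[OF Gi Et]])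
      fix z
      have "R 1 (bas i) (E c (t *\<^sub>Z bas i) z) \<approx> R 1 (bas i) (R 1 (bas i) (R 1 (bas i + t *\<^sub>Z c) z))"
        using cc Bs by (intro R_veq veq_refl cong_refl veq_sym[OF R_R_E]) simp_all
      also have "\<dots> \<approx> R 1 (bas i + t *\<^sub>Z c) z"
        by (rule R_invol) (simp add: Bs)
      finally show "R 1 (bas i) (E c (t *\<^sub>Z bas i) z) \<approx> R 1 (bas i + t *\<^sub>Z c) z" .
    qed
  qed
  have "inG K (R 1 x)" if xs: "supp_on K x" "[B x x = 2] (mod p)" for x
  proof -
    define l where "l = coord x i - coord x j"
    have "[l * l * 2 = 1 * 1 * 2] (mod p)"
      using cong_trans[OF cong_sym[OF norm[OF xs(1)]] xs(2)] by (simp add: l_def)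
    then have sq: "[l * l = 1 * 1] (mod p)" using cong_cancel not_p_dvd_2 by blast
    have eq: "R 1 (bas i + (l * coord x j) *\<^sub>Z c) z \<approx> R 1 x z" for z
    proof -
      have "R 1 (bas i + (l * coord x j) *\<^sub>Z c) z \<approx> R (1 * l * l) (bas i + (l * coord x j) *\<^sub>Z c) z"
        using cong_sym[OF sq] by (intro R_veq) auto
      also have "\<dots> = R 1 (l *\<^sub>Z (bas i + (l * coord x j) *\<^sub>Z c)) z" by (simp add: R_scale)
      also have "l *\<^sub>Z (bas i + (l * coord x j) *\<^sub>Z c) = l *\<^sub>Z bas i + (l * l * coord x j) *\<^sub>Z c"
        by (rule coord_ext) (simp add: algebra_simps)
      also have "R 1 \<dots> z \<approx> R 1 (l *\<^sub>Z bas i + (1 * 1 * coord x j) *\<^sub>Z c) z"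
        by (rule R_veq[OF veq_refl veq_add[OF veq_refl veq_smul[OF cong_mult[OF sq cong_refl] veq_refl]] cong_refl])
      also have "\<dots> \<approx> R 1 x z"
        using veq_sym[OF x[OF xs(1)]] by (intro R_veq) (auto simp: l_def)
      finally show ?thesis .
    qed
    show ?thesis by (rule inG_cong[OF rc]) (rule eq)
  qed
  moreover have False if xs: "supp_on K x" "[B x x = 2 * nu] (mod p)" for x
  proof -
    have "[(coord x i - coord x j) * (coord x i - coord x j) * 2 = nu * 2] (mod p)"
      using cong_trans[OF cong_sym[OF norm[OF xs(1)]] xs(2)] by (simp add: mult.commute)
    then show False using cong_cancel not_p_dvd_2 nu_nonsquare by blast
  qed
  ultimately have "full K" unfolding full_def by blast
  then show ?thesis by (simp add: K_def)
qed

end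

text \<open>The enumeration \<open>v\<close> lets the same lemmas run along the diagram in either
  direction. \<open>d i\<close> is the bond between \<open>v i\<close> and \<open>v (Suc i)\<close>:
  1 for order 3 and 2 for infinite order.\<close>

locale path = refl_nu +
  fixes v :: "nat \<Rightarrow> nat" and N :: nat and d :: "nat \<Rightarrow> int"
  assumes v_less: "i < N \<Longrightarrow> v i < n"
    and v_inj: "inj_on v {..<N}"
    and A_path: "i < N \<Longrightarrow> j < N \<Longrightarrow> A (v i) (v j) =
      (if i = j then 2 else if j = Suc i then - d i else if i = Suc j then - d j else 0)"
begin

abbreviation b :: "nat \<Rightarrow> ivec" where "b i \<equiv> bas (v i)"
abbreviation K :: "nat set" where "K \<equiv> v ` {..<N}"

lemma K_sub: "K \<subseteq> {..<n}"
  using v_less by auto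

lemma v_eq: "i < N \<Longrightarrow> j < N \<Longrightarrow> v i = v j \<longleftrightarrow> i = j"
  using v_inj by (auto simp: inj_on_def)

lemma B_b: "i < N \<Longrightarrow> j < N \<Longrightarrow> B (b i) (b j) =
    (if i = j then 2 else if j = Suc i then - d i else if i = Suc j then - d j else 0)"
  by (simp add: B_bas v_less A_path)

lemma R_minus_fun: "R s' (- u) = R s' u"
  by (rule ext) (rule R_minus)

lemma inG_b: "i < N \<Longrightarrow> inG K (R 1 (b i))"
  by (rule inG_bas) simp

lemma p_big: "p > m \<Longrightarrow> m > 0 \<Longrightarrow> \<not> p dvd m" "p > m \<Longrightarrow> m > 0 \<Longrightarrow> \<not> p dvd - m"
  by (auto dest: zdvd_imp_le)

text \<open>Only \<open>\<alpha>\<close> and possibly \<open>\<beta>\<close> pair nontrivially with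
  \<open>C\<close>, so its complement is spanned by the other nodes and
  \<open>b \<beta> - m *\<^sub>Z b \<alpha>\<close>. A value \<open>\<beta> \<ge> N\<close> encodes
  that there is no such second node.\<close>

lemma eichler_in_all:
  assumes \<alpha>: "\<alpha> < N" and cc: "B C C = 0" and \<kappa>: "\<not> p dvd B (b \<alpha>) C"
    and S: "\<And>i. i < N \<Longrightarrow> i \<noteq> \<alpha> \<Longrightarrow> i \<noteq> \<beta> \<Longrightarrow> eichler_in K C (b i) \<and> B (b i) C = 0"
    and \<beta>: "\<beta> \<noteq> \<alpha>" "\<beta> < N \<Longrightarrow> eichler_in K C (b \<beta> - m *\<^sub>Z b \<alpha>) \<and> B (b \<beta>) C = m * B (b \<alpha>) C"
    and x: "supp_on K x" "[B x C = 0] (mod p)"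
  shows "eichler_in K C x"
proof (rule eichler_in_span[where J = "v ` ({..<N} - {\<alpha>, \<beta>})" and L = "v ` ({..<N} \<inter> {\<alpha>, \<beta>})"])
  fix y assume y: "supp_on (v ` ({..<N} \<inter> {\<alpha>, \<beta>})) y" "[B y C = 0] (mod p)"
  show "eichler_in K C y"
  proof (cases "\<beta> < N")
    case True
    define l where "l = coord y (v \<beta>)"
    define q where "q = coord y (v \<alpha>) + m * l"
    define z where "z = b \<beta> - m *\<^sub>Z b \<alpha>"
    have "\<not> p dvd coord y i \<Longrightarrow> i = v \<alpha> \<or> i = v \<beta>" for i
      using y(1) by (auto simp: supp_on_def)
    then have yz: "y \<approx> q *\<^sub>Z b \<alpha> + l *\<^sub>Z z"
      using v_eq[OF \<alpha> True] \<beta>(1) by (auto simp: veq_def l_def q_def z_def coord_bas cong_0_iff)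
    have zC: "B z C = 0" using \<beta>(2)[OF True] by (simp add: z_def B_lin)
    have "[q * B (b \<alpha>) C = 0 * B (b \<alpha>) C] (mod p)"
      using cong_trans[OF cong_sym[OF B_cong[OF yz veq_refl[of C]]] y(2)] zC by (simp add: B_lin)
    then have "[q = 0] (mod p)" using cong_cancel \<kappa> by blast
    then have "q *\<^sub>Z b \<alpha> + l *\<^sub>Z z \<approx> 0 *\<^sub>Z b \<alpha> + l *\<^sub>Z z"
      by (intro veq_add veq_smul veq_refl cong_refl)
    then have "l *\<^sub>Z z \<approx> y" using veq_trans[OF yz] veq_sym by simp
    moreover have "eichler_in K C (l *\<^sub>Z z)"
      using eichler_in_smul[of K C z l] \<beta>(2)[OF True] zC cc by (simp add: z_def)
    ultimately show ?thesis using eichler_in_veq veq_refl by blast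
  next
    case False
    define q where "q = coord y (v \<alpha>)"
    have "\<not> p dvd coord y i \<Longrightarrow> i = v \<alpha>" for i
      using y(1) False by (auto simp: supp_on_def)
    then have yz: "y \<approx> q *\<^sub>Z b \<alpha>"
      by (auto simp: veq_def q_def coord_bas cong_0_iff)
    have "[q * B (b \<alpha>) C = 0 * B (b \<alpha>) C] (mod p)"
      using cong_trans[OF cong_sym[OF B_cong[OF yz veq_refl[of C]]] y(2)] by (simp add: B_lin)
    then have "[q = 0] (mod p)" using cong_cancel \<kappa> by blast
    then have "q *\<^sub>Z b \<alpha> \<approx> 0 *\<^sub>Z b \<alpha>" by (intro veq_smul veq_refl)
    then have "0 \<approx> y" using veq_trans[OF yz] veq_sym by simp
    then show ?thesis using eichler_in_zero eichler_in_veq veq_refl by blast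
  qed
next
  show "supp_on (v ` ({..<N} - {\<alpha>, \<beta>}) \<union> v ` ({..<N} \<inter> {\<alpha>, \<beta>})) x"
    using x(1) by (rule supp_on_mono) auto
qed (use cc S x in auto)

text \<open>Two overlapping infinite bonds give the hyperbolic pair \<open>C\<close>,
  \<open>D\<close>, and their common node is a root orthogonal to both. Only node 3 needs a new
  idea, since it is not orthogonal to \<open>C\<close>.\<close>

lemma full_infinity:
  assumes N: "N \<ge> 3" and d: "\<And>i. Suc i < N \<Longrightarrow> d i = 2" and p: "p > 3"
  shows "full K"
proof -
  define C where "C = b 1 + b 2"
  define D where "D = b 0 + b 1"
  have nodvd: "\<not> p dvd 2" "\<not> p dvd - 2" "\<not> p dvd 1" "\<not> p dvd - 1" "\<not> p dvd 3"
    using p p_big by auto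
  have n6: "\<not> p dvd 6"
    using nodvd prime_p prime_dvd_mult_iff[of p 2 3] by simp
  have d01: "d 0 = 2" "d (Suc 0) = 2" "N > 3 \<Longrightarrow> d 2 = 2"
    using N d[of 0] d[of 1] d[of 2] by auto
  have B3: "B (b 0) (b 0) = 2" "B (b 0) (b 1) = - 2" "B (b 0) (b 2) = 0"
    "B (b 1) (b 0) = - 2" "B (b 1) (b 1) = 2" "B (b 1) (b 2) = - 2"
    "B (b 2) (b 0) = 0" "B (b 2) (b 1) = - 2" "B (b 2) (b 2) = 2"
    using N d01 by (simp_all add: B_b numeral_2_eq_2)
  note B3 = B3 B3[unfolded One_nat_def]
  have CD: "B C C = 0" "B D D = 0" "B C D = - 2" "B (b 1) C = 0" "B (b 1) D = 0"
    "B (b 0) C = - 2" "B (b 2) C = 0"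
    by (simp_all add: C_def D_def B_lin B3)
  note CD = CD CD[unfolded One_nat_def]
  have SC1: "eichler_in K C (b 1)"
  proof (rule eichler_in_of_roots[where t = "- 1"])
    have "b 1 + (- 1) *\<^sub>Z C = - b 2" by (rule coord_ext) (simp add: C_def)
    moreover have "inG K (R 1 (b 2))" using N inG_b by simp
    ultimately show "inG K (R 1 (b 1 + (- 1) *\<^sub>Z C))"
      by (simp only: R_minus_fun)
  qed (use N CD B3 nodvd inG_b in auto)
  have SD1: "eichler_in K D (b 1)"
  proof (rule eichler_in_of_roots[where t = "- 1"])
    have "b 1 + (- 1) *\<^sub>Z D = - b 0" by (rule coord_ext) (simp add: D_def)
    moreover have "inG K (R 1 (b 0))" using N inG_b by simp
    ultimately show "inG K (R 1 (b 1 + (- 1) *\<^sub>Z D))"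
      by (simp only: R_minus_fun)
  qed (use N CD B3 nodvd inG_b in auto)
  have SC2: "eichler_in K C (b 2)"
  proof -
    have "eichler_in K C (1 *\<^sub>Z C - b 1)"
      using CD by (intro eichler_in_diff eichler_in_self SC1) simp_all
    then show ?thesis by (simp add: C_def)
  qed
  have far: "B (b i) C = 0" if "i < N" "i \<ge> 4" for i
    using that N by (auto simp: C_def B_lin B_b)
  \<comment> \<open>Here \<open>\<rho> = 1\<close> and \<open>\<kappa> = 2\<close>, so 6 must be
    invertible; this is where \<open>p > 3\<close> enters.\<close>
  have S3: "eichler_in K C (b 3 - 1 *\<^sub>Z D)" if "3 < N"
  proof (rule eichler_in_torus[where e = "b 1" and \<kappa> = 2, OF K_sub])
    show "B (b 3) C = - 1 * 2" "B (b 3) D = 0" "B (b 3) (b 1) = 0"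
      using that d01(3) by (simp_all add: C_def D_def B_lin B_b numeral_2_eq_2 numeral_3_eq_3)
  qed (use that CD B3 SC1 SD1 nodvd n6 in auto)
  have B3C: "B (b 3) C = - 2" if "3 < N"
    using that d01(3) by (simp add: C_def B_lin B_b numeral_2_eq_2 numeral_3_eq_3)
  have S3': "eichler_in K C (b 3 - 1 *\<^sub>Z b 0)" if "3 < N"
  proof -
    have "eichler_in K C ((b 3 - 1 *\<^sub>Z D) + b 1)"
      using S3[OF that] SC1 CD B3C[OF that]
      by (intro eichler_in_add) (simp_all add: B_lin B_sym[of D C])
    moreover have "(b 3 - 1 *\<^sub>Z D) + b 1 = b 3 - 1 *\<^sub>Z b 0"
      by (rule coord_ext) (simp add: D_def)
    ultimately show ?thesis by (simp only:)
  qed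
  have S4: "eichler_in K C (b (4 + i))" if "4 + i < N" for i
    using that
  proof (induction i)
    case 0
    then have i: "3 < N" "4 < N" by simp_all
    have "B (b 3 - 1 *\<^sub>Z b 0) (b 4) = - 2"
      using i d[of 3] by (simp add: B_lin B_b)
    then show ?case
      using eichler_in_next[OF K_sub _ S3'[OF i(1)], of "v 4"] i CD far[of 4] B3C[OF i(1)] nodvd
      by (simp add: B_lin)
  next
    case (Suc i)
    then have "B (b (4 + i)) (b (4 + Suc i)) = - 2"
      using d[of "4 + i"] by (simp add: B_b)
    then show ?case
      using eichler_in_next[OF K_sub _ Suc.IH, of "v (4 + Suc i)"] Suc.prems CD far[of "4 + i"] far[of "4 + Suc i"] nodvd
      by simp
  qed
  have all: "eichler_in K C x" if "supp_on K x" "[B x C = 0] (mod p)" for x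
  proof (rule eichler_in_all[where \<alpha> = 0 and \<beta> = 3 and m = 1])
    fix i assume i: "i < N" "i \<noteq> 0" "i \<noteq> 3"
    then consider "i = 1" | "i = 2" | "i \<ge> 4" by linarith
    then show "eichler_in K C (b i) \<and> B (b i) C = 0"
    proof cases
      case 3
      then show ?thesis using S4[of "i - 4"] far i by simp
    qed (use SC1 SC2 CD in auto)
  next
    show "3 < N \<Longrightarrow> eichler_in K C (b 3 - 1 *\<^sub>Z b 0) \<and> B (b 3) C = 1 * B (b 0) C"
      using S3' B3C CD by simp
  qed (use that N CD nodvd in auto)
  show ?thesis
  proof (rule full_if_E[where c = C and c' = D and e = "b 1" and k = "v 0", OF K_sub])
    show "supp_on K C" "supp_on K D" "supp_on K (b 1)"
      using N unfolding C_def D_def by (auto intro!: supp_on_lin)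
    show "v 0 \<in> K" using N by auto
  qed (use CD B3 SD1 all nodvd in auto)
qed

end

context path
begin

text \<open>One infinite bond gives \<open>C\<close>, and the adjacent node \<open>j\<close> of
  order 3 carries it to \<open>D\<close>. The nodes to the left of \<open>j\<close> are started by
  \<open>eichler_in_torus\<close>. This fails on the right because node \<open>j + 3\<close> is not
  orthogonal to \<open>e\<close>.\<close>

lemma full_three_infinity:
  assumes N: "j + 2 < N" and dj: "d j = 1" "d (Suc j) = 2"
    and d: "\<And>i. Suc i < N \<Longrightarrow> d i = 1 \<or> d i = 2" and p: "p > 17"
  shows "full K"
proof -
  define C where "C = b (j + 1) + b (j + 2)"
  define D where "D = C + b j"
  define e where "e = b (j + 2)"
  have small: "\<not> p dvd m" "\<not> p dvd - m" if "0 < m" "m < 18" for m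
    using p_big[of m] that p by auto
  have dnz: "\<not> p dvd d i" "\<not> p dvd - d i" "\<not> p dvd 3 * d i" if "Suc i < N" for i
    using d[OF that] small[of 1] small[of 2] small[of 3] small[of 6] by auto
  have Bj: "B (b j) (b j) = 2" "B (b j) (b (j + 1)) = - 1" "B (b j) (b (j + 2)) = 0"
    "B (b (j + 1)) (b j) = - 1" "B (b (j + 1)) (b (j + 1)) = 2" "B (b (j + 1)) (b (j + 2)) = - 2"
    "B (b (j + 2)) (b j) = 0" "B (b (j + 2)) (b (j + 1)) = - 2" "B (b (j + 2)) (b (j + 2)) = 2"
    using N dj by (simp_all add: B_b)
  note Bj = Bj Bj[simplified]
  have CD: "B C C = 0" "B D D = 0" "B C D = - 1" "B e C = 0" "B e D = 0" "B e e = 2"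
    "B (b j) C = - 1" "B (b (j + 1)) C = 0" "B C (b j) = - 1" "B D (b j) = 1" "B e (b j) = 0" "B D C = - 1"
    by (simp_all add: C_def D_def e_def B_lin Bj)
  note CD = CD CD[simplified]
  have act_j: "act [j'] x = x - B x (bas j') *\<^sub>Z bas j'" for j' x
    by (simp add: R_def)
  have SC2: "eichler_in L C e" if "v (j + 1) \<in> L" "v (j + 2) \<in> L" for L
  proof (rule eichler_in_of_roots[where t = "- 1"])
    have "e + (- 1) *\<^sub>Z C = - b (j + 1)" by (rule coord_ext) (simp add: C_def e_def)
    moreover have "inG L (R 1 (b (j + 1)))" by (rule inG_bas[OF that(1)])
    ultimately show "inG L (R 1 (e + (- 1) *\<^sub>Z C))"
      by (simp only: R_minus_fun)
    show "inG L (R 1 e)" unfolding e_def by (rule inG_bas[OF that(2)])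
  qed (use CD small[of 1] in auto)
  have SD2: "eichler_in L D e" if "v j \<in> L" "v (j + 1) \<in> L" "v (j + 2) \<in> L" "L \<subseteq> {..<n}" for L
  proof -
    have "eichler_in L (act [v j] C) (act [v j] e)"
      by (rule eichler_in_act[OF that(4) _ SC2]) (use that in auto)
    moreover have "act [v j] C = D" "act [v j] e = e"
      unfolding act_j by (rule coord_ext, simp add: CD D_def)+
    ultimately show ?thesis by simp
  qed
  have SC1: "eichler_in L C (b (j + 1))" if "v (j + 1) \<in> L" "v (j + 2) \<in> L" for L
  proof -
    have "eichler_in L C (1 *\<^sub>Z C - e)"
      using CD by (intro eichler_in_diff eichler_in_self SC2 that) simp_all
    moreover have "1 *\<^sub>Z C - e = b (j + 1)" by (simp add: C_def e_def)
    ultimately show ?thesis by (simp only:)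
  qed
  have inK: "v j \<in> K" "v (j + 1) \<in> K" "v (j + 2) \<in> K" using N by auto
  have SCe: "eichler_in K C e" by (rule SC2[OF inK(2,3)])
  have SDe: "eichler_in K D e" by (rule SD2[OF inK K_sub])
  \<comment> \<open>The three nodes \<open>j\<close>, \<open>j + 1\<close>, \<open>j + 2\<close> are
    treated first, on their own: this yields reflections in roots of their span other than the basis
    vectors, as \<open>right1\<close> needs.\<close>
  have F1: "inG K (R 1 a)"
    if a: "a = x0 *\<^sub>Z b j + x1 *\<^sub>Z b (j + 1) + x2 *\<^sub>Z b (j + 2)" "[B a a = 2] (mod p)" for a x0 x1 x2
  proof -
    define w where "w i = v (j + i)" for i
    interpret P: path n A p nu s w 3 "\<lambda>i. d (j + i)"
    proof
      show "inj_on w {..<3}"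
      proof (rule inj_onI)
        fix i i' :: nat assume "i \<in> {..<3}" "i' \<in> {..<3}" "w i = w i'"
        then show "i = i'" using v_eq[of "j + i" "j + i'"] N by (simp add: w_def)
      qed
    qed (use N in \<open>auto simp: w_def v_less A_path\<close>)
    have w: "w 0 = v j" "w 1 = v (j + 1)" "w 2 = v (j + 2)" by (simp_all add: w_def)
    have L: "P.K = {v j, v (j + 1), v (j + 2)}"
      by (simp add: w_def lessThan_Suc numeral_3_eq_3 insert_commute)
    have LK: "P.K \<subseteq> K" using inK unfolding L by auto
    have "full P.K"
    proof (rule full_if_E[where c = C and c' = D and e = e and k = "v j", OF P.K_sub])
      show "supp_on P.K C" "supp_on P.K D" "supp_on P.K e"
        unfolding C_def D_def e_def L by (intro supp_on_lin; simp)+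
      show "v j \<in> P.K" by (simp add: L)
      show "eichler_in P.K C x" if "supp_on P.K x" "[B x C = 0] (mod p)" for x
      proof (rule P.eichler_in_all[where \<alpha> = 0 and \<beta> = 3 and m = 0, OF _ _ _ _ _ _ that])
        fix i :: nat assume "i < 3" "i \<noteq> 0" "i \<noteq> 3"
        then have "i = 1 \<or> i = 2" by linarith
        then show "eichler_in P.K C (P.b i) \<and> B (P.b i) C = 0"
        proof
          assume "i = 1"
          then have "P.b i = b (j + 1)" by (simp add: w_def)
          moreover have "eichler_in P.K C (b (j + 1))" by (rule SC1) (simp_all only: L insert_iff simp_thms)
          ultimately show ?thesis by (simp only: CD simp_thms)
        next
          assume "i = 2"
          then have "P.b i = e" by (simp add: w_def e_def)
          moreover have "eichler_in P.K C e" by (rule SC2) (simp_all only: L insert_iff simp_thms)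
          ultimately show ?thesis by (simp only: CD simp_thms)
        qed
      qed (use CD small[of 1] in \<open>auto simp: w\<close>)
      show "eichler_in P.K D e" by (rule SD2[OF _ _ _ P.K_sub]) (simp_all add: L)
    qed (use CD small[of 1] in auto)
    moreover have "supp_on P.K a"
      unfolding a L by (intro supp_on_lin; simp)
    ultimately have "inG P.K (R 1 a)" using a(2) unfolding full_def by blast
    then show ?thesis using inG_mono LK by blast
  qed
  \<comment> \<open>Node \<open>j - 1\<close> is orthogonal to \<open>C\<close> but not to
    \<open>D\<close>, so the torus argument is applied with the two exchanged. The reflection at
    \<open>j\<close> brings \<open>D\<close> back to \<open>C\<close> and fixes
    \<open>q - \<theta> *\<^sub>Z C\<close>.\<close>
  have left1: "eichler_in K C (b (j - 1))" if j1: "j \<ge> 1"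
  proof -
    define \<theta> where "\<theta> = d (j - 1)"
    define q where "q = b (j - 1)"
    have th: "\<not> p dvd 3 * \<theta>" using dnz[of "j - 1"] j1 N by (simp add: \<theta>_def)
    have Bq: "B q (b j) = - \<theta>" "B q (b (j + 1)) = 0" "B q (b (j + 2)) = 0"
    proof -
      obtain i where "j = Suc i" using j1 by (cases j) auto
      then show "B q (b j) = - \<theta>" "B q (b (j + 1)) = 0" "B q (b (j + 2)) = 0"
        using N by (simp_all add: q_def B_b \<theta>_def)
    qed
    note Bq = Bq Bq[simplified]
    have qCD: "B q C = 0" "B q D = - \<theta>" "B q e = 0"
      by (simp_all add: C_def D_def e_def B_lin Bq)
    note qCD = qCD qCD[unfolded q_def One_nat_def]
    have "eichler_in K D (q - \<theta> *\<^sub>Z C)"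
      unfolding q_def
    proof (rule eichler_in_torus[where e = e and \<kappa> = 1, OF K_sub, folded q_def])
      show "v (j - 1) \<in> K" using N by simp
    qed (use qCD CD SCe SDe th small[of 1] in simp_all)
    then have "eichler_in K (act [v j] D) (act [v j] (q - \<theta> *\<^sub>Z C))"
      by (intro eichler_in_act[OF K_sub]) (use inK in auto)
    moreover have "act [v j] D = C"
      unfolding act_j CD by (simp add: D_def)
    moreover have "act [v j] (q - \<theta> *\<^sub>Z C) = q - \<theta> *\<^sub>Z C"
      unfolding act_j by (rule coord_ext) (simp add: CD B_lin Bq)
    ultimately have "eichler_in K C (q - \<theta> *\<^sub>Z C)" by simp
    then have "eichler_in K C ((q - \<theta> *\<^sub>Z C) + \<theta> *\<^sub>Z C)"
      by (rule eichler_in_add) (use qCD CD eichler_in_self in \<open>auto simp: B_lin\<close>)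
    then show ?thesis by (simp add: q_def)
  qed
  have farC: "B (b i) C = 0" if "i < N" "i < j \<or> i \<ge> j + 4" for i
    using that N by (auto simp: C_def B_lin B_b)
  have left: "i < j \<Longrightarrow> eichler_in K C (b (j - 1 - i))" for i
  proof (induction i)
    case 0
    then show ?case using left1 by simp
  next
    case (Suc i)
    then have "B (b (j - 1 - i)) (b (j - 1 - Suc i)) = - d (j - 1 - Suc i)"
      using N by (auto simp: B_b)
    moreover have "\<not> p dvd - d (j - 1 - Suc i)" using Suc.prems N by (intro dnz) simp
    ultimately show ?case
      using eichler_in_next[OF K_sub _ Suc.IH, of "v (j - 1 - Suc i)"] Suc.prems N CD
        farC[of "j - 1 - i"] farC[of "j - 1 - Suc i"] by simp
  qed
  define \<theta> where "\<theta> = d (j + 2)"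
  have B3C: "B (b (j + 3)) C = \<theta> * B (b j) C" if "j + 3 < N"
    using that CD by (simp add: C_def B_lin B_b \<theta>_def)
  have right1: "eichler_in K C (b (j + 3) - \<theta> *\<^sub>Z b j)" if j3: "j + 3 < N"
  proof -
    have th: "\<theta> = 1 \<or> \<theta> = 2" using d[of "j + 2"] j3 by (simp add: \<theta>_def)
    define q where "q = b (j + 3)"
    have K3: "v (j + 3) \<in> K" using j3 by simp
    have Bq: "B q q = 2" "B q (b j) = 0" "B q (b (j + 1)) = 0" "B q (b (j + 2)) = - \<theta>"
      "B (b j) q = 0" "B (b (j + 1)) q = 0" "B (b (j + 2)) q = - \<theta>"
      using j3 by (simp_all add: q_def B_b \<theta>_def)
    note Bq = Bq Bq[simplified]
    text \<open>
      \<open>a\<close> is a vector of norm \<open>1\<close> in the span of \<open>b\<^sub>j, b\<^sub>j\<^sub>+\<^sub>1, b\<^sub>j\<^sub>+\<^sub>2\<close> orthogonal to \<open>f = r\<^sub>j\<^sub>+\<^sub>3 C\<close>,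
      found on a line through \<open>b\<^sub>j\<^sub>+\<^sub>1\<close>. Since \<open>\<theta> \<in> {1, 2}\<close>, its denominator \<open>\<theta>\<^sup>4 + 1\<close> is
      \<open>2\<close> or \<open>17\<close>.
    \<close>
    define D4 where "D4 = \<theta> * \<theta> * \<theta> * \<theta> + 1"
    have "\<not> p dvd D4" using th small[of 2] small[of 17] by (auto simp: D4_def)
    then obtain t where t: "[t * D4 = 1] (mod p)" using inv_mod by blast
    \<comment> \<open>\<open>x2 = 0\<close> would give \<open>b (j + 1)\<close> itself; this is the
      other solution of the norm equation. The coefficient \<open>- \<theta> * \<theta> * x2\<close>
      of \<open>b j\<close> is forced by orthogonality to \<open>f\<close>.\<close>
    define x2 where "x2 = (2 - \<theta> * \<theta>) * t"
    have x2: "[D4 * x2 = 2 - \<theta> * \<theta>] (mod p)"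
      using cong_mult[OF cong_refl[of "2 - \<theta> * \<theta>"] t] by (simp add: x2_def mult_ac)
    define a where "a = (- \<theta> * \<theta> * x2) *\<^sub>Z b j + 1 *\<^sub>Z b (j + 1) + x2 *\<^sub>Z b (j + 2)"
    have "B a a = 2 + 2 * (x2 * (D4 * x2 + (\<theta> * \<theta> - 2)))"
      by (simp add: a_def B_lin Bj D4_def algebra_simps)
    moreover have "[2 + 2 * (x2 * (D4 * x2 + (\<theta> * \<theta> - 2))) = 2 + 2 * (x2 * ((2 - \<theta> * \<theta>) + (\<theta> * \<theta> - 2)))] (mod p)"
      using x2 by (intro cong_add cong_mult cong_refl)
    ultimately have aa: "[B a a = 2] (mod p)" by simp
    obtain w where w: "w \<in> lists K" "\<And>x. act w x \<approx> R 1 a x"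
      using F1[OF a_def aa] by (auto simp: inG_def)
    \<comment> \<open>The images of \<open>C\<close> and \<open>e\<close> under the generator at
      \<open>j + 3\<close>. The reflection in \<open>a\<close> fixes \<open>f\<close> and shifts
      \<open>z\<close> by \<open>\<beta>\<close> times \<open>a\<close>, so the difference trick
      isolates \<open>a\<close> along \<open>f\<close>; transported back to \<open>C\<close>, it has
      a component along \<open>q\<close>.\<close>
    define f where "f = C + \<theta> *\<^sub>Z q"
    define z where "z = e + \<theta> *\<^sub>Z q"
    have q_act: "act [v (j + 3)] x = x - B x q *\<^sub>Z q" for x by (simp only: act_j q_def)
    have Cq: "B C q = - \<theta>" "B e q = - \<theta>" by (simp_all add: C_def e_def B_lin Bq)
    have "eichler_in K (act [v (j + 3)] C) (act [v (j + 3)] e)"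
      by (rule eichler_in_act[OF K_sub _ SCe]) (use K3 in simp)
    then have Sz: "eichler_in K f z"
    proof -
      have "act [v (j + 3)] C = f" "act [v (j + 3)] e = z"
        unfolding q_act by (rule coord_ext, simp add: Cq f_def z_def)+
      then show ?thesis
        using \<open>eichler_in K (act [v (j + 3)] C) (act [v (j + 3)] e)\<close> by simp
    qed
    have ff: "B f f = 0" "B z f = 0" "B a f = 0"
      by (simp_all add: f_def z_def a_def e_def C_def B_lin Bj Bq algebra_simps)
    define \<beta> where "\<beta> = B z a"
    have "\<beta> = (2 - \<theta> * \<theta>) * x2 - 2"
      by (simp add: \<beta>_def z_def a_def e_def B_lin Bj Bq algebra_simps)
    then have "D4 * \<beta> = D4 * ((2 - \<theta> * \<theta>) * x2 - 2)" by (simp only:)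
    also have "\<dots> = (2 - \<theta> * \<theta>) * (D4 * x2) - 2 * D4" by (simp add: algebra_simps)
    also have "[(2 - \<theta> * \<theta>) * (D4 * x2) - 2 * D4 = (2 - \<theta> * \<theta>) * (2 - \<theta> * \<theta>) - 2 * D4] (mod p)"
      using x2 by (intro cong_diff cong_mult cong_refl)
    finally have Db: "[D4 * \<beta> = (2 - \<theta> * \<theta>) * (2 - \<theta> * \<theta>) - 2 * D4] (mod p)" .
    \<comment> \<open>The right-hand side of \<open>Db\<close> is \<open>- 30\<close> for
      \<open>\<theta> = 2\<close>, and \<open>- 3\<close> for \<open>\<theta> = 1\<close>.\<close>
    have n30: "\<not> p dvd - 30"
    proof -
      have "\<not> p dvd 2" "\<not> p dvd 15" using small[of 2] small[of 15] by simp_all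
      then show ?thesis using prime_dvd_mult_iff[OF prime_p, of 2 15] by simp
    qed
    have "\<not> p dvd (2 - \<theta> * \<theta>) * (2 - \<theta> * \<theta>) - 2 * D4"
      using th small[of 3] n30 by (auto simp: D4_def)
    then have \<beta>0: "\<not> p dvd \<beta>" using Db cong_dvd_iff dvd_mult by blast
    have "eichler_in K (act w f) (act w z)" by (rule eichler_in_act[OF K_sub w(1) Sz])
    moreover have "act w f \<approx> f"
    proof -
      have "R 1 a f = f" using ff by (simp add: R_def B_sym[of f a])
      then show ?thesis using w(2)[of f] by simp
    qed
    moreover have "act w z \<approx> z - \<beta> *\<^sub>Z a"
      using w(2)[of z] by (simp add: R_def \<beta>_def)
    ultimately have "eichler_in K f (z - \<beta> *\<^sub>Z a)" by (rule eichler_in_veq)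
    then have "eichler_in K f (z - (z - \<beta> *\<^sub>Z a))"
      by (rule eichler_in_diff[OF Sz]) (use ff in \<open>simp_all add: B_lin\<close>)
    then have "eichler_in K f (\<beta> *\<^sub>Z a)" by simp
    then have "eichler_in K f a" using eichler_in_cancel \<beta>0 ff by simp
    then have "eichler_in K (act [v (j + 3)] f) (act [v (j + 3)] a)"
      by (intro eichler_in_act[OF K_sub]) (use K3 in auto)
    moreover have "act [v (j + 3)] f = C"
      unfolding q_act by (rule coord_ext) (simp add: f_def B_lin Cq Bq)
    moreover have "act [v (j + 3)] a = a + (\<theta> * x2) *\<^sub>Z q"
      unfolding q_act by (rule coord_ext) (simp add: a_def B_lin Bq)
    ultimately have 1: "eichler_in K C (a + (\<theta> * x2) *\<^sub>Z q)" by simp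
    have qC: "B q C = - \<theta>" by (simp add: B_sym[of q C] Cq)
    have aqC: "B (a + (\<theta> * x2) *\<^sub>Z q) C = 0"
      by (simp add: a_def C_def B_lin Bj Bq algebra_simps)
    have "eichler_in K C ((a + (\<theta> * x2) *\<^sub>Z q) - b (j + 1))"
      by (rule eichler_in_diff[OF 1 SC1[OF inK(2,3)]]) (use aqC CD in simp_all)
    then have "eichler_in K C (((a + (\<theta> * x2) *\<^sub>Z q) - b (j + 1)) - x2 *\<^sub>Z e)"
      by (rule eichler_in_diff[OF _ eichler_in_smul[OF SCe]]) (use aqC CD in \<open>simp_all add: B_lin\<close>)
    moreover have "((a + (\<theta> * x2) *\<^sub>Z q) - b (j + 1)) - x2 *\<^sub>Z e = (\<theta> * x2) *\<^sub>Z (q - \<theta> *\<^sub>Z b j)"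
      by (rule coord_ext) (simp add: a_def e_def algebra_simps)
    ultimately have 2: "eichler_in K C ((\<theta> * x2) *\<^sub>Z (q - \<theta> *\<^sub>Z b j))" by (simp only:)
    have "\<not> p dvd \<theta> * x2"
    proof
      assume "p dvd \<theta> * x2"
      then have "p dvd \<theta> * (D4 * x2)" by (metis dvd_mult mult.left_commute)
      moreover have "[\<theta> * (D4 * x2) = \<theta> * (2 - \<theta> * \<theta>)] (mod p)"
        using x2 by (intro cong_mult cong_refl)
      ultimately have "p dvd \<theta> * (2 - \<theta> * \<theta>)" using cong_dvd_iff by blast
      then show False using th small[of 1] small[of 4] by auto
    qed
    then have "eichler_in K C (q - \<theta> *\<^sub>Z b j)"
      using eichler_in_cancel[OF 2] CD qC by (simp add: B_lin)
    then show ?thesis by (simp add: q_def)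
  qed
  have right: "eichler_in K C (b (j + 4 + i))" if "j + 4 + i < N" for i
    using that
  proof (induction i)
    case 0
    then have i: "j + 3 < N" "j + 4 < N" by simp_all
    have "B (b (j + 3) - \<theta> *\<^sub>Z b j) (b (j + 4)) = - d (j + 3)"
      using i by (simp add: B_lin B_b)
    moreover have "\<not> p dvd - d (j + 3)" using i by (intro dnz) simp
    ultimately show ?case
      using eichler_in_next[OF K_sub _ right1[OF i(1)], of "v (j + 4)"] i CD farC[of "j + 4"] B3C[OF i(1)]
      by (simp add: B_lin)
  next
    case (Suc i)
    then have "B (b (j + 4 + i)) (b (j + 4 + Suc i)) = - d (j + 4 + i)"
      by (simp add: B_b)
    moreover have "\<not> p dvd - d (j + 4 + i)" using Suc.prems by (intro dnz) simp
    ultimately show ?case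
      using eichler_in_next[OF K_sub _ Suc.IH, of "v (j + 4 + Suc i)"] Suc.prems CD
        farC[of "j + 4 + i"] farC[of "j + 4 + Suc i"] by simp
  qed
  have all: "eichler_in K C x" if "supp_on K x" "[B x C = 0] (mod p)" for x
  proof (rule eichler_in_all[where \<alpha> = j and \<beta> = "j + 3" and m = \<theta>])
    fix i assume i: "i < N" "i \<noteq> j" "i \<noteq> j + 3"
    then consider "i = j + 1" | "i = j + 2" | "i < j" | "i \<ge> j + 4" by linarith
    then show "eichler_in K C (b i) \<and> B (b i) C = 0"
    proof cases
      case 1
      then show ?thesis using SC1[OF inK(2,3)] CD by simp
    next
      case 2
      then show ?thesis using SCe CD by (simp add: e_def)
    next
      case 3
      then show ?thesis using left[of "j - 1 - i"] farC i by simp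
    next
      case 4
      then show ?thesis using right[of "i - (j + 4)"] farC i by simp
    qed
  qed (use that N CD right1 B3C small[of 1] in auto)
  show ?thesis
  proof (rule full_if_E[where c = C and c' = D and e = e and k = "v j", OF K_sub inK(1)])
    show "supp_on K C" "supp_on K D" "supp_on K e"
      unfolding C_def D_def e_def by (intro supp_on_lin inK)+
    show "eichler_in K D e" by (rule SDe)
  qed (use CD all small[of 1] in auto)
qed

end

section \<open>Parabolic subgroups of finite type\<close>

context refl_rep
begin

text \<open>Otherwise squaring would be surjective on residues, hence injective, although 1 and
  \<open>p - 1\<close> have the same square.\<close>

lemma ex_nonsquare: "\<exists>nu. \<forall>t. \<not> [t * t = nu] (mod p)"
proof (rule ccontr)
  assume "\<nexists>nu. \<forall>t. \<not> [t * t = nu] (mod p)"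
  then have sq: "\<exists>t. [t * t = x] (mod p)" for x by blast
  let ?f = "\<lambda>t. t * t mod p"
  have "?f ` {0..<p} = {0..<p}"
  proof (intro equalityI subsetI)
    fix x assume x: "x \<in> {0..<p}"
    obtain t where "[t * t = x] (mod p)" using sq by blast
    then have "?f (t mod p) = x" using x by (simp add: cong_def mod_mult_eq)
    moreover have "t mod p \<in> {0..<p}" using p_pos by simp
    ultimately show "x \<in> ?f ` {0..<p}" by blast
  qed (use p_pos in auto)
  then have inj: "inj_on ?f {0..<p}" by (intro eq_card_imp_inj_on) auto
  have eq: "?f 1 = ?f (p - 1)"
  proof -
    have "(p - 1) * (p - 1) = 1 + p * (p - 2)" by (simp add: algebra_simps)
    then show ?thesis by (metis mod_mult_self2 mult_1)
  qed
  have "1 = p - 1" by (rule inj_onD[OF inj eq]) (use p_gt_2 in simp_all)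
  then show False using p_gt_2 by simp
qed

end

context path
begin

text \<open>The coordinates vanish one after another from node 0 on: the product with
  \<open>b m\<close> involves only the coordinate at \<open>m + 1\<close> once the lower ones are
  gone.\<close>

lemma path_nondeg:
  assumes d: "\<And>i. Suc i < N \<Longrightarrow> \<not> p dvd d i"
    and z: "supp_on (v ` {1..<N}) z" "\<And>i. i < N \<Longrightarrow> p dvd B z (b i)"
  shows "z \<approx> 0"
proof -
  have "supp_on (v ` {Suc m..<N}) z" if "Suc m \<le> N \<or> m = 0" for m
    using that
  proof (induction m)
    case (Suc m)
    then have m: "Suc m < N" by simp
    then have IH: "supp_on (v ` {Suc m..<N}) z" using Suc by simp
    let ?t = "\<lambda>j. coord z j * A j (v m)"
    have "p dvd (\<Sum>j\<in>{..<n} - {v (Suc m)}. ?t j)"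
    proof (rule dvd_sum)
      fix j assume j: "j \<in> {..<n} - {v (Suc m)}"
      show "p dvd ?t j"
      proof (cases "j \<in> v ` {Suc m..<N}")
        case True
        then obtain i where i: "j = v i" "Suc m \<le> i" "i < N" by auto
        then have "i \<noteq> Suc m" using j by auto
        then show ?thesis using i m by (simp add: A_path)
      next
        case False
        then show ?thesis using IH by (simp add: supp_on_def)
      qed
    qed
    moreover have "B z (b m) = ?t (v (Suc m)) + (\<Sum>j\<in>{..<n} - {v (Suc m)}. ?t j)"
      using m v_less[of m] v_less[of "Suc m"]
      by (subst B_bas_right) (auto simp: sum.remove[of _ "v (Suc m)"])
    ultimately have "p dvd ?t (v (Suc m))"
      using z(2)[of m] m by (simp add: dvd_add_left_iff)
    then have 1: "p dvd coord z (v (Suc m))"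
      using m d[OF m] prime_p by (simp add: A_path prime_dvd_mult_iff)
    show ?case
      unfolding supp_on_def
    proof (intro allI impI)
      fix i assume i: "i \<notin> v ` {Suc (Suc m)..<N}"
      show "p dvd coord z i"
      proof (cases "i = v (Suc m)")
        case False
        have "i \<notin> v ` {Suc m..<N}"
        proof
          assume "i \<in> v ` {Suc m..<N}"
          then obtain q where q: "i = v q" "Suc m \<le> q" "q < N" by auto
          then have "q \<noteq> Suc m" using False by auto
          then have "i \<in> v ` {Suc (Suc m)..<N}" using q by auto
          then show False using i by simp
        qed
        then show ?thesis using IH by (simp add: supp_on_def)
      qed (use 1 in simp)
    qed
  qed (use z(1) in simp)
  from this[of "N - 1"] have "supp_on {} z" by (cases N) auto
  then show ?thesis by (simp add: supp_on_def veq_def cong_0_iff)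
qed

section \<open>Braid relations and cosets when every bond has order 3 modulo
  \<open>p\<close>\<close>

lemma R_commute:
  assumes "i < N" "j < N" "i + 2 \<le> j \<or> j + 2 \<le> i"
  shows "R 1 (b i) (R 1 (b j) x) = R 1 (b j) (R 1 (b i) x)"
  using assms by (intro coord_ext) (auto simp: R_def B_lin B_b algebra_simps)

text \<open>Since \<open>d i\<close> is 1 or -1 modulo \<open>p\<close>, each of the two reflections
  sends the other's root to the same root up to sign, so the two conjugates coincide.\<close>

lemma R_braid:
  assumes i: "Suc i < N" and d: "[d i * d i = 1] (mod p)"
  shows "R 1 (b i) (R 1 (b (Suc i)) (R 1 (b i) x)) \<approx> R 1 (b (Suc i)) (R 1 (b i) (R 1 (b (Suc i)) x))"
proof -
  have norm: "[1 * B (b j) (b j) = 2] (mod p)" if "j < N" for j using that by (simp add: B_b)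
  define y where "y = R 1 (b i) (b (Suc i))"
  have y: "y = b (Suc i) + d i *\<^sub>Z b i"
    using i by (intro coord_ext) (simp add: y_def R_def B_b)
  have "R 1 (b i) (R 1 (b (Suc i)) (R 1 (b i) x)) \<approx> R 1 y x"
    unfolding y_def using i by (intro R_conj norm) simp
  also have "\<dots> \<approx> R (1 * d i * d i) y x"
    using cong_sym[OF d] by (intro R_veq veq_refl) simp
  also have "\<dots> = R 1 (d i *\<^sub>Z y) x" by (simp add: R_scale)
  also have "\<dots> \<approx> R 1 (R 1 (b (Suc i)) (b i)) x"
  proof (intro R_veq veq_refl cong_refl)
    have "d i *\<^sub>Z y = d i *\<^sub>Z b (Suc i) + (d i * d i) *\<^sub>Z b i"
      unfolding y by (rule coord_ext) (simp add: algebra_simps)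
    also have "\<dots> \<approx> d i *\<^sub>Z b (Suc i) + 1 *\<^sub>Z b i"
      by (rule veq_add[OF veq_refl veq_smul[OF d veq_refl]])
    also have "\<dots> = R 1 (b (Suc i)) (b i)"
      using i by (intro coord_ext) (simp add: R_def B_b)
    finally show "d i *\<^sub>Z y \<approx> R 1 (b (Suc i)) (b i)" .
  qed
  also have "\<dots> \<approx> R 1 (b (Suc i)) (R 1 (b i) (R 1 (b (Suc i)) x))"
    by (rule veq_sym, rule R_conj, rule norm[OF i])
  finally show ?thesis .
qed

text \<open>Representatives of the cosets of the parabolic subgroup of \<open>v ` {1..<N}\<close>.\<close>

primrec W :: "nat \<Rightarrow> ivec \<Rightarrow> ivec" where
  "W 0 x = x"
| "W (Suc j) x = R 1 (b j) (W j x)"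

lemma W_commute: "i < N \<Longrightarrow> j < i \<Longrightarrow> R 1 (b i) (W j x) = W j (R 1 (b i) x)"
proof (induction j)
  case (Suc j)
  then show ?case using R_commute[of i j "W j x"] by simp
qed simp

lemma W_shift:
  assumes d: "\<And>i. Suc i < N \<Longrightarrow> [d i * d i = 1] (mod p)"
  shows "i + 2 + j \<le> N \<Longrightarrow> R 1 (b i) (W (i + 2 + j) x) \<approx> W (i + 2 + j) (R 1 (b (Suc i)) x)"
proof (induction j)
  case 0
  then have i: "Suc i < N" by simp
  have "R 1 (b i) (W (i + 2) x) = R 1 (b i) (R 1 (b (Suc i)) (R 1 (b i) (W i x)))" by simp
  also have "\<dots> \<approx> R 1 (b (Suc i)) (R 1 (b i) (R 1 (b (Suc i)) (W i x)))"
    by (rule R_braid[OF i d[OF i]])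
  also have "\<dots> = W (i + 2) (R 1 (b (Suc i)) x)"
    using W_commute[of "Suc i" i x] i by simp
  finally show ?case by simp
next
  case (Suc j)
  have "R 1 (b i) (W (i + 2 + Suc j) x) = R 1 (b (i + 2 + j)) (R 1 (b i) (W (i + 2 + j) x))"
    using R_commute[of i "i + 2 + j"] Suc.prems by simp
  also have "\<dots> \<approx> R 1 (b (i + 2 + j)) (W (i + 2 + j) (R 1 (b (Suc i)) x))"
    using Suc by (intro R_veq veq_refl cong_refl) simp
  finally show ?case by simp
qed

text \<open>Left multiplication by a generator lengthens or shortens the representative, or passes
  through it, keeping its index \<open>i\<close> or becoming \<open>Suc i\<close>. In each case the
  remaining letter avoids node 0.\<close>

lemma W_step:
  assumes d: "\<And>i. Suc i < N \<Longrightarrow> [d i * d i = 1] (mod p)" and "i < N" "j \<le> N"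
  shows "\<exists>j'\<le>N. \<exists>h\<in>lists (v ` {1..<N}). \<forall>x. R 1 (b i) (W j x) \<approx> W j' (act h x)"
proof -
  consider "i = j" | "Suc i = j" | "j < i" | "i + 2 \<le> j" by linarith
  then show ?thesis
  proof cases
    case 1
    then show ?thesis using assms(2) by (intro exI[of _ "Suc j"] conjI bexI[of _ "[]"]) auto
  next
    case 2
    have "R 1 (b i) (R 1 (b i) y) = y" for y using R_bas_invol[OF v_less[OF assms(2)]] .
    then show ?thesis using 2 assms by (intro exI[of _ i] conjI bexI[of _ "[]"]) auto
  next
    case 3
    then show ?thesis using W_commute[OF assms(2) 3] assms
      by (intro exI[of _ j] conjI bexI[of _ "[v i]"]) auto
  next
    case 4
    then obtain q where q: "j = i + 2 + q" using le_Suc_ex by blast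
    have "R 1 (b i) (W j x) \<approx> W j (act [v (Suc i)] x)" for x
      unfolding act.simps q by (rule W_shift[OF d]) (use q assms(3) in auto)
    then show ?thesis using 4 assms(3)
      by (intro exI[of _ j] conjI bexI[of _ "[v (Suc i)]"]) auto
  qed
qed

lemma W_cosets:
  assumes d: "\<And>i. Suc i < N \<Longrightarrow> [d i * d i = 1] (mod p)" and w: "w \<in> lists K"
  shows "\<exists>j\<le>N. \<exists>h\<in>lists (v ` {1..<N}). \<forall>x. act w x \<approx> W j (act h x)"
  using w
proof (induction w)
  case Nil
  show ?case by (intro exI[of _ 0] conjI bexI[of _ "[]"]) auto
next
  case (Cons k w)
  then obtain j h where j: "j \<le> N" "h \<in> lists (v ` {1..<N})" "\<And>x. act w x \<approx> W j (act h x)"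
    by auto
  obtain i where i: "i < N" "k = v i" using Cons by auto
  obtain j' h' where j': "j' \<le> N" "h' \<in> lists (v ` {1..<N})" "\<And>x. R 1 (b i) (W j x) \<approx> W j' (act h' x)"
    using W_step[OF d i(1) j(1)] by blast
  have "act (k # w) x \<approx> W j' (act (h' @ h) x)" for x
  proof -
    have "R 1 (b i) (act w x) \<approx> R 1 (b i) (W j (act h x))"
      by (intro R_veq j(3) veq_refl cong_refl)
    also note j'(3)
    finally show ?thesis by (simp add: act_append i)
  qed
  moreover have "h' @ h \<in> lists (v ` {1..<N})" using j' j by simp
  ultimately show ?case using j'(1) by blast
qed

text \<open>The reflection at node 0 occurs once and is applied first, negating \<open>b 0\<close>;
  the later ones do not touch this coordinate.\<close>

lemma coord_W: "0 < j \<Longrightarrow> j \<le> N \<Longrightarrow> coord (W j (b 0)) (v 0) = - 1"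
proof (induction j)
  case (Suc j)
  show ?case
  proof (cases "j = 0")
    case True
    then show ?thesis using Suc by (simp add: R_def B_b coord_bas)
  next
    case False
    then have "coord (b j) (v 0) = 0"
      using v_eq[of j 0] Suc by (auto simp: coord_bas)
    then show ?thesis using Suc False by (simp add: R_def)
  qed
qed simp

theorem finite_type_inG:
  assumes N: "0 < N" and d: "\<And>i. Suc i < N \<Longrightarrow> [d i * d i = 1] (mod p)"
    and w: "w \<in> lists K" "\<And>x. supp_on (v ` {1..<N}) (act w x - x)"
  shows "inG (v ` {1..<N}) (act w)"
proof -
  obtain j h where j: "j \<le> N" "h \<in> lists (v ` {1..<N})" "\<And>x. act w x \<approx> W j (act h x)"
    using W_cosets[OF d w(1)] by blast
  have sub: "v ` {1..<N} \<subseteq> {..<n}" using v_less by auto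
  have hn: "h \<in> lists {..<n}" using j(2) lists_mono[OF sub] by blast
  \<comment> \<open>The test vector is the preimage of \<open>b 0\<close> under \<open>h\<close>,
    whose coordinate at \<open>v 0\<close> is 1. Its image has coordinate -1 there, yet node 0 lies
    outside the support of the displacement, and 2 is invertible.\<close>
  have "j = 0"
  proof (rule ccontr)
    assume "j \<noteq> 0"
    define x where "x = act (rev h) (b 0)"
    have "supp_on (v ` {1..<N}) (x - b 0)"
      unfolding x_def by (rule act_diff_supp) (use j(2) in \<open>auto simp: in_lists_conv_set\<close>)
    moreover have "act w x - x \<approx> W j (b 0) - x"
      using j(3)[of x] act_rev2[OF hn] by (intro veq_diff veq_refl) (simp add: x_def)
    then have "supp_on (v ` {1..<N}) (W j (b 0) - x)"
      using w(2) supp_on_veq by blast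
    ultimately have "supp_on (v ` {1..<N}) ((W j (b 0) - x) + (x - b 0))"
      by (intro supp_on_add)
    moreover have "v 0 \<notin> v ` {1..<N}"
    proof
      assume "v 0 \<in> v ` {1..<N}"
      then obtain i where "v 0 = v i" "1 \<le> i" "i < N" by auto
      then show False using v_eq[of 0 i] N by simp
    qed
    ultimately have "p dvd coord ((W j (b 0) - x) + (x - b 0)) (v 0)"
      by (simp only: supp_on_def not_False_eq_True)
    then have "p dvd - 2" using coord_W[of j] \<open>j \<noteq> 0\<close> j(1) by (simp add: coord_bas)
    then show False using not_p_dvd_2 by simp
  qed
  then have "act h x \<approx> act w x" for x using veq_sym[OF j(3)] by simp
  then show ?thesis using j(2) by (auto simp: inG_def)
qed

lemma full_path_inG:
  assumes full: "full (v ` {1..<N})" and d: "\<And>i. Suc i < N \<Longrightarrow> \<not> p dvd d i" and N: "0 < N"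
    and w: "w \<in> lists {..<n}" "\<And>x. supp_on (v ` {1..<N}) (act w x - x)"
  shows "inG (v ` {1..<N}) (act w)"
proof (rule full_imp_inG[OF full _ w])
  show "v ` {1..<N} \<subseteq> {..<n}" using v_less by auto
  fix z assume z: "supp_on (v ` {1..<N}) z" "\<And>k. k \<in> v ` {1..<N} \<Longrightarrow> p dvd B z (bas k)" "p dvd B z (b 0)"
  show "z \<approx> 0"
  proof (rule path_nondeg[OF d z(1)])
    fix i assume "i < N"
    then show "p dvd B z (b i)" using z(2)[of "v i"] z(3) by (cases "i = 0") auto
  qed
qed

end

section \<open>The reduced Coxeter groups\<close>

lemma mod_mat_carrier_mat [simp]: "A \<in> carrier_mat a b \<Longrightarrow> mod_mat p A \<in> carrier_mat a b"
  by (simp add: mod_mat_def)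

lemma mod_mat_eq_iff:
  assumes "A \<in> carrier_mat n n" "C \<in> carrier_mat n n"
  shows "mod_mat p A = mod_mat p C \<longleftrightarrow> (\<forall>a<n. \<forall>j<n. [A $$ (a, j) = C $$ (a, j)] (mod int p))"
proof
  assume eq: "mod_mat p A = mod_mat p C"
  show "\<forall>a<n. \<forall>j<n. [A $$ (a, j) = C $$ (a, j)] (mod int p)"
  proof (intro allI impI)
    fix a j assume aj: "a < n" "j < n"
    have "mod_mat p A $$ (a, j) = mod_mat p C $$ (a, j)" by (simp only: eq)
    then show "[A $$ (a, j) = C $$ (a, j)] (mod int p)"
      using aj assms by (simp add: mod_mat_def cong_def)
  qed
next
  assume "\<forall>a<n. \<forall>j<n. [A $$ (a, j) = C $$ (a, j)] (mod int p)"
  then show "mod_mat p A = mod_mat p C"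
    using assms by (intro eq_matI) (auto simp: mod_mat_def cong_def)
qed

text \<open>The bond between \<open>i\<close> and \<open>Suc i\<close>, so the \<open>j\<close>-th
  period belongs to the index \<open>j - 1\<close>.\<close>

definition bond :: "nat \<Rightarrow> nat \<Rightarrow> nat \<Rightarrow> int"
  where "bond k l i = (if k \<le> i \<and> i < k + l then 2 else 1)"

lemma cartan_bond: "cartan k l m i j =
    (if i = j then 2 else if j = Suc i then - bond k l i else if i = Suc j then - bond k l j else 0)"
  by (auto simp: cartan_def period_def bond_def max_def)

locale coxeter_mod =
  refl_nu "cox_rank k l m" "cartan k l m" "int p" nu s
  for k l m p :: nat and nu s :: int
begin

notation veq (infix "\<approx>" 50)

section \<open>Words, matrices and generated subgroups\<close>

abbreviation rank :: nat where "rank \<equiv> cox_rank k l m"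

definition word_mat :: "nat list \<Rightarrow> int mat"
  where "word_mat w = foldr (\<lambda>i X. int_refl k l m i * X) w (1\<^sub>m rank)"

lemma word_mat_simps: "word_mat [] = 1\<^sub>m rank" "word_mat (i # w) = int_refl k l m i * word_mat w"
  by (simp_all add: word_mat_def)

lemma word_mat_carrier [simp]: "word_mat w \<in> carrier_mat rank rank"
  by (induction w) (auto simp: word_mat_simps intro: mult_carrier_mat)

lemma word_mat_append: "word_mat (u @ w) = word_mat u * word_mat w"
proof (induction u)
  case (Cons i u)
  have "word_mat ((i # u) @ w) = int_refl k l m i * (word_mat u * word_mat w)"
    using Cons by (simp add: word_mat_simps)
  also have "\<dots> = int_refl k l m i * word_mat u * word_mat w"
    by (rule assoc_mult_mat[symmetric, OF int_refl_carrier word_mat_carrier word_mat_carrier])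
  finally show ?case by (simp add: word_mat_simps)
qed (simp add: word_mat_simps left_mult_one_mat[OF word_mat_carrier])

lemma coord_act:
  assumes "w \<in> lists {..<rank}" "a < rank"
  shows "coord (act w x) a = (\<Sum>j<rank. word_mat w $$ (a, j) * coord x j)"
  using assms
proof (induction w arbitrary: a)
  case Nil
  have "(\<Sum>j<rank. word_mat [] $$ (a, j) * coord x j) = (\<Sum>j<rank. if j = a then coord x j else 0)"
    using Nil by (intro sum.cong) (auto simp: word_mat_simps)
  then show ?case using Nil by simp
next
  case (Cons i w)
  then have i: "i < rank" and IH: "\<And>a. a < rank \<Longrightarrow> coord (act w x) a = (\<Sum>j<rank. word_mat w $$ (a, j) * coord x j)"
    by auto
  have c: "word_mat w \<in> carrier_mat rank rank" by simp
  have "coord (act (i # w) x) a = (\<Sum>c<rank. int_refl k l m i $$ (a, c) * coord (act w x) c)"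
  proof -
    have "(\<Sum>c<rank. int_refl k l m i $$ (a, c) * coord (act w x) c)
      = (\<Sum>c<rank. (if c = a then coord (act w x) c else 0) - (if a = i then coord (act w x) c * cartan k l m c i else 0))"
      using Cons.prems i by (intro sum.cong) (auto simp: int_refl_entry algebra_simps)
    then show ?thesis
      using Cons.prems i by (simp add: sum_subtractf R_def B_bas_right coord_bas)
  qed
  also have "\<dots> = (\<Sum>c<rank. \<Sum>j<rank. int_refl k l m i $$ (a, c) * word_mat w $$ (c, j) * coord x j)"
    by (intro sum.cong refl) (simp add: IH sum_distrib_left mult.assoc)
  also have "\<dots> = (\<Sum>j<rank. (\<Sum>c<rank. int_refl k l m i $$ (a, c) * word_mat w $$ (c, j)) * coord x j)"
    by (subst sum.swap) (simp add: sum_distrib_right)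
  also have "\<dots> = (\<Sum>j<rank. word_mat (i # w) $$ (a, j) * coord x j)"
    using Cons.prems carrier_matD[OF c]
    by (intro sum.cong refl) (simp add: word_mat_simps scalar_prod_def atLeast0LessThan)
  finally show ?case .
qed

text \<open>The bridge from matrices to maps. Columns are the images of the basis vectors;
  coordinates from \<open>rank\<close> on are never moved.\<close>

lemma mod_IM_eq_iff:
  assumes "u \<in> lists {..<rank}" "w \<in> lists {..<rank}"
  shows "mod_mat p (word_mat u) = mod_mat p (word_mat w) \<longleftrightarrow> (\<forall>x. act u x \<approx> act w x)"
proof
  assume eq: "mod_mat p (word_mat u) = mod_mat p (word_mat w)"
  show "\<forall>x. act u x \<approx> act w x"
    unfolding veq_def
  proof (intro allI)
    fix x a
    show "[coord (act u x) a = coord (act w x) a] (mod int p)"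
    proof (cases "a < rank")
      case True
      have "[word_mat u $$ (a, j) = word_mat w $$ (a, j)] (mod int p)" if "j < rank" for j
        using eq that True mod_mat_eq_iff[of "word_mat u" rank "word_mat w" p] by simp
      then show ?thesis
        unfolding coord_act[OF assms(1) True] coord_act[OF assms(2) True]
        by (intro cong_sum cong_mult cong_refl) simp
    next
      case False
      then have "[coord (act u x) a = coord x a] (mod int p)" "[coord (act w x) a = coord x a] (mod int p)"
        using act_diff_supp[OF assms(1), of x] act_diff_supp[OF assms(2), of x]
        by (simp_all add: supp_on_def cong_iff_dvd_diff)
      then show ?thesis using cong_trans cong_sym by blast
    qed
  qed
next
  assume eq: "\<forall>x. act u x \<approx> act w x"
  have entry: "coord (act w' (bas j)) a = word_mat w' $$ (a, j)" if "w' \<in> lists {..<rank}" "a < rank" "j < rank" for w' a j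
  proof -
    have "(\<Sum>i<rank. word_mat w' $$ (a, i) * coord (bas j) i) = (\<Sum>i<rank. if i = j then word_mat w' $$ (a, i) else 0)"
      by (intro sum.cong) (auto simp: coord_bas)
    then show ?thesis using that by (simp add: coord_act)
  qed
  have "[word_mat u $$ (a, j) = word_mat w $$ (a, j)] (mod int p)" if "a < rank" "j < rank" for a j
    using eq entry[OF assms(1) that] entry[OF assms(2) that] unfolding veq_def by metis
  then show "mod_mat p (word_mat u) = mod_mat p (word_mat w)"
    by (subst mod_mat_eq_iff[of _ rank]) simp_all
qed

lemma p_pos': "p > 0"
  using p_pos by simp

lemma GL_simps: "x \<otimes>\<^bsub>GL rank p\<^esub> y = mod_mat p (x * y)" "\<one>\<^bsub>GL rank p\<^esub> = mod_mat p (1\<^sub>m rank)"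
  by (simp_all add: GL_def units_of_def mat_monoid_def)

text \<open>The generators are involutions, so words without inverses suffice.\<close>

lemma generate_eq:
  assumes I: "I \<subseteq> {..<rank}"
  shows "generate (GL rank p) (red_refl k l m p ` I) = (\<lambda>w. mod_mat p (word_mat w)) ` lists I"
proof
  interpret G: group "GL rank p" by (rule group_GL[OF p_pos'])
  show "generate (GL rank p) (red_refl k l m p ` I) \<subseteq> (\<lambda>w. mod_mat p (word_mat w)) ` lists I"
  proof
    have single: "red_refl k l m p i = mod_mat p (word_mat [i])" for i
      by (simp add: word_mat_simps red_refl_int_refl right_mult_one_mat[OF int_refl_carrier])
    fix g assume "g \<in> generate (GL rank p) (red_refl k l m p ` I)"
    then show "g \<in> (\<lambda>w. mod_mat p (word_mat w)) ` lists I"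
    proof (induction rule: generate.induct)
      case one
      show ?case by (rule image_eqI[of _ _ "[]"]) (simp_all add: GL_simps word_mat_simps)
    next
      case (incl h)
      then obtain i where "i \<in> I" "h = red_refl k l m p i" by auto
      then show ?case by (intro image_eqI[of _ _ "[i]"]) (simp_all add: single)
    next
      case (inv h)
      then obtain i where i: "i \<in> I" "h = red_refl k l m p i" by auto
      then have i': "i < rank" using I by auto
      have "inv\<^bsub>GL rank p\<^esub> h = h"
        unfolding i using red_refl_involution[OF i', of p] red_refl_carrier[OF i' p_pos']
        by (intro G.inv_equality)
      then show ?case using i by (intro image_eqI[of _ _ "[i]"]) (simp_all add: single)
    next
      case (eng h1 h2)
      then obtain u w where "u \<in> lists I" "w \<in> lists I" "h1 = mod_mat p (word_mat u)" "h2 = mod_mat p (word_mat w)"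
        by auto
      then show ?case
        by (intro image_eqI[of _ _ "u @ w"])
          (simp_all add: GL_simps word_mat_append mod_mat_mult[where n = rank])
    qed
  qed
  show "(\<lambda>w. mod_mat p (word_mat w)) ` lists I \<subseteq> generate (GL rank p) (red_refl k l m p ` I)"
  proof (rule image_subsetI)
    fix w assume "w \<in> lists I"
    then show "mod_mat p (word_mat w) \<in> generate (GL rank p) (red_refl k l m p ` I)"
    proof (induction w)
      case Nil
      show ?case using generate.one[of "GL rank p"] by (simp add: word_mat_simps GL_simps)
    next
      case (Cons i w)
      then have "red_refl k l m p i \<otimes>\<^bsub>GL rank p\<^esub> mod_mat p (word_mat w) \<in> generate (GL rank p) (red_refl k l m p ` I)"
        by (intro generate.eng[OF generate.incl]) auto
      then show ?case
        by (simp add: GL_simps word_mat_simps red_refl_int_refl mod_mat_mult[where n = rank])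
    qed
  qed
qed

section \<open>Intervals of nodes as paths in both directions\<close>

lemma path_up:
  assumes "x + N \<le> rank"
  shows "path rank (cartan k l m) (int p) nu s (\<lambda>i. x + i) N (\<lambda>i. bond k l (x + i))"
  by unfold_locales (use assms in \<open>auto simp: cartan_bond inj_on_def\<close>)

lemma path_down:
  assumes "y < rank" "N \<le> Suc y"
  shows "path rank (cartan k l m) (int p) nu s (\<lambda>i. y - i) N (\<lambda>i. bond k l (y - Suc i))"
proof unfold_locales
  fix i j assume "i < N" "j < N"
  then have "i \<le> y" "j \<le> y" using assms by auto
  then have eqs: "y - i = y - j \<longleftrightarrow> i = j" "y - j = Suc (y - i) \<longleftrightarrow> i = Suc j" "y - i = Suc (y - j) \<longleftrightarrow> j = Suc i"
    by presburger+
  show "cartan k l m (y - i) (y - j) =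
      (if i = j then 2 else if j = Suc i then - bond k l (y - Suc i)
       else if i = Suc j then - bond k l (y - Suc j) else 0)"
    unfolding cartan_bond eqs by (cases "i = j"; cases "i = Suc j"; simp)
next
  show "inj_on (\<lambda>i. y - i) {..<N}"
    using assms(2) by (intro inj_onI) auto
qed (use assms in linarith)

lemma image_down: "N \<le> Suc y \<Longrightarrow> q \<le> N \<Longrightarrow> (\<lambda>i. y - i) ` {q..<N} = {Suc y - N..<Suc y - q}" for y N q :: nat
proof (intro equalityI subsetI)
  fix z assume "N \<le> Suc y" "q \<le> N" "z \<in> {Suc y - N..<Suc y - q}"
  then have "z = y - (y - z)" "y - z \<in> {q..<N}" by auto
  then show "z \<in> (\<lambda>i. y - i) ` {q..<N}" by blast
qed auto

lemma image_up: "(\<lambda>i. x + i) ` {q..<N} = {x + q..<x + N}" for x q N :: nat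
proof (intro equalityI subsetI)
  fix z assume "z \<in> {x + q..<x + N}"
  then have "z = x + (z - x)" "z - x \<in> {q..<N}" by auto
  then show "z \<in> (\<lambda>i. x + i) ` {q..<N}" by blast
qed auto

lemma bond_cases: "bond k l i = 1 \<or> bond k l i = 2"
  by (simp add: bond_def)

lemma bond_nonzero: "\<not> int p dvd bond k l i"
  using bond_cases[of i] not_p_dvd_2 p_gt_2 zdvd_imp_le[of "int p" 1] by auto

lemma full_interval:
  assumes l: "l \<ge> 1" and xy: "x \<le> y" "y < rank"
    and inf: "x < k + l" "k < y \<or> x = y"
    and p: "p > 3" "k \<le> x \<and> y \<le> k + l \<or> p > 17"
  shows "full {x..y}"
proof -
  consider "x = y" | "y = Suc x" "k \<le> x" "y \<le> k + l" | "x + 2 \<le> y" "k \<le> x" "y \<le> k + l"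
    | "x < y" "x < k" | "x < y" "k + l < y"
    using xy by linarith
  then show ?thesis
  proof cases
    case 1
    then show ?thesis using full_single[of x] xy by simp
  next
    case 2
    have "full {x, Suc x}"
      using 2 xy by (intro full_dihedral) (auto simp: cartan_bond bond_def)
    moreover have "{x..y} = {x, Suc x}" using 2 by auto
    ultimately show ?thesis by simp
  next
    case 3
    interpret P: path rank "cartan k l m" "int p" nu s "\<lambda>i. x + i" "Suc y - x" "\<lambda>i. bond k l (x + i)"
      by (rule path_up) (use xy in simp)
    have "full P.K" by (rule P.full_infinity) (use 3 p in \<open>auto simp: bond_def\<close>)
    moreover have "P.K = {x..y}"
      using image_up[of x 0 "Suc y - x"] xy by (simp add: atLeast0LessThan atLeastLessThanSuc_atLeastAtMost)
    ultimately show ?thesis by simp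
  next
    case 4
    then have ky: "k < y" and p17: "p > 17" using inf p by auto
    interpret P: path rank "cartan k l m" "int p" nu s "\<lambda>i. x + i" "Suc y - x" "\<lambda>i. bond k l (x + i)"
      by (rule path_up) (use xy in simp)
    have "full P.K"
      \<comment> \<open>This index points to the bond between \<open>k - 1\<close> and
        \<open>k\<close>, the last of order 3 before the infinite ones.\<close>
      by (rule P.full_three_infinity[where j = "k - 1 - x"])
        (use 4 ky p17 inf bond_cases l xy in \<open>auto simp: bond_def\<close>)
    moreover have "P.K = {x..y}"
      using image_up[of x 0 "Suc y - x"] xy by (simp add: atLeast0LessThan atLeastLessThanSuc_atLeastAtMost)
    ultimately show ?thesis by simp
  next
    case 5
    then have ky: "k < y" and p17: "p > 17" using inf p by auto
    interpret P: path rank "cartan k l m" "int p" nu s "\<lambda>i. y - i" "Suc y - x" "\<lambda>i. bond k l (y - Suc i)"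
      by (rule path_down) (use xy in simp_all)
    have "full P.K"
      \<comment> \<open>Read from the right end, this is the bond between \<open>k + l + 1\<close>
        and \<open>k + l\<close>, followed by an infinite one.\<close>
      by (rule P.full_three_infinity[where j = "y - 1 - (k + l)"])
        (use 5 ky p17 inf bond_cases l xy in \<open>auto simp: bond_def\<close>)
    moreover have "P.K = {x..y}"
      using image_down[of "Suc y - x" y 0] xy by (simp add: atLeast0LessThan atLeastLessThanSuc_atLeastAtMost)
    ultimately show ?thesis by simp
  qed
qed

text \<open>The displacement of \<open>act w\<close> is confined to both intervals, hence to their
  overlap. The coset argument may be run from either end of the path, according to which side has
  only bonds of order 3 modulo \<open>p\<close>.\<close>

lemma interval_inG:
  assumes klm: "k \<ge> 1" "l \<ge> 1" "m \<ge> 1" and p: "p = 3 \<or> k = 1 \<and> m = 1 \<or> p > 17"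
    and ac: "a < c" "c < rank"
    and w: "w \<in> lists {a..<c}" "w' \<in> lists {Suc a..c}" "\<And>x. act w x \<approx> act w' x"
  shows "inG {Suc a..<c} (act w)"
proof -
  have supp: "supp_on {Suc a..<c} (act w x - x)" for x
  proof -
    have 1: "supp_on {a..<c} (act w x - x)" by (rule act_diff_supp[OF w(1)])
    have "supp_on {Suc a..c} (act w x - x)"
      by (rule supp_on_veq[OF act_diff_supp[OF w(2)] veq_diff[OF veq_sym[OF w(3)] veq_refl]])
    with 1 show ?thesis
      unfolding supp_on_def by (metis atLeastAtMost_iff atLeastLessThan_iff less_imp_le)
  qed
  have supp': "supp_on {Suc a..<c} (act w' x - x)" for x
    by (rule supp_on_veq[OF supp veq_diff[OF w(3) veq_refl]])
  interpret U: path rank "cartan k l m" "int p" nu s "\<lambda>i. a + i" "c - a" "\<lambda>i. bond k l (a + i)"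
    by (rule path_up) (use ac in simp)
  interpret D: path rank "cartan k l m" "int p" nu s "\<lambda>i. c - i" "c - a" "\<lambda>i. bond k l (c - Suc i)"
    by (rule path_down) (use ac in simp_all)
  have UK: "(\<lambda>i. a + i) ` {1..<c - a} = {Suc a..<c}" "U.K = {a..<c}"
    using image_up[of a 1 "c - a"] image_up[of a 0 "c - a"] ac by (simp_all add: atLeast0LessThan)
  have DK: "(\<lambda>i. c - i) ` {1..<c - a} = {Suc a..<c}" "D.K = {Suc a..c}"
    using image_down[of "c - a" c 1] image_down[of "c - a" c 0] ac
    by (simp_all add: atLeast0LessThan Suc_diff_le atLeastLessThanSuc_atLeastAtMost)
  have left: ?thesis if d: "\<And>i. Suc i < c - a \<Longrightarrow> [bond k l (a + i) * bond k l (a + i) = 1] (mod int p)"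
    using U.finite_type_inG[OF _ d, of w] w(1) supp ac unfolding UK by simp
  have right: ?thesis if d: "\<And>i. Suc i < c - a \<Longrightarrow> [bond k l (c - Suc i) * bond k l (c - Suc i) = 1] (mod int p)"
  proof -
    have "inG {Suc a..<c} (act w')"
      using D.finite_type_inG[OF _ d, of w'] w(2) supp' ac unfolding DK by simp
    then show ?thesis by (rule inG_cong) (rule veq_sym[OF w(3)])
  qed
  have wr: "w \<in> lists {..<rank}" using w(1) ac by (auto simp: in_lists_conv_set)
  have full: ?thesis if "full {Suc a..<c}"
    using U.full_path_inG[of w] that wr supp ac bond_nonzero unfolding UK by simp
  consider "p = 3" | "c = Suc a" | "c \<le> Suc k" | "k + l \<le> Suc a"
    | "p > 3" "Suc a < c" "k < c - 1 \<or> Suc a = c - 1" "Suc a < k + l"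
  proof -
    have "p > 3" if "p \<noteq> 3" using that p_gt_2 by simp
    then show ?thesis using that ac by linarith
  qed
  then show ?thesis
  proof cases
    case 1
    then show ?thesis by (intro left) (auto simp: bond_def cong_def)
  next
    case 2
    then show ?thesis by (intro left) auto
  next
    case 3
    then show ?thesis by (intro left) (auto simp: bond_def)
  next
    case 4
    then show ?thesis by (intro right) (auto simp: bond_def)
  next
    case 5
    have "{Suc a..<c} = {Suc a..c - 1}" using 5 by auto
    moreover have "full {Suc a..c - 1}"
    proof (rule full_interval)
      \<comment> \<open>For \<open>k = m = 1\<close> the nodes strictly between \<open>a\<close> and
        \<open>c\<close> avoid both ends of the diagram, so they lie between \<open>k\<close> and
        \<open>k + l\<close>.\<close>
      show "k \<le> Suc a \<and> c - 1 \<le> k + l \<or> p > 17"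
        using p 5(1) ac(2) by (auto simp: cox_rank_def)
    qed (use 5 ac klm in auto)
    ultimately show ?thesis using full by simp
  qed
qed

lemma reduction:
  assumes "k \<ge> 1" "l \<ge> 1" "m \<ge> 1" "p = 3 \<or> k = 1 \<and> m = 1 \<or> p > 17"
  shows "reduction_string_C k l m p"
proof -
  interpret G: string_gens "GL rank p" "red_refl k l m p" rank
    using group_GL[OF p_pos', of rank] red_refl_carrier[OF _ p_pos'] red_refl_commute
    by (auto intro!: string_gens.intro simp: string_gens_axioms_def)
  have S: "G.S I = (\<lambda>w. mod_mat p (word_mat w)) ` lists I" if "I \<subseteq> {..<rank}" for I
    unfolding G.S_def by (rule generate_eq[OF that])
  have "G.ip {..<rank}"
  proof (rule G.ip_all)
    fix a c assume ac: "a < c" "c < rank"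
    have sub: "{a..<c} \<subseteq> {..<rank}" "{Suc a..c} \<subseteq> {..<rank}" "{Suc a..<c} \<subseteq> {..<rank}"
      using ac by auto
    show "G.S {a..<c} \<inter> G.S {Suc a..c} \<subseteq> G.S {Suc a..<c}"
    proof
      fix g assume "g \<in> G.S {a..<c} \<inter> G.S {Suc a..c}"
      then obtain w w' where w: "w \<in> lists {a..<c}" "w' \<in> lists {Suc a..c}"
        "g = mod_mat p (word_mat w)" "g = mod_mat p (word_mat w')"
        unfolding S[OF sub(1)] S[OF sub(2)] by blast
      have wr: "w \<in> lists {..<rank}" "w' \<in> lists {..<rank}"
        using w sub(1,2) lists_mono by blast+
      have "act w x \<approx> act w' x" for x
        using mod_IM_eq_iff[OF wr] w(3,4) by simp
      from interval_inG[OF assms ac w(1,2) this]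
      obtain u where u: "u \<in> lists {Suc a..<c}" "\<forall>x. act u x \<approx> act w x"
        by (auto simp: inG_def)
      have ur: "u \<in> lists {..<rank}" using u(1) sub(3) lists_mono by blast
      have "g = mod_mat p (word_mat u)" using mod_IM_eq_iff[OF ur wr(1)] u(2) w(3) by simp
      then show "g \<in> G.S {Suc a..<c}" unfolding S[OF sub(3)] using u(1) by blast
    qed
  qed
  then have ip: "G.S I \<inter> G.S J \<subseteq> G.S (I \<inter> J)" if "I \<subseteq> {0..<rank}" "J \<subseteq> {0..<rank}" for I J
    using that unfolding G.ip_def atLeast0LessThan by blast
  have "G.S I \<inter> G.S J = G.S (I \<inter> J)" if "I \<subseteq> {0..<rank}" "J \<subseteq> {0..<rank}" for I J
    using ip[OF that] G.S_mono[of "I \<inter> J" I] G.S_mono[of "I \<inter> J" J] by blast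
  then show ?thesis
    unfolding reduction_string_C_def string_C_group_def G.S_def by blast
qed

end

lemma reduction_string_C:
  assumes klm: "k \<ge> 1" "l \<ge> 1" "m \<ge> 1" and p: "prime p" "odd p"
    and "p = 3 \<or> k = 1 \<and> m = 1 \<or> p > 17"
  shows "reduction_string_C k l m p"
proof -
  have "p \<noteq> 2" using p(2) by auto
  then have "p > 2" using prime_ge_2_nat[OF p(1)] by simp
  interpret V: refl_rep "cox_rank k l m" "cartan k l m" "int p"
    by unfold_locales (use p(1) \<open>p > 2\<close> in \<open>auto simp: cartan_bond\<close>)
  obtain nu where nu: "\<And>t. \<not> [t * t = nu] (mod int p)" using V.ex_nonsquare by blast
  have "\<not> int p dvd nu" using nu[of 0] by (simp add: cong_iff_dvd_diff)
  then obtain s where s: "[s * nu = 1] (mod int p)" by (rule V.inv_mod)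
  interpret coxeter_mod k l m p nu s
    by unfold_locales (rule nu s)+
  show ?thesis using assms by (intro reduction)
qed

theorem theorem3p3:
  fixes k l m :: nat
  assumes "k \<ge> 1" and "l \<ge> 1" and "m \<ge> 1"
  shows "(k = 1 \<and> m = 1 \<longrightarrow>
           (\<forall>p :: nat. prime p \<and> odd p \<and> \<not> (p = 7 \<and> l \<ge> 4 \<and> l mod 3 = 1) \<longrightarrow>
              reduction_string_C k l m p))
       \<and> (k > 1 \<or> m > 1 \<longrightarrow>
           finite {p :: nat. prime p \<and> odd p \<and> \<not> reduction_string_C k l m p})"
proof (intro conjI impI allI)
  fix p :: nat
  assume "k = 1 \<and> m = 1" "prime p \<and> odd p \<and> \<not> (p = 7 \<and> l \<ge> 4 \<and> l mod 3 = 1)"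
  then show "reduction_string_C k l m p" using assms by (intro reduction_string_C) auto
next
  \<comment> \<open>All exceptional primes of the general family lie below the single bound 17,
    whatever \<open>k\<close>, \<open>l\<close> and \<open>m\<close> are.\<close>
  have "{p :: nat. prime p \<and> odd p \<and> \<not> reduction_string_C k l m p} \<subseteq> {..17}"
    using reduction_string_C[OF assms] not_le by auto
  then show "finite {p :: nat. prime p \<and> odd p \<and> \<not> reduction_string_C k l m p}"
    by (rule finite_subset) simp
qed

end
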